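(* There exists a universal constant $C\ge 1$ such that the following two statements hold. (1) For every $m\ge 1$ and every matrix $B=(b_{i,j})_{i,j\le m}$ with $b_{i,j}\in\{0,1\}$ for all $i,j$, $$\mathbb{E}\|(b_{i,j}\varepsilon_{i,j})_{i,j\leq m}\|\le C\Big(\max_{1\leq i\leq m}\|(b_{i,j})_j\|_2+\max_{1\leq j\leq m}\|(b_{i,j})_i\|_2+R_B(\mathrm{Log}\, m)\Big).$$ (2) As a consequence, for every $n\ge 1$ and every $E\subset[n]\times[n]$, setting $$Q:=\max_{1\leq i\leq n}\|(\mathbf 1_E(i,j))_j\|_2+\max_{1\leq j\leq n}\|(\mathbf 1_E(i,j))_i\|_2+\max_{1\leq k\leq n}\ \min_{I\subset [n],\,|I|\leq k}\ \sup_{\|s\|_2,\|t\|_2\leq 1}\Big\|\sum_{i\notin I,\, j\notin I}\mathbf 1_E(i,j)\varepsilon_{i,j}s_it_j\Big\|_{\mathrm{Log}\, k},$$ one has $$C^{-1}Q\le \mathbb{E}\|(\mathbf 1_E(i,j)\varepsilon_{i,j})_{i,j\leq n}\|\le C\,Q.$$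
   Context: $[n]=\{1,\dots,n\}$. $(\varepsilon_{i,j})_{i,j\ge1}$ are i.i.d. symmetric $\pm1$ (Rademacher) random variables. For a real matrix $M$, $\|M\|$ denotes the operator (spectral) norm $\sup_{\|s\|_2,\|t\|_2\le1}\sum_{i,j}M_{i,j}s_it_j$. For vectors, $\|\cdot\|_2$ is the Euclidean norm; $(b_{i,j})_j$ is the $i$-th row and $(b_{i,j})_i$ the $j$-th column. $\mathrm{Log}\,x=\log(\max(x,e))$ (natural logarithm). For a real random variable $S$ and $p\ge1$, $\|S\|_p=(\mathbb E|S|^p)^{1/p}$. For a real matrix $A=(a_{i,j})$ and $p\ge 1$, $R_A(p):=\sup_{\|s\|_2\le1,\|t\|_2\le1}\big\|\sum_{i,j}a_{i,j}\varepsilon_{i,j}s_it_j\big\|_p$. $\mathbf 1_E$ is the indicator function of $E$. *)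

theory Defs
  imports "HOL-Probability.Probability"
begin

(* The i.i.d. Rademacher variables are realised as coordinate signs on a fair coin-tossing
   space, so that a constant quantified over statements about them is universal.
   Lemma rademacher_law_unique shows that every Rademacher array, on any probability space,
   has the same joint law. *)

definition rademacher_space :: "(nat \<times> nat \<Rightarrow> bool) measure" where
  "rademacher_space = (\<Pi>\<^sub>M ij\<in>UNIV. measure_pmf (bernoulli_pmf (1 / 2)))"

definition eps :: "nat \<Rightarrow> nat \<Rightarrow> (nat \<times> nat \<Rightarrow> bool) \<Rightarrow> real" where
  "eps i j \<omega> = (if \<omega> (i, j) then 1 else -1)"

definition rademacher_array :: "'a measure \<Rightarrow> (nat \<Rightarrow> nat \<Rightarrow> 'a \<Rightarrow> real) \<Rightarrow> bool" where
  "rademacher_array M X \<longleftrightarrow> prob_space M \<and>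
     prob_space.indep_vars M (\<lambda>_. borel) (\<lambda>(i, j). X i j) UNIV \<and>
     (\<forall>i j. measure M {\<omega> \<in> space M. X i j \<omega> = 1} = 1 / 2 \<and>
            measure M {\<omega> \<in> space M. X i j \<omega> = -1} = 1 / 2)"

lemma prob_space_rademacher_space: "prob_space rademacher_space"
  unfolding rademacher_space_def by (intro prob_space_PiM measure_pmf.prob_space_axioms)

lemma space_rademacher_space [simp]: "space rademacher_space = UNIV"
  by (simp add: rademacher_space_def space_PiM)

lemma measurable_coord [measurable]: "(\<lambda>\<omega>. \<omega> ij) \<in> rademacher_space \<rightarrow>\<^sub>M count_space UNIV"
proof -
  have "(\<lambda>\<omega>. \<omega> ij) \<in> (\<Pi>\<^sub>M ij\<in>UNIV. measure_pmf (bernoulli_pmf (1/2))) \<rightarrow>\<^sub>M measure_pmf (bernoulli_pmf (1/2))"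
    by (rule measurable_component_singleton) simp
  then show ?thesis by (simp add: rademacher_space_def)
qed

lemma distr_coord: "distr rademacher_space (measure_pmf (bernoulli_pmf (1/2))) (\<lambda>\<omega>. \<omega> ij)
    = measure_pmf (bernoulli_pmf (1/2))"
proof -
  interpret product_prob_space "\<lambda>_. measure_pmf (bernoulli_pmf (1/2))" UNIV
    by unfold_locales
  show ?thesis unfolding rademacher_space_def by (rule PiM_component) simp
qed

lemma measurable_eps [measurable]: "eps i j \<in> borel_measurable rademacher_space"
  unfolding eps_def by measurable

lemma rademacher_array_eps: "rademacher_array rademacher_space eps"
proof -
  interpret prob_space rademacher_space by (rule prob_space_rademacher_space)
  have "distr rademacher_space (\<Pi>\<^sub>M ij\<in>UNIV. measure_pmf (bernoulli_pmf (1/2))) (\<lambda>\<omega>. \<omega>) = rademacher_space"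
    unfolding rademacher_space_def by (rule distr_id)
  then have 1: "indep_vars (\<lambda>_. measure_pmf (bernoulli_pmf (1/2))) (\<lambda>ij \<omega>. \<omega> ij) UNIV"
    by (subst indep_vars_iff_distr_eq_PiM') (auto simp: distr_coord restrict_def rademacher_space_def[symmetric])
  have 2: "indep_vars (\<lambda>_. borel) (\<lambda>(i, j). eps i j) UNIV"
  proof -
    have "indep_vars (\<lambda>_. borel) (\<lambda>ij. (\<lambda>b. if b then 1 else -1 :: real) \<circ> (\<lambda>\<omega>. \<omega> ij)) UNIV"
      by (rule indep_vars_compose[OF 1]) simp
    then show ?thesis by (simp add: eps_def[abs_def] comp_def case_prod_beta')
  qed
  have 3: "prob {\<omega> \<in> space rademacher_space. \<omega> ij = b} = 1 / 2" for ij b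
  proof -
    have "prob {\<omega> \<in> space rademacher_space. \<omega> ij = b} =
       measure (distr rademacher_space (measure_pmf (bernoulli_pmf (1/2))) (\<lambda>\<omega>. \<omega> ij)) {b}"
      by (subst measure_distr) (auto simp: vimage_def)
    also have "\<dots> = 1 / 2" by (cases b) (simp_all add: distr_coord measure_pmf_single)
    finally show ?thesis .
  qed
  show ?thesis unfolding rademacher_array_def
    using prob_space_axioms 2 3[of _ True] 3[of _ False] by (auto simp: eps_def)
qed

lemma rademacher_marginal:
  assumes "prob_space M" "f \<in> borel_measurable M"
    "measure M {\<omega> \<in> space M. f \<omega> = 1} = 1 / 2" "measure M {\<omega> \<in> space M. f \<omega> = -1} = 1 / (2::real)"
  shows "distr M borel f = distr (measure_pmf (pmf_of_set {-1, 1::real})) borel (\<lambda>x. x)"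
proof (rule measure_eqI)
  interpret prob_space M by fact
  note [measurable] = assms(2)
  have ae: "AE \<omega> in M. f \<omega> = 1 \<or> f \<omega> = -1"
  proof -
    have "prob {\<omega> \<in> space M. f \<omega> = 1 \<or> f \<omega> = -1} =
       prob ({\<omega> \<in> space M. f \<omega> = 1} \<union> {\<omega> \<in> space M. f \<omega> = -1})"
      by (rule arg_cong[where f = prob]) auto
    also have "\<dots> = prob {\<omega> \<in> space M. f \<omega> = 1} + prob {\<omega> \<in> space M. f \<omega> = -1}"
      by (rule finite_measure_Union) auto
    finally have "prob {\<omega> \<in> space M. f \<omega> = 1 \<or> f \<omega> = -1} = 1" using assms by simp
    then show ?thesis by (subst (asm) prob_Collect_eq_1) auto
  qed
  fix A assume "A \<in> sets (distr M borel f)"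
  then have [measurable]: "A \<in> sets borel" by simp
  have "prob (f -` A \<inter> space M) =
     prob ({\<omega> \<in> space M. f \<omega> = 1 \<and> 1 \<in> A} \<union> {\<omega> \<in> space M. f \<omega> = -1 \<and> -1 \<in> A})"
    by (rule finite_measure_eq_AE) (use ae in auto)
  also have "\<dots> = prob {\<omega> \<in> space M. f \<omega> = 1 \<and> 1 \<in> A} + prob {\<omega> \<in> space M. f \<omega> = -1 \<and> -1 \<in> A}"
    by (rule finite_measure_Union) auto
  also have "\<dots> = indicator A 1 / 2 + indicator A (-1) / 2"
    using assms(3,4) by (cases "1 \<in> A"; cases "-1 \<in> A") auto
  also have "\<dots> = measure (measure_pmf (pmf_of_set {-1, 1::real})) A"
    by (subst measure_pmf_of_set) (auto simp: indicator_def)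
  finally show "emeasure (distr M borel f) A =
      emeasure (distr (measure_pmf (pmf_of_set {-1, 1::real})) borel (\<lambda>x. x)) A"
    by (simp add: emeasure_distr emeasure_eq_measure measure_pmf.emeasure_eq_measure)
qed simp

lemma rademacher_array_law:
  assumes "rademacher_array M X"
  shows "distr M (\<Pi>\<^sub>M ij\<in>UNIV. borel) (\<lambda>\<omega> (i, j). X i j \<omega>) =
    (\<Pi>\<^sub>M ij\<in>UNIV. distr (measure_pmf (pmf_of_set {-1, 1::real})) borel (\<lambda>x. x))"
proof -
  interpret prob_space M using assms by (simp add: rademacher_array_def)
  have ind: "indep_vars (\<lambda>_. borel) (\<lambda>(i, j). X i j) UNIV"
    using assms by (simp add: rademacher_array_def)
  then have rv: "random_variable borel ((\<lambda>(i, j). X i j) ij)" for ij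
    unfolding indep_vars_def by blast
  have "distr M (\<Pi>\<^sub>M ij\<in>UNIV. borel) (\<lambda>\<omega>. \<lambda>ij\<in>UNIV. (\<lambda>(i, j). X i j) ij \<omega>) =
      (\<Pi>\<^sub>M ij\<in>UNIV. distr M borel ((\<lambda>(i, j). X i j) ij))"
    using indep_vars_iff_distr_eq_PiM'[of UNIV "\<lambda>(i, j). X i j" "\<lambda>_. borel"] rv ind by auto
  also have "\<dots> = (\<Pi>\<^sub>M ij\<in>UNIV. distr (measure_pmf (pmf_of_set {-1, 1::real})) borel (\<lambda>x. x))"
  proof (rule PiM_cong)
    fix ij :: "nat \<times> nat"
    show "distr M borel ((\<lambda>(i, j). X i j) ij) =
        distr (measure_pmf (pmf_of_set {-1, 1::real})) borel (\<lambda>x. x)"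
      using assms rv[of ij] prob_space_axioms
      by (intro rademacher_marginal) (auto simp: rademacher_array_def split: prod.split)
  qed simp
  finally show ?thesis by (simp add: case_prod_beta' restrict_def)
qed

lemma rademacher_law_unique:
  assumes "rademacher_array M X"
  shows "distr M (\<Pi>\<^sub>M ij\<in>UNIV. borel) (\<lambda>\<omega> (i, j). X i j \<omega>) =
         distr rademacher_space (\<Pi>\<^sub>M ij\<in>UNIV. borel) (\<lambda>\<omega> (i, j). eps i j \<omega>)"
  using rademacher_array_law[OF assms] rademacher_array_law[OF rademacher_array_eps] by simp

(* Every integral below has an integrand that depends on finitely many signs only, so
   none of them takes the default value of a non-integrable function. *)

lemma integrable_finitely_many_signs:
  fixes f :: "(nat \<times> nat \<Rightarrow> bool) \<Rightarrow> real"
  assumes J: "finite J" and f: "\<And>\<omega> \<omega>'. (\<And>ij. ij \<in> J \<Longrightarrow> \<omega> ij = \<omega>' ij) \<Longrightarrow> f \<omega> = f \<omega>'"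
  shows "integrable rademacher_space f"
proof -
  interpret prob_space rademacher_space by (rule prob_space_rademacher_space)
  have eq: "f = (\<lambda>\<omega>. f (restrict \<omega> J))" by (intro ext f) simp
  have "(\<lambda>\<omega>. \<lambda>ij\<in>J. \<omega> ij) \<in> rademacher_space \<rightarrow>\<^sub>M (\<Pi>\<^sub>M ij\<in>J. count_space UNIV)"
    by measurable
  also have "(\<Pi>\<^sub>M ij\<in>J. count_space (UNIV :: bool set)) = count_space (PiE J (\<lambda>_. UNIV))"
    using J by (rule count_space_PiM_finite) simp
  finally have "(\<lambda>\<omega>. f (restrict \<omega> J)) \<in> borel_measurable rademacher_space"
    by (rule measurable_compose) simp
  then have m: "f \<in> borel_measurable rademacher_space" using eq by simp
  have "range f \<subseteq> f ` PiE J (\<lambda>_. UNIV)" using eq by (metis (no_types, lifting) image_subsetI imageI restrict_PiE_iff UNIV_I)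
  moreover have "finite (PiE J (\<lambda>_. UNIV :: bool set))" using J by (intro finite_PiE) auto
  ultimately have "finite (range f)" by (meson finite_imageI finite_subset)
  then obtain B where "\<And>\<omega>. norm (f \<omega>) \<le> B"
    by (metis (no_types, lifting) bounded_iff finite_imp_bounded rangeI)
  then show ?thesis using m by (intro integrable_const_bound[of _ B]) auto
qed

definition Log :: "real \<Rightarrow> real" where
  "Log x = ln (max x (exp 1))"

definition Lp_norm :: "real \<Rightarrow> ((nat \<times> nat \<Rightarrow> bool) \<Rightarrow> real) \<Rightarrow> real" where
  "Lp_norm p S = (\<integral>\<omega>. \<bar>S \<omega>\<bar> powr p \<partial>rademacher_space) powr (1 / p)"

(* A matrix with index set J is a function nat => nat => real and a vector a function
   nat => real; values outside J are irrelevant throughout. *)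

definition ball_pairs :: "nat set \<Rightarrow> ((nat \<Rightarrow> real) \<times> (nat \<Rightarrow> real)) set" where
  "ball_pairs J = {(s, t). L2_set s J \<le> 1 \<and> L2_set t J \<le> 1}"

definition op_norm :: "nat set \<Rightarrow> (nat \<Rightarrow> nat \<Rightarrow> real) \<Rightarrow> real" where
  "op_norm J M = (SUP (s, t)\<in>ball_pairs J. \<Sum>i\<in>J. \<Sum>j\<in>J. M i j * s i * t j)"

definition max_row :: "nat set \<Rightarrow> (nat \<Rightarrow> nat \<Rightarrow> real) \<Rightarrow> real" where
  "max_row J M = (MAX i\<in>J. L2_set (\<lambda>j. M i j) J)"

definition max_col :: "nat set \<Rightarrow> (nat \<Rightarrow> nat \<Rightarrow> real) \<Rightarrow> real" where
  "max_col J M = (MAX j\<in>J. L2_set (\<lambda>i. M i j) J)"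

definition expected_op_norm :: "nat set \<Rightarrow> (nat \<Rightarrow> nat \<Rightarrow> real) \<Rightarrow> real" where
  "expected_op_norm J A = (\<integral>\<omega>. op_norm J (\<lambda>i j. A i j * eps i j \<omega>) \<partial>rademacher_space)"

definition R_norm :: "nat set \<Rightarrow> (nat \<Rightarrow> nat \<Rightarrow> real) \<Rightarrow> real \<Rightarrow> real" where
  "R_norm J A p = (SUP (s, t)\<in>ball_pairs J.
     Lp_norm p (\<lambda>\<omega>. \<Sum>i\<in>J. \<Sum>j\<in>J. A i j * eps i j \<omega> * s i * t j))"

definition Q_quantity :: "nat \<Rightarrow> (nat \<times> nat) set \<Rightarrow> real" where
  "Q_quantity n E = max_row {1..n} (\<lambda>i j. indicator E (i, j)) + max_col {1..n} (\<lambda>i j. indicator E (i, j)) +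
     (MAX k\<in>{1..n}. MIN I\<in>{I. I \<subseteq> {1..n} \<and> card I \<le> k}.
        SUP (s, t)\<in>ball_pairs {1..n}. Lp_norm (Log (real k))
          (\<lambda>\<omega>. \<Sum>i\<in>{1..n} - I. \<Sum>j\<in>{1..n} - I. indicator E (i, j) * eps i j \<omega> * s i * t j))"

end

theory Submission
  imports Defs
begin

text \<open>The moment \<open>E \<parallel>X\<parallel>\<^sup>2\<^sup>p\<close> is at most the expected trace of the \<open>2p\<close>-th power of the symmetrised
  matrix, that is the number of closed walks of length \<open>2p\<close> using every edge an even number of
  times. Such a walk visits at most \<open>p + 1\<close> vertices, and on a fixed set of so few vertices a net
  argument bounds the norm by \<open>R(2p)\<close>. The union over vertex sets is paid for as follows. Each walk
  has a discovery tree, whose edges it uses at least twice. Given the tree, add to the sign matrix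
  the weight \<open>sqrt (D / k)\<close> on the edges from a vertex to its \<open>k\<close> children: this raises the norm by
  at most \<open>2 sqrt D\<close>, while every even walk with this tree gains a factor of order \<open>D / k\<close> for each
  tree edge. The sum over all trees of the product of \<open>k / D\<close> over the edges is exponential in \<open>p\<close>.

  For the upper bound by \<open>Q\<close>, nested vertex sets of doubly exponential size that contain the
  removable sets and the neighbours of their predecessors make the matrix block tridiagonal, and
  the moment bound applies to each block with its own exponent. For the lower bound, a greedy
  removal of vertex-disjoint subgraphs with at most \<open>q\<close> edges and large norm stops after \<open>2 ^ q\<close>
  steps, since otherwise the signs on one of them are likely to be all positive; in what remains,
  the \<open>L\<^sub>p\<close> norms are controlled by the norms of subgraphs with at most \<open>q\<close> edges.\<close>

section \<open>Expectations over finitely many signs\<close>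

text \<open>A norm bound on a fixed vertex set controls the walks with one given tree, but there may
  be of order \<open>D ^ p\<close> trees up to an exponential factor, and paying for them separately
  would yield the product of \<open>sqrt D\<close> and \<open>R\<close> instead of the sum. The
  weight \<open>sqrt (D / k)\<close> is forced from two sides. A star with \<open>k\<close> leaves
  of weight \<open>w\<close> has norm \<open>w * sqrt k\<close>, so this is the largest weight that
  keeps the added norm of order \<open>sqrt D\<close>; and a vertex has at most
  \<open>(exp 1 * D / k) ^ k\<close> sets of \<open>k\<close> children, so a gain of order
  \<open>D / k\<close> per tree edge pays for the choice of the children.

  The trace carries the dimension as a factor, which is harmless only when its logarithm is of order
  \<open>p\<close>. In the upper bound by \<open>Q\<close> the exponent must therefore grow with the
  block, while a removal at scale \<open>k\<close> controls exponents up to \<open>Log k\<close>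
  only. With doubly exponential block sizes consecutive exponents differ by a constant factor, which
  reconciles the two demands, and the excesses over all blocks sum geometrically.\<close>

lemma measure_sign_pattern:
  assumes "finite J"
  shows "measure rademacher_space {\<omega>. \<forall>e\<in>J. \<omega> e = s e} = 1 / 2 ^ card J"
proof -
  interpret product_prob_space "\<lambda>_. measure_pmf (bernoulli_pmf (1/2))" "UNIV :: (nat \<times> nat) set"
    by unfold_locales
  have "{\<omega>. \<forall>e\<in>J. \<omega> e = s e} =
      prod_emb UNIV (\<lambda>_. measure_pmf (bernoulli_pmf (1/2))) J (PiE J (\<lambda>e. {s e}))"
    by (auto simp: prod_emb_def restrict_def PiE_iff space_PiM extensional_def fun_eq_iff)
  also have "measure rademacher_space \<dots> = (\<Prod>e\<in>J. measure (measure_pmf (bernoulli_pmf (1/2))) {s e})"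
    unfolding rademacher_space_def by (rule measure_PiM_emb) (use assms in auto)
  also have "\<dots> = (\<Prod>e\<in>J. 1 / 2)"
    by (rule prod.cong) (simp_all add: measure_pmf_single)
  finally show ?thesis by (simp add: power_divide)
qed

text \<open>A configuration on \<open>J\<close> is encoded by the set of its positive positions.
  Factorisation over edges and invariance under sign flips then become identities for finite sums
  over \<open>Pow J\<close>.\<close>

lemma expectation_signs:
  fixes f :: "(nat \<times> nat \<Rightarrow> bool) \<Rightarrow> real"
  assumes J: "finite J" and f: "\<And>\<omega> \<omega>'. (\<And>e. e \<in> J \<Longrightarrow> \<omega> e = \<omega>' e) \<Longrightarrow> f \<omega> = f \<omega>'"
  shows "integral\<^sup>L rademacher_space f = (\<Sum>S\<in>Pow J. f (\<lambda>e. e \<in> S)) / 2 ^ card J"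
proof -
  interpret prob_space rademacher_space by (rule prob_space_rademacher_space)
  define B where "B S = {\<omega>. \<forall>e\<in>J. \<omega> e = (e \<in> S)}" for S :: "(nat \<times> nat) set"
  have B [measurable]: "B S \<in> sets rademacher_space" for S
  proof -
    have "B S = {\<omega> \<in> space rademacher_space. \<forall>e\<in>J. \<omega> e = (e \<in> S)}" by (simp add: B_def)
    also have "\<dots> \<in> sets rademacher_space" using J by measurable
    finally show ?thesis .
  qed
  have eq: "f \<omega> = (\<Sum>S\<in>Pow J. f (\<lambda>e. e \<in> S) * indicator (B S) \<omega>)" for \<omega>
  proof -
    define S0 where "S0 = {e \<in> J. \<omega> e}"
    have "\<omega> \<in> B S \<longleftrightarrow> S = S0" if "S \<in> Pow J" for S
      using that by (auto simp: B_def S0_def)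
    then have "(\<Sum>S\<in>Pow J. f (\<lambda>e. e \<in> S) * indicator (B S) \<omega>) =
        (\<Sum>S\<in>Pow J. if S = S0 then f (\<lambda>e. e \<in> S) else 0)"
      by (intro sum.cong) (auto simp: indicator_def)
    also have "\<dots> = f (\<lambda>e. e \<in> S0)" using J by (auto simp: S0_def)
    also have "\<dots> = f \<omega>" by (rule f) (simp add: S0_def)
    finally show ?thesis by simp
  qed
  have "integral\<^sup>L rademacher_space f =
      (\<integral>\<omega>. (\<Sum>S\<in>Pow J. f (\<lambda>e. e \<in> S) * indicator (B S) \<omega>) \<partial>rademacher_space)"
    by (rule Bochner_Integration.integral_cong[OF refl eq])
  also have "\<dots> = (\<Sum>S\<in>Pow J. f (\<lambda>e. e \<in> S) * prob (B S))"
    by (subst Bochner_Integration.integral_sum) (auto simp: integrable_real_mult_indicator emeasure_eq_measure)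
  also have "\<dots> = (\<Sum>S\<in>Pow J. f (\<lambda>e. e \<in> S) * (1 / 2 ^ card J))"
    unfolding B_def measure_sign_pattern[OF J] ..
  finally show ?thesis by (simp add: sum_divide_distrib)
qed

lemma expectation_prod_signs:
  fixes h :: "nat \<times> nat \<Rightarrow> bool \<Rightarrow> real"
  assumes "finite J"
  shows "(\<integral>\<omega>. (\<Prod>e\<in>J. h e (\<omega> e)) \<partial>rademacher_space) = (\<Prod>e\<in>J. (h e True + h e False) / 2)"
proof -
  have "(\<integral>\<omega>. (\<Prod>e\<in>J. h e (\<omega> e)) \<partial>rademacher_space) =
      (\<Sum>S\<in>Pow J. \<Prod>e\<in>J. h e (e \<in> S)) / 2 ^ card J"
    using assms by (subst expectation_signs[where J = J]) auto
  also have "(\<Sum>S\<in>Pow J. \<Prod>e\<in>J. h e (e \<in> S)) =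
      (\<Sum>S\<in>Pow J. (\<Prod>e\<in>S. h e True) * (\<Prod>e\<in>J - S. h e False))"
  proof (rule sum.cong)
    fix S assume "S \<in> Pow J"
    then have S: "S \<subseteq> J" by simp
    show "(\<Prod>e\<in>J. h e (e \<in> S)) = (\<Prod>e\<in>S. h e True) * (\<Prod>e\<in>J - S. h e False)"
      by (subst prod.subset_diff[OF S assms]) (simp add: mult.commute)
  qed simp
  also have "\<dots> = (\<Prod>e\<in>J. h e True + h e False)"
    by (rule prod_add[OF assms, symmetric])
  finally show ?thesis by (simp add: prod_dividef)
qed

abbreviation sgb :: "bool \<Rightarrow> real" where
  "sgb b \<equiv> (if b then 1 else -1)"

text \<open>Jensen's inequality. The fact \<open>young\<close> is the tangent line of
  \<open>y powr r\<close> at the mean \<open>m\<close>, in the form given by Young's inequality;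
  integrating it and cancelling \<open>m powr r\<close> gives the claim.\<close>

lemma powr_expectation_le:
  fixes Y :: "'a \<Rightarrow> real"
  assumes "prob_space M" "r \<ge> 1" "\<And>x. Y x \<ge> 0"
    and "integrable M Y" "integrable M (\<lambda>x. Y x powr r)"
  shows "(integral\<^sup>L M Y) powr r \<le> (\<integral>x. Y x powr r \<partial>M)"
proof -
  interpret prob_space M by fact
  define m where "m = integral\<^sup>L M Y"
  have m0: "m \<ge> 0" unfolding m_def by (rule integral_nonneg_AE) (use assms in auto)
  show ?thesis
  proof (cases "m = 0")
    case True
    then show ?thesis unfolding m_def by (simp add: integral_nonneg_AE)
  next
    case False
    then have m: "m > 0" using m0 by simp
    have young: "Y x * m powr (r - 1) \<le> (1/r) * Y x powr r + (1 - 1/r) * m powr r" for x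
    proof (cases "Y x = 0")
      case True
      then show ?thesis using assms(2) m by simp
    next
      case False
      then have Y: "Y x > 0" using assms(3)[of x] by simp
      have "(Y x powr r) powr (1/r) * (m powr r) powr (1 - 1/r) \<le> (1/r) * Y x powr r + (1 - 1/r) * m powr r"
        by (rule Youngs_inequality_0) (use assms(2) Y m in auto)
      moreover have "r * (1 - 1/r) = r - 1" using assms(2) by (simp add: field_simps)
      ultimately show ?thesis using assms(2) Y m by (simp add: powr_powr)
    qed
    have "m * m powr (r - 1) = (\<integral>x. Y x * m powr (r - 1) \<partial>M)"
      by (simp add: m_def)
    also have "\<dots> \<le> (\<integral>x. (1/r) * Y x powr r + (1 - 1/r) * m powr r \<partial>M)"
      by (intro integral_mono young) (use assms in auto)
    also have "\<dots> = (1/r) * (\<integral>x. Y x powr r \<partial>M) + (1 - 1/r) * m powr r"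
      using assms by (simp add: prob_space)
    also have "m * m powr (r - 1) = m powr r"
      using m by (metis diff_add_cancel add.commute powr_add powr_one less_imp_le)
    finally have "(1/r) * m powr r \<le> (1/r) * (\<integral>x. Y x powr r \<partial>M)"
      by (simp add: algebra_simps)
    then show ?thesis using assms(2) unfolding m_def by (simp add: field_simps)
  qed
qed

lemma power_expectation_le:
  fixes Y :: "'a \<Rightarrow> real"
  assumes "prob_space M" "n \<ge> 1" "\<And>x. Y x \<ge> 0"
    and "integrable M Y" "integrable M (\<lambda>x. Y x ^ n)"
  shows "(integral\<^sup>L M Y) ^ n \<le> (\<integral>x. Y x ^ n \<partial>M)"
proof -
  have eq: "y powr real n = y ^ n" if "y \<ge> 0" for y :: real
    using that assms(2) by (intro powr_realpow') auto
  have "integral\<^sup>L M Y \<ge> 0" by (rule integral_nonneg_AE) (use assms in auto)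
  then show ?thesis
    using powr_expectation_le[of M "real n" Y] assms by (simp add: eq)
qed

section \<open>Sub-Gaussian moments: Khintchine's inequality\<close>

lemma cosh_le_exp_half_square: "(exp x + exp (- x)) / 2 \<le> exp (x\<^sup>2 / 2)" for x :: real
proof -
  have *: "(exp y + exp (- y)) / 2 \<le> exp (y\<^sup>2 / 2)" if "y \<ge> 0" for y :: real
  proof -
    have pos: "1 + (1/2) * (exp (2 * y) - 1) > 0" using that
      by (simp add: add_pos_nonneg)
    \<comment> \<open>This is Hoeffding's estimate for a fair 0/1 variable at \<open>2 * y\<close>;
      multiplying by \<open>exp (- y)\<close> recentres it to the hyperbolic cosine.\<close>
    have "- (2 * y) * (1/2) + ln (1 + (1/2) * (exp (2 * y) - 1)) \<le> (2 * y)\<^sup>2 / 8"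
      by (rule Hoeffdings_lemma_aux) (use that in auto)
    then have "ln (1 + (1/2) * (exp (2 * y) - 1)) \<le> y + y\<^sup>2 / 2"
      by (simp add: power2_eq_square)
    then have "1 + (1/2) * (exp (2 * y) - 1) \<le> exp (y + y\<^sup>2 / 2)"
      using pos by (metis exp_ln exp_le_cancel_iff)
    then have "exp (- y) * (1 + (1/2) * (exp (2 * y) - 1)) \<le> exp (- y) * exp (y + y\<^sup>2 / 2)"
      by (intro mult_left_mono) auto
    also have "exp (- y) * exp (y + y\<^sup>2 / 2) = exp (y\<^sup>2 / 2)" by (simp flip: exp_add)
    also have "exp (- y) * (1 + (1/2) * (exp (2 * y) - 1)) = (exp y + exp (- y)) / 2"
      by (simp add: algebra_simps flip: exp_add)
    finally show ?thesis .
  qed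
  show ?thesis using *[of x] *[of "-x"] by (cases "x \<ge> 0") (auto simp: add.commute)
qed

lemma integrable_signs:
  assumes "finite J" "\<And>\<omega> \<omega>'. (\<And>ij. ij \<in> J \<Longrightarrow> \<omega> ij = \<omega>' ij) \<Longrightarrow> g \<omega> = g \<omega>'"
  shows "integrable rademacher_space (\<lambda>\<omega>. h (g \<omega>) :: real)"
  by (rule integrable_finitely_many_signs[OF assms(1)]) (metis assms(2))

lemma expectation_exp_signs_le:
  assumes "finite J" "(\<Sum>e\<in>J. (c e)\<^sup>2) \<le> v"
  shows "(\<integral>\<omega>. exp (l * (\<Sum>e\<in>J. c e * sgb (\<omega> e))) \<partial>rademacher_space) \<le> exp (l\<^sup>2 * v / 2)"
proof -
  have "(\<integral>\<omega>. exp (l * (\<Sum>e\<in>J. c e * sgb (\<omega> e))) \<partial>rademacher_space) =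
     (\<integral>\<omega>. (\<Prod>e\<in>J. exp (l * c e * sgb (\<omega> e))) \<partial>rademacher_space)"
    using assms(1) by (simp add: sum_distrib_left exp_sum mult.assoc)
  also have "\<dots> = (\<Prod>e\<in>J. (exp (l * c e) + exp (- (l * c e))) / 2)"
    by (subst expectation_prod_signs[OF assms(1), where h = "\<lambda>e b. exp (l * c e * sgb b)"]) simp
  also have "\<dots> \<le> (\<Prod>e\<in>J. exp ((l * c e)\<^sup>2 / 2))"
    by (intro prod_mono conjI cosh_le_exp_half_square) (simp add: add_nonneg_nonneg)
  also have "\<dots> = exp (\<Sum>e\<in>J. (l * c e)\<^sup>2 / 2)" using assms(1) by (simp add: exp_sum)
  also have "(\<Sum>e\<in>J. (l * c e)\<^sup>2 / 2) = l\<^sup>2 * (\<Sum>e\<in>J. (c e)\<^sup>2) / 2"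
    by (simp add: power_mult_distrib sum_distrib_left sum_divide_distrib)
  also have "exp \<dots> \<le> exp (l\<^sup>2 * v / 2)" using assms(2) by (simp add: mult_left_mono)
  finally show ?thesis .
qed

text \<open>The power is dominated by two exponentials through \<open>ln z \<le> z - 1\<close> at
  \<open>z = l * \<bar>x\<bar> / p\<close>, and exponential moments of Rademacher sums are
  sub-Gaussian. The case of zero \<open>\<sigma>\<close> is separate because \<open>l\<close>
  divides by it.\<close>

lemma khintchine:
  assumes J: "finite J" and p: "p \<ge> 1" and \<sigma>: "\<sigma> \<ge> 0" and c: "(\<Sum>e\<in>J. (c e)\<^sup>2) \<le> \<sigma>\<^sup>2"
  shows "(\<integral>\<omega>. \<bar>\<Sum>e\<in>J. c e * sgb (\<omega> e)\<bar> powr p \<partial>rademacher_space) \<le> (2 * sqrt p * \<sigma>) powr p"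
proof (cases "\<sigma> = 0")
  case True
  then have "(\<Sum>e\<in>J. (c e)\<^sup>2) = 0" using c by (simp add: order.antisym sum_nonneg)
  then have "\<forall>e\<in>J. c e = 0" using J by (simp add: sum_nonneg_eq_0_iff)
  then show ?thesis using True by simp
next
  case False
  then have \<sigma>0: "\<sigma> > 0" using \<sigma> by simp
  define S where "S \<omega> = (\<Sum>e\<in>J. c e * sgb (\<omega> e))" for \<omega>
  \<comment> \<open>With this choice \<open>l\<^sup>2 * \<sigma>\<^sup>2 / 2 = p / 2\<close>, while
    \<open>K\<close> supplies \<open>exp (- p)\<close>; a factor \<open>2 * exp (- (p / 2))\<close>
    remains beside the scale \<open>\<sigma> * sqrt p\<close>.\<close>
  define l where "l = sqrt p / \<sigma>"
  have l: "l > 0" using \<sigma>0 p by (simp add: l_def)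
  define K where "K = (\<sigma> * sqrt p) powr p * exp (- p)"
  have K: "K \<ge> 0" by (simp add: K_def)
  have pw: "\<bar>x\<bar> powr p \<le> K * (exp (l * x) + exp (- l * x))" for x :: real
  proof (cases "x = 0")
    case False
    define y where "y = l * \<bar>x\<bar>"
    have y: "y > 0" using False l by (simp add: y_def)
    have "ln (y / p) \<le> y / p - 1" using y p by (intro ln_le_minus_one) simp
    then have "p * ln (y / p) \<le> y - p" using p by (simp add: field_simps)
    then have "(y / p) powr p \<le> exp (y - p)" using y p by (simp add: powr_def)
    have "\<bar>x\<bar> = (\<sigma> * sqrt p) * (y / p)"
      using \<sigma>0 p by (simp add: y_def l_def field_simps flip: real_sqrt_mult power2_eq_square)
    then have "\<bar>x\<bar> powr p = (\<sigma> * sqrt p) powr p * (y / p) powr p"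
      using y p \<sigma>0 by (simp only: powr_mult)
    also have "\<dots> \<le> (\<sigma> * sqrt p) powr p * exp (y - p)"
      by (intro mult_left_mono) (use \<open>(y / p) powr p \<le> exp (y - p)\<close> in auto)
    also have "\<dots> = K * exp y" by (simp add: K_def exp_diff exp_minus field_simps)
    also have "exp y \<le> exp (l * x) + exp (- l * x)"
      by (cases "x \<ge> 0") (simp_all add: y_def)
    finally show ?thesis using K by (simp add: mult_left_mono)
  qed (simp add: K)
  have dep: "S \<omega> = S \<omega>'" if "\<And>e. e \<in> J \<Longrightarrow> \<omega> e = \<omega>' e" for \<omega> \<omega>'
    unfolding S_def using that by (intro sum.cong) auto
  have int: "integrable rademacher_space (\<lambda>\<omega>. h (S \<omega>) :: real)" for h
    by (rule integrable_signs[OF J dep])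
  have E: "(\<integral>\<omega>. exp (k * S \<omega>) \<partial>rademacher_space) \<le> exp (p / 2)" if "\<bar>k\<bar> = l" for k
  proof -
    have "k\<^sup>2 = l\<^sup>2" using that by (metis power2_abs)
    then have "k\<^sup>2 * \<sigma>\<^sup>2 / 2 = p / 2" using \<sigma>0 p by (simp add: l_def power_divide)
    then show ?thesis unfolding S_def using expectation_exp_signs_le[OF J c, of k] by simp
  qed
  have "(\<integral>\<omega>. \<bar>S \<omega>\<bar> powr p \<partial>rademacher_space) \<le>
      (\<integral>\<omega>. K * (exp (l * S \<omega>) + exp (- l * S \<omega>)) \<partial>rademacher_space)"
    by (intro integral_mono pw int)
  also have "\<dots> = K * ((\<integral>\<omega>. exp (l * S \<omega>) \<partial>rademacher_space) + (\<integral>\<omega>. exp (- l * S \<omega>) \<partial>rademacher_space))"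
    using int[of "\<lambda>x. exp (l * x)"] int[of "\<lambda>x. exp (- l * x)"] by simp
  also have "\<dots> \<le> K * (exp (p / 2) + exp (p / 2))"
    by (intro mult_left_mono add_mono E K) (use l in auto)
  also have "\<dots> = (\<sigma> * sqrt p) powr p * (2 * exp (- (p / 2)))"
    by (simp add: K_def flip: exp_add)
  also have "\<dots> \<le> (\<sigma> * sqrt p) powr p * (2 powr p)"
  proof (intro mult_left_mono)
    have "2 * exp (- (p / 2)) \<le> 2 powr 1 * 1" using p by (intro mult_mono) auto
    also have "\<dots> \<le> 2 powr p" using powr_mono[of 1 p 2] p by simp
    finally show "2 * exp (- (p / 2)) \<le> 2 powr p" .
  qed simp
  also have "\<dots> = (2 * sqrt p * \<sigma>) powr p" using \<sigma>0 p by (simp add: powr_mult ac_simps)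
  finally show ?thesis by (simp add: S_def)
qed

section \<open>Powers of a matrix and walks\<close>

definition bform :: "'v set \<Rightarrow> ('v \<Rightarrow> 'v \<Rightarrow> real) \<Rightarrow> ('v \<Rightarrow> real) \<Rightarrow> ('v \<Rightarrow> real) \<Rightarrow> real" where
  "bform V M g h = (\<Sum>x\<in>V. \<Sum>y\<in>V. M x y * g x * h y)"

fun mpow :: "'v set \<Rightarrow> ('v \<Rightarrow> 'v \<Rightarrow> real) \<Rightarrow> nat \<Rightarrow> 'v \<Rightarrow> 'v \<Rightarrow> real" where
  "mpow V M 0 x z = of_bool (x = z)"
| "mpow V M (Suc n) x z = (\<Sum>y\<in>V. M x y * mpow V M n y z)"

fun steps :: "'v list \<Rightarrow> ('v \<times> 'v) list" where
  "steps [] = []"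
| "steps [x] = []"
| "steps (x # y # r) = (x, y) # steps (y # r)"

definition walks :: "'v set \<Rightarrow> nat \<Rightarrow> 'v \<Rightarrow> 'v \<Rightarrow> 'v list set" where
  "walks V n x z = {r. length r = Suc n \<and> set r \<subseteq> V \<and> hd r = x \<and> last r = z}"

lemma finite_walks: "finite V \<Longrightarrow> finite (walks V n x z)"
  by (rule finite_subset[OF _ finite_lists_length_eq[of V "Suc n"]]) (auto simp: walks_def)

lemma walks_Suc:
  assumes "x \<in> V"
  shows "walks V (Suc n) x z = (\<Union>y\<in>V. (#) x ` walks V n y z)"
proof (intro set_eqI iffI)
  fix r assume "r \<in> walks V (Suc n) x z"
  then obtain r' where "r = x # r'" "length r' = Suc n" "set r' \<subseteq> V" "last (x # r') = z"
    by (cases r) (auto simp: walks_def)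
  moreover from this have "r' \<noteq> []" by auto
  ultimately show "r \<in> (\<Union>y\<in>V. (#) x ` walks V n y z)"
    by (intro UN_I[of "hd r'"]) (auto simp: walks_def)
qed (use assms in \<open>auto simp: walks_def split: if_splits\<close>)

lemma mpow_eq_sum_walks:
  assumes "finite V" "x \<in> V" "z \<in> V"
  shows "mpow V M n x z = (\<Sum>r\<in>walks V n x z. \<Prod>(a, b)\<leftarrow>steps r. M a b)"
  using assms(2)
proof (induction n arbitrary: x)
  case 0
  have "walks V 0 x z = (if x = z then {[x]} else {})"
    using 0 by (auto simp: walks_def length_Suc_conv)
  then show ?case by auto
next
  case (Suc n)
  have cons: "(\<Prod>(a, b)\<leftarrow>steps (x # r). M a b) = M x y * (\<Prod>(a, b)\<leftarrow>steps r. M a b)"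
    if "r \<in> walks V n y z" for r y
    using that by (cases r) (auto simp: walks_def)
  have "(\<Sum>r\<in>walks V (Suc n) x z. \<Prod>(a, b)\<leftarrow>steps r. M a b) =
      (\<Sum>y\<in>V. \<Sum>r\<in>(#) x ` walks V n y z. \<Prod>(a, b)\<leftarrow>steps r. M a b)"
    unfolding walks_Suc[OF Suc.prems]
    by (rule sum.UNION_disjoint) (simp_all add: assms(1) finite_walks, auto simp: walks_def)
  also have "\<dots> = (\<Sum>y\<in>V. \<Sum>r\<in>walks V n y z. M x y * (\<Prod>(a, b)\<leftarrow>steps r. M a b))"
  proof (rule sum.cong[OF refl])
    fix y
    have "(\<Sum>r\<in>(#) x ` walks V n y z. \<Prod>(a, b)\<leftarrow>steps r. M a b) =
        (\<Sum>r\<in>walks V n y z. \<Prod>(a, b)\<leftarrow>steps (x # r). M a b)"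
      by (subst sum.reindex) (auto simp: inj_on_def)
    also have "\<dots> = (\<Sum>r\<in>walks V n y z. M x y * (\<Prod>(a, b)\<leftarrow>steps r. M a b))"
      by (intro sum.cong refl cons)
    finally show "(\<Sum>r\<in>(#) x ` walks V n y z. \<Prod>(a, b)\<leftarrow>steps r. M a b) = \<dots>" .
  qed
  also have "\<dots> = mpow V M (Suc n) x z"
    using Suc.IH by (simp add: sum_distrib_left)
  finally show ?case by simp
qed

lemma mpow_add:
  assumes "finite V" "x \<in> V"
  shows "mpow V M (m + n) x z = (\<Sum>y\<in>V. mpow V M m x y * mpow V M n y z)"
  using assms(2)
proof (induction m arbitrary: x)
  case 0
  have "(\<Sum>y\<in>V. of_bool (x = y) * mpow V M n y z) = (\<Sum>y\<in>V. if x = y then mpow V M n y z else 0)"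
    by (intro sum.cong) auto
  then show ?case using assms(1) 0 by simp
next
  case (Suc m)
  have "mpow V M (Suc m + n) x z = (\<Sum>w\<in>V. \<Sum>y\<in>V. M x w * mpow V M m w y * mpow V M n y z)"
    using Suc.IH by (simp add: sum_distrib_left mult.assoc)
  also have "\<dots> = (\<Sum>y\<in>V. \<Sum>w\<in>V. M x w * mpow V M m w y * mpow V M n y z)"
    by (rule sum.swap)
  finally show ?case by (simp add: sum_distrib_right)
qed

lemma mpow_sym:
  assumes "finite V" "x \<in> V" "z \<in> V" and sym: "\<And>x y. x \<in> V \<Longrightarrow> y \<in> V \<Longrightarrow> M x y = M y x"
  shows "mpow V M n x z = mpow V M n z x"
  using assms(2,3)
proof (induction n arbitrary: x z)
  case (Suc n)
  have one: "mpow V M (Suc 0) y z = M y z" if "y \<in> V" for y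
  proof -
    have "(\<Sum>w\<in>V. M y w * of_bool (w = z)) = (\<Sum>w\<in>V. if w = z then M y w else 0)"
      by (intro sum.cong) auto
    then show ?thesis using assms(1) Suc.prems by simp
  qed
  have "mpow V M (Suc n) x z = (\<Sum>y\<in>V. mpow V M n x y * M y z)"
    using mpow_add[OF assms(1) Suc.prems(1), of M n "Suc 0" z] one by simp
  also have "\<dots> = (\<Sum>y\<in>V. M z y * mpow V M n y x)"
    using Suc sym by (intro sum.cong refl) (simp add: mult.commute)
  finally show ?case by simp
qed auto

definition mvec :: "'v set \<Rightarrow> ('v \<Rightarrow> 'v \<Rightarrow> real) \<Rightarrow> nat \<Rightarrow> ('v \<Rightarrow> real) \<Rightarrow> 'v \<Rightarrow> real" where
  "mvec V M n h x = (\<Sum>z\<in>V. mpow V M n x z * h z)"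

lemma mvec_0: "finite V \<Longrightarrow> x \<in> V \<Longrightarrow> mvec V M 0 h x = h x"
proof -
  assume "finite V" "x \<in> V"
  moreover have "(\<Sum>z\<in>V. of_bool (x = z) * h z) = (\<Sum>z\<in>V. if x = z then h z else 0)"
    by (intro sum.cong) auto
  ultimately show ?thesis by (simp add: mvec_def)
qed

lemma mvec_Suc: "mvec V M (Suc n) h x = (\<Sum>y\<in>V. M x y * mvec V M n h y)"
proof -
  have "mvec V M (Suc n) h x = (\<Sum>z\<in>V. \<Sum>y\<in>V. M x y * mpow V M n y z * h z)"
    by (simp add: mvec_def sum_distrib_right)
  also have "\<dots> = (\<Sum>y\<in>V. \<Sum>z\<in>V. M x y * mpow V M n y z * h z)" by (rule sum.swap)
  finally show ?thesis by (simp add: mvec_def sum_distrib_left mult.assoc)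
qed

lemma sum_mult_le_L2: "(\<Sum>i\<in>A. f i * g i) \<le> L2_set f A * L2_set g A"
proof -
  have "(\<Sum>i\<in>A. f i * g i) \<le> (\<Sum>i\<in>A. \<bar>f i\<bar> * \<bar>g i\<bar>)"
    by (intro sum_mono) (metis abs_ge_self abs_mult)
  also have "\<dots> \<le> L2_set f A * L2_set g A" by (rule L2_set_mult_ineq)
  finally show ?thesis .
qed

lemma L2_set_power2: "(L2_set f A)\<^sup>2 = (\<Sum>i\<in>A. (f i)\<^sup>2)"
  unfolding L2_set_def by (simp add: sum_nonneg)

lemma bform_eq_mvec:
  assumes "finite V"
  shows "bform V M g (mvec V M n h) = (\<Sum>x\<in>V. g x * mvec V M (Suc n) h x)"
  unfolding bform_def mvec_Suc by (simp add: sum_distrib_left ac_simps)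

text \<open>Testing the form against \<open>M v\<close> itself gives \<open>\<parallel>M
  v\<parallel>\<^sup>2 \<le> K * \<parallel>M v\<parallel> * \<parallel>v\<parallel>\<close>, so
  each application of \<open>M\<close> costs a factor \<open>K\<close>; start from the unit vector
  at \<open>x\<close>.\<close>

lemma mpow_diag_le:
  assumes V: "finite V" "x \<in> V" and K: "K \<ge> 0"
    and bd: "\<And>g h. bform V M g h \<le> K * L2_set g V * L2_set h V"
  shows "mpow V M n x x \<le> K ^ n"
proof -
  define h where "h z = (if z = x then 1 else 0 :: real)" for z
  have h: "L2_set h V = 1"
  proof -
    have "(\<Sum>z\<in>V. (h z)\<^sup>2) = (\<Sum>z\<in>V. if z = x then 1 else 0)"
      by (intro sum.cong) (auto simp: h_def)
    then show ?thesis using V by (simp add: L2_set_def)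
  qed
  have step: "L2_set (mvec V M (Suc n) h) V \<le> K * L2_set (mvec V M n h) V" for n
  proof -
    let ?g = "mvec V M (Suc n) h"
    have "(L2_set ?g V)\<^sup>2 = bform V M ?g (mvec V M n h)"
      unfolding bform_eq_mvec[OF V(1)] L2_set_power2 by (simp add: power2_eq_square)
    also have "\<dots> \<le> K * L2_set ?g V * L2_set (mvec V M n h) V" by (rule bd)
    finally have "L2_set ?g V * L2_set ?g V \<le> L2_set ?g V * (K * L2_set (mvec V M n h) V)"
      by (simp add: power2_eq_square ac_simps)
    then show ?thesis using K
      by (cases "L2_set ?g V = 0") (auto simp: mult_le_cancel_left order.strict_iff_order)
  qed
  have L: "L2_set (mvec V M n h) V \<le> K ^ n" for n
  proof (induction n)
    case 0
    have "L2_set (mvec V M 0 h) V = L2_set h V" by (intro L2_set_cong refl mvec_0 V)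
    then show ?case using h by simp
  next
    case (Suc n)
    then show ?case using step[of n] K by (simp add: mult_left_mono order.trans)
  qed
  have "mpow V M n x x = mvec V M n h x"
  proof -
    have "mvec V M n h x = (\<Sum>z\<in>V. if z = x then mpow V M n x z else 0)"
      unfolding mvec_def by (intro sum.cong) (auto simp: h_def)
    then show ?thesis using V by simp
  qed
  also have "\<dots> \<le> L2_set (mvec V M n h) V" using V by (rule member_le_L2_set)
  also have "\<dots> \<le> K ^ n" by (rule L)
  finally show ?thesis .
qed

text \<open>By symmetry the norms \<open>a n\<close> of the iterates \<open>M ^ n h\<close> are
  log-convex, and \<open>a 0 \<le> 1\<close>, hence \<open>a 1 ^ p \<le> a p\<close>. Cauchy-Schwarz
  then bounds \<open>(a p)\<^sup>2\<close> by the sum of squares of the entries of the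
  \<open>p\<close>-th power, which is the trace of the power \<open>2 * p\<close>. No eigenvalues
  enter.\<close>

lemma bform_power_le_trace:
  assumes V: "finite V" and sym: "\<And>x y. x \<in> V \<Longrightarrow> y \<in> V \<Longrightarrow> M x y = M y x" and p: "p \<ge> 1"
    and g: "L2_set g V \<le> 1" and h: "L2_set h V \<le> 1"
  shows "\<bar>bform V M g h\<bar> ^ (2 * p) \<le> (\<Sum>x\<in>V. mpow V M (2 * p) x x)"
proof -
  define a where "a n = L2_set (mvec V M n h) V" for n
  have a_nonneg: "a n \<ge> 0" for n by (simp add: a_def)
  have conv: "(a (Suc n))\<^sup>2 \<le> a n * a (Suc (Suc n))" for n
  proof -
    have "(a (Suc n))\<^sup>2 = (\<Sum>x\<in>V. mvec V M (Suc n) h x * (\<Sum>y\<in>V. M x y * mvec V M n h y))"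
      unfolding a_def L2_set_power2 mvec_Suc[symmetric] by (simp add: power2_eq_square)
    also have "\<dots> = (\<Sum>x\<in>V. \<Sum>y\<in>V. mvec V M n h y * (M y x * mvec V M (Suc n) h x))"
      using sym by (intro sum.cong refl) (simp add: sum_distrib_left ac_simps cong: sum.cong)
    also have "\<dots> = (\<Sum>y\<in>V. mvec V M n h y * mvec V M (Suc (Suc n)) h y)"
      by (subst sum.swap) (simp only: mvec_Suc[of V M "Suc n"] sum_distrib_left)
    also have "\<dots> \<le> a n * a (Suc (Suc n))" unfolding a_def by (rule sum_mult_le_L2)
    finally show ?thesis .
  qed
  have a0: "a 0 \<le> 1"
  proof -
    have "a 0 = L2_set h V" unfolding a_def by (intro L2_set_cong refl mvec_0 V)
    then show ?thesis using h by simp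
  qed
  have pow: "a 1 ^ p \<le> a p"
  proof (cases "a 1 = 0")
    case False
    then have a1: "a 1 > 0" using a_nonneg[of 1] by simp
    \<comment> \<open>Log-convexity yields monotone ratios only after division by
      \<open>a n\<close>, so positivity is carried through the same induction.\<close>
    have pos: "a n > 0 \<and> a n * a 1 \<le> a (Suc n)" for n
    proof (induction n)
      case 0
      have "a 0 \<noteq> 0" using conv[of 0] a1 by auto
      then show ?case using a0 a1 a_nonneg[of 0] mult_right_mono[of "a 0" 1 "a 1"] by simp
    next
      case (Suc n)
      then have "a n * a 1 > 0" using a1 by simp
      then have pos: "a (Suc n) > 0" using Suc by linarith
      have "a n * (a (Suc n) * a 1) \<le> a (Suc n) * a (Suc n)"
        using Suc pos mult_right_mono[of "a n * a 1" "a (Suc n)" "a (Suc n)"] by (simp add: ac_simps)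
      also have "\<dots> \<le> a n * a (Suc (Suc n))" using conv[of n] by (simp add: power2_eq_square)
      finally show ?case using Suc pos by (simp add: mult_le_cancel_left)
    qed
    have "a 1 ^ Suc n \<le> a (Suc n)" for n
    proof (induction n)
      case (Suc n)
      then have "a 1 ^ Suc (Suc n) \<le> a (Suc n) * a 1"
        using a1 by (simp add: mult_right_mono mult.commute)
      then show ?case using pos[of "Suc n"] by linarith
    qed simp
    from this[of "p - 1"] show ?thesis using p by simp
  qed (use p a_nonneg in \<open>simp add: power_0_left\<close>)
  have "bform V M g h = (\<Sum>x\<in>V. g x * mvec V M 1 h x)"
  proof -
    have "bform V M g h = bform V M g (mvec V M 0 h)"
      unfolding bform_def using mvec_0[OF V] by (intro sum.cong refl) simp
    then show ?thesis by (simp only: bform_eq_mvec[OF V] One_nat_def)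
  qed
  then have "\<bar>bform V M g h\<bar> \<le> (\<Sum>x\<in>V. \<bar>g x\<bar> * \<bar>mvec V M 1 h x\<bar>)"
    by (simp add: abs_mult[symmetric])
  also have "\<dots> \<le> L2_set g V * a 1" unfolding a_def by (rule L2_set_mult_ineq)
  also have "\<dots> \<le> a 1" using g a_nonneg[of 1] mult_right_mono[of _ 1 "a 1"] by simp
  finally have "\<bar>bform V M g h\<bar> ^ (2 * p) \<le> (a 1 ^ p)\<^sup>2"
    by (metis abs_ge_zero mult.commute power_mono power_mult)
  also have "\<dots> \<le> (a p)\<^sup>2" using pow a_nonneg[of 1] by (intro power_mono) auto
  also have "\<dots> = (\<Sum>x\<in>V. (\<Sum>z\<in>V. mpow V M p x z * h z)\<^sup>2)"
    unfolding a_def L2_set_power2 mvec_def ..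
  also have "\<dots> \<le> (\<Sum>x\<in>V. \<Sum>z\<in>V. (mpow V M p x z)\<^sup>2)"
  proof (rule sum_mono)
    fix x
    have "(\<Sum>z\<in>V. mpow V M p x z * h z)\<^sup>2 \<le> (\<Sum>z\<in>V. (mpow V M p x z)\<^sup>2) * (\<Sum>z\<in>V. (h z)\<^sup>2)"
      by (rule Cauchy_Schwarz_ineq_sum)
    also have "\<dots> \<le> (\<Sum>z\<in>V. (mpow V M p x z)\<^sup>2) * 1"
      using h by (intro mult_left_mono) (auto simp: sum_nonneg L2_set_def)
    finally show "(\<Sum>z\<in>V. mpow V M p x z * h z)\<^sup>2 \<le> (\<Sum>z\<in>V. (mpow V M p x z)\<^sup>2)" by simp
  qed
  also have "\<dots> = (\<Sum>x\<in>V. mpow V M (2 * p) x x)"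
  proof (intro sum.cong refl)
    fix x assume x: "x \<in> V"
    show "(\<Sum>z\<in>V. (mpow V M p x z)\<^sup>2) = mpow V M (2 * p) x x"
      unfolding mult_2 mpow_add[OF V x]
      using mpow_sym[OF V _ _ sym] x by (intro sum.cong refl) (simp add: power2_eq_square)
  qed
  finally show ?thesis .
qed

section \<open>Even walks and their discovery trees\<close>

text \<open>The list is read from its end: \<open>last r\<close> is the root, and a new head
  \<open>y\<close> not seen before is hung below its successor \<open>x\<close> in the list. Pairs
  are (parent, child), opposite to the direction of \<open>steps\<close>. For closed walks the root
  is also the head.\<close>

fun dtree :: "'v list \<Rightarrow> ('v \<times> 'v) set" where
  "dtree [] = {}"
| "dtree [x] = {}"
| "dtree (y # x # r) = (if y \<in> set (x # r) then dtree (x # r) else insert (x, y) (dtree (x # r)))"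

lemma dtree_vertices: "(x, y) \<in> dtree r \<Longrightarrow> x \<in> set r \<and> y \<in> set r \<and> y \<noteq> last r"
  by (induction r rule: dtree.induct) (auto split: if_splits)

lemma finite_dtree: "finite (dtree r)"
  by (induction r rule: dtree.induct) auto

lemma dtree_parent_unique: "(x, y) \<in> dtree r \<Longrightarrow> (x', y) \<in> dtree r \<Longrightarrow> x = x'"
  by (induction r rule: dtree.induct) (auto split: if_splits dest: dtree_vertices)

lemma dtree_antisym: "(x, y) \<in> dtree r \<Longrightarrow> (y, x) \<notin> dtree r"
  by (induction r rule: dtree.induct) (auto split: if_splits dest: dtree_vertices)

lemma dtree_step: "(x, y) \<in> dtree r \<Longrightarrow> (y, x) \<in> set (steps r)"
  by (induction r rule: dtree.induct) (auto split: if_splits)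

lemma dtree_reach: "y \<in> set r \<Longrightarrow> (last r, y) \<in> (dtree r)\<^sup>*"
proof (induction r arbitrary: y rule: dtree.induct)
  case (3 z x r)
  have sub: "dtree (x # r) \<subseteq> dtree (z # x # r)" by auto
  have old: "(last (z # x # r), w) \<in> (dtree (z # x # r))\<^sup>*" if "w \<in> set (x # r)" for w
  proof -
    have "(last (x # r), w) \<in> (dtree (x # r))\<^sup>*"
      using 3 that by (cases "z \<in> set (x # r)") auto
    then show ?thesis using rtrancl_mono[OF sub] by auto
  qed
  show ?case
  proof (cases "y \<in> set (x # r)")
    case False
    then have "y = z" "(x, y) \<in> dtree (z # x # r)" using 3 by auto
    then show ?thesis using old[of x] by (meson list.set_intros(1) rtrancl.rtrancl_into_rtrancl)
  qed (use old in blast)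
qed auto

lemma card_dtree: "r \<noteq> [] \<Longrightarrow> card (set r) = Suc (card (dtree r))"
proof (induction r rule: dtree.induct)
  case (3 y x r)
  show ?case
  proof (cases "y \<in> set (x # r)")
    case True
    then have "set (y # x # r) = set (x # r)" by auto
    then show ?thesis using 3(1)[OF True] True by simp
  next
    case False
    then have "(x, y) \<notin> dtree (x # r)" using dtree_vertices[of x y "x # r"] by blast
    then show ?thesis using 3(2)[OF False] False finite_dtree[of "x # r"]
      by (simp del: list.set(2) add: list.set(2)[of y "x # r"])
  qed
qed auto

text \<open>Every visited vertex is reached from the root along tree edges, and the children of each
  reached vertex are dictated by \<open>S\<close>. Hence a common root and a common \<open>S\<close>
  determine both the vertex set and the tree, whatever \<open>S\<close> does off the walks.\<close>

lemma dtree_determined: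
  assumes "r \<noteq> []" "r' \<noteq> []" "last r = last r'"
    and "\<And>x. x \<in> set r \<Longrightarrow> S x = dtree r `` {x}"
    and "\<And>x. x \<in> set r' \<Longrightarrow> S x = dtree r' `` {x}"
  shows "set r = set r' \<and> dtree r = dtree r'"
proof -
  have *: "set q \<subseteq> set q'"
    if q: "q' \<noteq> []" "last q = last q'" "\<And>x. x \<in> set q \<Longrightarrow> S x = dtree q `` {x}"
      "\<And>x. x \<in> set q' \<Longrightarrow> S x = dtree q' `` {x}" for q q'
  proof
    fix y assume "y \<in> set q"
    then have "(last q, y) \<in> (dtree q)\<^sup>*" by (rule dtree_reach)
    then show "y \<in> set q'"
    proof (induction rule: rtrancl_induct)
      case base
      then show ?case using q by simp
    next
      case (step x y)
      then have "y \<in> S x" using q(3) dtree_vertices[of x y q] by auto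
      then show ?case using q(4)[OF step.IH] dtree_vertices[of x y q'] by auto
    qed
  qed
  have eq: "set r = set r'" using *[of r' r] *[of r r'] assms by auto
  moreover have "dtree r = dtree r'"
  proof -
    have "(x, y) \<in> dtree r \<longleftrightarrow> (x, y) \<in> dtree r'" for x y
      using assms(4)[of x] assms(5)[of x] eq dtree_vertices[of x y r] dtree_vertices[of x y r']
      by (cases "x \<in> set r") auto
    then show ?thesis by auto
  qed
  ultimately show ?thesis by simp
qed

lemma length_steps: "length (steps r) = length r - 1"
  by (induction r rule: steps.induct) auto

lemma prod_list_eq_prod_count:
  fixes g :: "'e \<Rightarrow> 'a::comm_monoid_mult"
  assumes "finite J" "set es \<subseteq> J"
  shows "prod_list (map g es) = (\<Prod>e\<in>J. g e ^ count_list es e)"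
  using assms(2)
proof (induction es)
  case (Cons a es)
  have "(\<Prod>e\<in>J. g e ^ count_list (a # es) e) =
      (\<Prod>e\<in>J. (if e = a then g e else 1) * g e ^ count_list es e)"
    by (intro prod.cong) auto
  also have "\<dots> = g a * (\<Prod>e\<in>J. g e ^ count_list es e)"
    using assms(1) Cons.prems by (simp add: prod.distrib)
  finally show ?case using Cons by simp
qed simp

lemma sum_count_list: "finite J \<Longrightarrow> (\<Sum>e\<in>J. count_list es e) \<le> length es"
proof (induction es)
  case (Cons a es)
  have "(\<Sum>e\<in>J. count_list (a # es) e) = (\<Sum>e\<in>J. (if e = a then 1 else 0) + count_list es e)"
    by (intro sum.cong) auto
  also have "\<dots> \<le> 1 + (\<Sum>e\<in>J. count_list es e)"
    using Cons(2) by (simp add: sum.distrib)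
  finally show ?case using Cons by simp
qed simp

section \<open>Walks in graphs with signed and tilted edges\<close>

declare split_paired_All [simp del]

text \<open>A symmetric random matrix indexed by \<open>V\<close>: the entry at an edge is the sign
  with index \<open>ed x y\<close>. Symmetry of \<open>ed\<close> gives both directions the same
  sign, and \<open>ed_inj\<close> gives distinct undirected edges different, hence independent
  signs.\<close>

locale sign_graph =
  fixes V :: "'v set" and adj :: "'v \<Rightarrow> 'v \<Rightarrow> bool" and ed :: "'v \<Rightarrow> 'v \<Rightarrow> nat \<times> nat"
  assumes finite_V: "finite V"
    and adj_sym: "adj x y \<Longrightarrow> adj y x"
    and adj_V: "adj x y \<Longrightarrow> x \<in> V"
    and ed_sym: "ed x y = ed y x"
    and ed_inj: "adj x y \<Longrightarrow> adj x' y' \<Longrightarrow> ed x y = ed x' y' \<Longrightarrow> x' = x \<and> y' = y \<or> x' = y \<and> y' = x"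
begin

definition tilted :: "(nat \<times> nat \<Rightarrow> real) \<Rightarrow> (nat \<times> nat \<Rightarrow> bool) \<Rightarrow> 'v \<Rightarrow> 'v \<Rightarrow> real" where
  "tilted l \<omega> x y = (if adj x y then (if \<omega> (ed x y) then 1 else -1) + l (ed x y) else 0)"

definition edges :: "'v list \<Rightarrow> (nat \<times> nat) list" where
  "edges r = map (\<lambda>(a, b). ed a b) (steps r)"

definition along_edges :: "'v list \<Rightarrow> bool" where
  "along_edges r \<longleftrightarrow> (\<forall>(a, b)\<in>set (steps r). adj a b)"

definition even_walks :: "nat \<Rightarrow> 'v \<Rightarrow> 'v list set" where
  "even_walks n v = {r \<in> walks V n v v. along_edges r \<and> (\<forall>e. even (count_list (edges r) e))}"

lemma finite_even_walks: "finite (even_walks n v)"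
  unfolding even_walks_def using finite_walks[OF finite_V] by simp

text \<open>Independence factors the expectation over the distinct edges of the walk; an edge
  traversed \<open>n\<close> times contributes the mean of \<open>(l + 1) ^ n\<close> and
  \<open>(l - 1) ^ n\<close>.\<close>

lemma expectation_walk:
  "(\<integral>\<omega>. (\<Prod>(a, b)\<leftarrow>steps r. tilted l \<omega> a b) \<partial>rademacher_space) =
    (if along_edges r then \<Prod>e\<in>set (edges r). ((1 + l e) ^ count_list (edges r) e + (l e - 1) ^ count_list (edges r) e) / 2
     else 0)"
proof (cases "along_edges r")
  case True
  have "(\<Prod>(a, b)\<leftarrow>steps r. tilted l \<omega> a b) =
      (\<Prod>e\<in>set (edges r). ((if \<omega> e then 1 else -1) + l e) ^ count_list (edges r) e)" for \<omega>
  proof -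
    have "(\<Prod>(a, b)\<leftarrow>steps r. tilted l \<omega> a b) = prod_list (map (\<lambda>e. (if \<omega> e then 1 else -1) + l e) (edges r))"
      unfolding edges_def map_map
      by (rule arg_cong[where f = prod_list], rule map_cong)
        (use True in \<open>auto simp: along_edges_def tilted_def\<close>)
    then show ?thesis by (subst (asm) prod_list_eq_prod_count[where J = "set (edges r)"]) auto
  qed
  moreover have "(\<integral>\<omega>. (\<Prod>e\<in>set (edges r). ((if \<omega> e then 1 else -1) + l e) ^ count_list (edges r) e) \<partial>rademacher_space)
      = (\<Prod>e\<in>set (edges r). ((1 + l e) ^ count_list (edges r) e + (l e - 1) ^ count_list (edges r) e) / 2)"
    by (subst expectation_prod_signs[where h = "\<lambda>e b. ((if b then 1 else -1) + l e) ^ count_list (edges r) e"])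
      simp_all
  ultimately show ?thesis using True by simp
next
  case False
  then obtain a b where "(a, b) \<in> set (steps r)" "\<not> adj a b" by (auto simp: along_edges_def)
  then have "0 \<in> set (map (\<lambda>(a, b). tilted l \<omega> a b) (steps r))" for \<omega>
    by (force simp: tilted_def)
  then have "(\<Prod>(a, b)\<leftarrow>steps r. tilted l \<omega> a b) = 0" for \<omega>
    by (simp add: prod_list_zero_iff)
  then show ?thesis using False by simp
qed

lemma integrable_walk: "integrable rademacher_space (\<lambda>\<omega>. \<Prod>(a, b)\<leftarrow>steps r. tilted l \<omega> a b)"
proof (rule integrable_finitely_many_signs[where J = "set (edges r)"])
  fix \<omega> \<omega>' :: "nat \<times> nat \<Rightarrow> bool"
  assume eq: "\<And>e. e \<in> set (edges r) \<Longrightarrow> \<omega> e = \<omega>' e"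
  have "tilted l \<omega> a b = tilted l \<omega>' a b" if "(a, b) \<in> set (steps r)" for a b
    using that eq[of "ed a b"] by (force simp: edges_def tilted_def)
  then show "(\<Prod>(a, b)\<leftarrow>steps r. tilted l \<omega> a b) = (\<Prod>(a, b)\<leftarrow>steps r. tilted l \<omega>' a b)"
    by (intro arg_cong[where f = prod_list] map_cong) auto
qed simp

text \<open>Without tilt an edge contributes 1 or 0 according to the parity of its multiplicity, so
  only even walks survive, each with weight one.\<close>

lemma expectation_mpow_zero:
  assumes "v \<in> V"
  shows "(\<integral>\<omega>. mpow V (tilted (\<lambda>_. 0) \<omega>) n v v \<partial>rademacher_space) = card (even_walks n v)"
proof -
  have "(\<integral>\<omega>. mpow V (tilted (\<lambda>_. 0) \<omega>) n v v \<partial>rademacher_space) =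
      (\<Sum>r\<in>walks V n v v. \<integral>\<omega>. (\<Prod>(a, b)\<leftarrow>steps r. tilted (\<lambda>_. 0) \<omega> a b) \<partial>rademacher_space)"
    unfolding mpow_eq_sum_walks[OF finite_V assms assms]
    by (rule Bochner_Integration.integral_sum) (rule integrable_walk)
  also have "\<dots> = (\<Sum>r\<in>walks V n v v. if r \<in> even_walks n v then 1 else 0)"
  proof (intro sum.cong refl)
    fix r assume r: "r \<in> walks V n v v"
    have "(\<Prod>e\<in>set (edges r). (1 + (- 1) ^ count_list (edges r) e) / 2) =
        (if \<forall>e. even (count_list (edges r) e) then 1 else 0 :: real)"
    proof (cases "\<forall>e. even (count_list (edges r) e)")
      case False
      then obtain e where e: "odd (count_list (edges r) e)" by auto
      then have "e \<in> set (edges r)" using count_list_0_iff[of "edges r" e] by (metis even_zero)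
      then show ?thesis using e False by (auto intro!: bexI[of _ e] simp: prod_zero_iff)
    qed simp
    then show "(\<integral>\<omega>. (\<Prod>(a, b)\<leftarrow>steps r. tilted (\<lambda>_. 0) \<omega> a b) \<partial>rademacher_space) =
        (if r \<in> even_walks n v then 1 else 0)"
      unfolding expectation_walk using r by (simp add: even_walks_def)
  qed
  also have "\<dots> = card (even_walks n v)"
    using finite_walks[OF finite_V] by (subst sum.If_cases) (auto simp: even_walks_def Int_def)
  finally show ?thesis .
qed

text \<open>The sum makes the tilt a function of the sign index; for a forest at most one summand is
  nonzero. The value \<open>1 / sqrt k\<close> normalises the star from a vertex to its
  \<open>k\<close> children to norm one; the factor \<open>sqrt D\<close> is applied by the
  users.\<close>

definition tilt :: "('v \<times> 'v) set \<Rightarrow> nat \<times> nat \<Rightarrow> real" where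
  "tilt T e = (\<Sum>(x, y)\<in>T. if ed x y = e then 1 / sqrt (card (T `` {x})) else 0)"

lemma tilt_nonneg: "tilt T e \<ge> 0"
  unfolding tilt_def by (intro sum_nonneg) auto

text \<open>Weaker than acyclicity: no pair occurs in both directions and every vertex has at most
  one parent. These are the properties behind the norm bound for the tilt.\<close>

definition is_forest :: "('v \<times> 'v) set \<Rightarrow> bool" where
  "is_forest T \<longleftrightarrow> finite T \<and> (\<forall>(x, y)\<in>T. adj x y \<and> (y, x) \<notin> T) \<and> inj_on snd T"

lemma inj_on_ed_forest: "is_forest T \<Longrightarrow> inj_on (\<lambda>(x, y). ed x y) T"
proof (rule inj_onI, clarify)
  fix x y a b
  assume T: "is_forest T" and xy: "(x, y) \<in> T" and ab: "(a, b) \<in> T" and eq: "ed x y = ed a b"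
  have "adj x y" "adj a b" "(y, x) \<notin> T" using T xy ab by (auto simp: is_forest_def)
  then show "x = a \<and> y = b" using ed_inj[OF _ _ eq] ab by blast
qed

lemma tilt_edge:
  assumes T: "is_forest T" and "adj x y"
  shows "tilt T (ed x y) = (if (x, y) \<in> T then 1 / sqrt (card (T `` {x})) else 0) +
      (if (y, x) \<in> T then 1 / sqrt (card (T `` {y})) else 0)"
proof -
  have fin: "finite T" using T by (simp add: is_forest_def)
  have "tilt T (ed x y) = (\<Sum>z\<in>T. (if z = (x, y) then 1 / sqrt (card (T `` {x})) else 0) +
      (if z = (y, x) then 1 / sqrt (card (T `` {y})) else 0))"
    unfolding tilt_def
  proof (intro sum.cong refl, clarify)
    fix a b assume ab: "(a, b) \<in> T"
    then have adj: "adj a b" and nba: "(b, a) \<notin> T" using T by (auto simp: is_forest_def)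
    then have "a \<noteq> b" using ab by auto
    then show "(if ed a b = ed x y then 1 / sqrt (real (card (T `` {a}))) else 0) =
       (if (a, b) = (x, y) then 1 / sqrt (real (card (T `` {x}))) else 0) +
       (if (a, b) = (y, x) then 1 / sqrt (real (card (T `` {y}))) else 0)"
    proof (cases "ed a b = ed x y")
      case True
      then have "a = x \<and> b = y \<or> a = y \<and> b = x" using ed_inj[OF assms(2) adj] by simp
      then show ?thesis
      proof
        assume "a = x \<and> b = y"
        then show ?thesis using True \<open>a \<noteq> b\<close> by simp
      next
        assume "a = y \<and> b = x"
        then show ?thesis using True \<open>a \<noteq> b\<close> by simp
      qed
    next
      case False
      then have A: "(a, b) \<noteq> (x, y)" and B: "(a, b) \<noteq> (y, x)" using ed_sym by (blast, metis prod.inject)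
      show ?thesis unfolding if_not_P[OF A] if_not_P[OF B] if_not_P[OF False] by simp
    qed
  qed
  also have "\<dots> = (if (x, y) \<in> T then 1 / sqrt (card (T `` {x})) else 0) +
      (if (y, x) \<in> T then 1 / sqrt (card (T `` {y})) else 0)"
    using fin by (simp add: sum.distrib)
  finally show ?thesis .
qed

text \<open>The tilt splits into the parent-to-child matrix \<open>D\<close> and its transpose. The
  rows of \<open>D\<close> have disjoint supports because parents are unique, and each nonzero row
  is a unit vector, so either part has norm at most one.\<close>

lemma bform_tilt_le:
  assumes T: "is_forest T" and V0: "finite V0" "T \<subseteq> V0 \<times> V0"
  shows "bform V0 (\<lambda>x y. if adj x y then tilt T (ed x y) else 0) g h \<le> 2 * L2_set g V0 * L2_set h V0"
proof -
  define D where "D x y = (if (x, y) \<in> T then 1 / sqrt (card (T `` {x})) else 0)" for x y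
  have finT: "finite T" using T by (simp add: is_forest_def)
  have D: "bform V0 D g h \<le> L2_set g V0 * L2_set h V0" for g h
  proof -
    have "bform V0 D g h = (\<Sum>(x, y)\<in>V0 \<times> V0. D x y * g x * h y)"
      unfolding bform_def by (rule sum.cartesian_product)
    also have "\<dots> = (\<Sum>(x, y)\<in>T. (g x / sqrt (card (T `` {x}))) * h y)"
      by (rule sum.mono_neutral_cong_right) (use V0 in \<open>auto simp: D_def\<close>)
    also have "\<dots> = (\<Sum>z\<in>T. (g (fst z) / sqrt (card (T `` {fst z}))) * h (snd z))"
      by (simp add: case_prod_beta')
    also have "\<dots> \<le> L2_set (\<lambda>z. g (fst z) / sqrt (card (T `` {fst z}))) T * L2_set (\<lambda>z. h (snd z)) T"
      by (rule sum_mult_le_L2)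
    also have "\<dots> \<le> L2_set g V0 * L2_set h V0"
    proof (intro mult_mono L2_set_nonneg)
      have "(\<Sum>z\<in>T. (g (fst z) / sqrt (card (T `` {fst z})))\<^sup>2) =
          (\<Sum>(x, y)\<in>(SIGMA x:V0. T `` {x}). (g x)\<^sup>2 / card (T `` {x}))"
        by (rule sum.cong) (use V0 in \<open>auto simp: power_divide\<close>)
      also have "\<dots> = (\<Sum>x\<in>V0. \<Sum>y\<in>T `` {x}. (g x)\<^sup>2 / card (T `` {x}))"
        by (rule sum.Sigma[symmetric]) (use V0 finT in auto)
      also have "\<dots> \<le> (\<Sum>x\<in>V0. (g x)\<^sup>2)"
        by (intro sum_mono) (auto simp: divide_simps)
      finally show "L2_set (\<lambda>z. g (fst z) / sqrt (card (T `` {fst z}))) T \<le> L2_set g V0"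
        by (simp add: L2_set_def)
      have "(\<Sum>z\<in>T. (h (snd z))\<^sup>2) = (\<Sum>y\<in>snd ` T. (h y)\<^sup>2)"
        using T by (simp add: sum.reindex is_forest_def)
      also have "\<dots> \<le> (\<Sum>y\<in>V0. (h y)\<^sup>2)"
        by (rule sum_mono2) (use V0 in auto)
      finally show "L2_set (\<lambda>z. h (snd z)) T \<le> L2_set h V0" by (simp add: L2_set_def)
    qed
    finally show ?thesis .
  qed
  have "bform V0 (\<lambda>x y. if adj x y then tilt T (ed x y) else 0) g h =
      (\<Sum>x\<in>V0. \<Sum>y\<in>V0. D x y * g x * h y + D y x * h y * g x)"
    unfolding bform_def
  proof (intro sum.cong refl)
    fix x y
    show "(if adj x y then tilt T (ed x y) else 0) * g x * h y = D x y * g x * h y + D y x * h y * g x"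
    proof (cases "adj x y")
      case False
      then have "(x, y) \<notin> T" "(y, x) \<notin> T" using T adj_sym by (auto simp: is_forest_def)
      then show ?thesis using False by (simp add: D_def)
    qed (simp add: tilt_edge[OF T] D_def algebra_simps)
  qed
  also have "\<dots> = bform V0 D g h + bform V0 D h g"
    unfolding bform_def sum.distrib by (subst (2) sum.swap) simp
  also have "\<dots> \<le> L2_set g V0 * L2_set h V0 + L2_set h V0 * L2_set g V0"
    by (intro add_mono D)
  finally show ?thesis by simp
qed

lemma is_forest_dtree:
  assumes "along_edges r"
  shows "is_forest (dtree r)"
proof -
  have "adj x y" if "(x, y) \<in> dtree r" for x y
    using dtree_step[OF that] assms adj_sym by (auto simp: along_edges_def)
  moreover have "inj_on snd (dtree r)"
    by (rule inj_onI) (metis dtree_parent_unique prod.collapse)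
  ultimately show ?thesis
    using finite_dtree dtree_antisym unfolding is_forest_def by fast
qed

lemma even_power_tilt_ge:
  fixes l :: real
  assumes "even n" "n \<ge> 2" "l \<ge> 0"
  shows "((1 + l) ^ n + (l - 1) ^ n) / 2 \<ge> l\<^sup>2 / 2"
proof -
  have "l\<^sup>2 \<le> (1 + l)\<^sup>2" using assms by (intro power_mono) auto
  also have "\<dots> \<le> (1 + l) ^ n" using assms by (intro power_increasing) auto
  finally show ?thesis using zero_le_even_power[OF assms(1), of "l - 1"] by simp
qed

lemma even_walk_edge_twice:
  assumes "r \<in> even_walks n v" "(x, y) \<in> dtree r"
  shows "count_list (edges r) (ed x y) \<ge> 2"
proof -
  have "ed y x \<in> set (edges r)" using dtree_step[OF assms(2)] by (force simp: edges_def)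
  then have "count_list (edges r) (ed x y) \<noteq> 0" by (simp add: count_list_0_iff ed_sym[of x y])
  moreover have "even (count_list (edges r) (ed x y))" using assms by (simp add: even_walks_def)
  ultimately show ?thesis by (metis One_nat_def Suc_1 Suc_leI dvd_imp_le gr0I)
qed

lemma card_even_walk:
  assumes "r \<in> even_walks (2 * p) v"
  shows "card (set r) \<le> Suc p"
proof -
  have T: "is_forest (dtree r)" using assms by (intro is_forest_dtree) (simp add: even_walks_def)
  have "2 * card (dtree r) = (\<Sum>e\<in>(\<lambda>(x, y). ed x y) ` dtree r. 2)"
    by (simp add: card_image[OF inj_on_ed_forest[OF T]])
  also have "\<dots> \<le> (\<Sum>e\<in>(\<lambda>(x, y). ed x y) ` dtree r. count_list (edges r) e)"
    by (rule sum_mono) (use even_walk_edge_twice[OF assms] in auto)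
  also have "\<dots> \<le> length (edges r)" by (rule sum_count_list) (simp add: finite_dtree)
  also have "\<dots> = 2 * p" using assms by (simp add: edges_def length_steps even_walks_def walks_def)
  finally have "card (dtree r) \<le> p" by simp
  moreover have "r \<noteq> []" using assms by (auto simp: even_walks_def walks_def)
  ultimately show ?thesis using card_dtree[of r] by simp
qed

text \<open>Edges off the tree have zero tilt and even multiplicity, hence contribute one. A tree
  edge is used at least twice and contributes at least \<open>l\<^sup>2 / 2\<close>, that is
  \<open>D / (2 * k)\<close>. Grouping by parents gives the product; a leaf has factor one because
  the exponent is zero.\<close>

lemma expectation_even_walk_ge:
  assumes r: "r \<in> even_walks n v" and D: "D \<ge> 0"
  shows "(\<integral>\<omega>. (\<Prod>(a, b)\<leftarrow>steps r. tilted (\<lambda>e. sqrt D * tilt (dtree r) e) \<omega> a b) \<partial>rademacher_space) \<ge>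
    (\<Prod>x\<in>set r. (D / (2 * card (dtree r `` {x}))) ^ card (dtree r `` {x}))"
proof -
  define T where "T = dtree r"
  define l where "l e = sqrt D * tilt T e" for e
  have ae: "along_edges r" and ev: "even (count_list (edges r) e)" for e
    using r by (auto simp: even_walks_def)
  have T: "is_forest T" unfolding T_def by (rule is_forest_dtree[OF ae])
  have finT: "finite T" using T by (simp add: is_forest_def)
  have l_nonneg: "l e \<ge> 0" for e using D by (simp add: l_def tilt_nonneg)
  let ?E = "(\<lambda>(x, y). ed x y) ` T"
  have sub: "?E \<subseteq> set (edges r)"
  proof
    fix e assume "e \<in> ?E"
    then obtain x y where "(x, y) \<in> T" and e: "e = ed x y" by auto
    then have "(y, x) \<in> set (steps r)" using dtree_step unfolding T_def by metis
    then have "ed y x \<in> set (edges r)" by (force simp: edges_def)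
    then show "e \<in> set (edges r)" by (simp add: ed_sym[of x y] e)
  qed
  have TV: "T \<subseteq> set r \<times> set r" using dtree_vertices by (fastforce simp: T_def)
  have "(\<Prod>x\<in>set r. (D / (2 * card (T `` {x}))) ^ card (T `` {x})) =
      (\<Prod>x\<in>set r. \<Prod>y\<in>T `` {x}. D / (2 * card (T `` {x})))"
    by simp
  also have "\<dots> = (\<Prod>(x, y)\<in>(SIGMA x:set r. T `` {x}). D / (2 * card (T `` {x})))"
    by (rule prod.Sigma) (use finT in auto)
  also have "(SIGMA x:set r. T `` {x}) = T" using TV by auto
  also have "(\<Prod>(x, y)\<in>T. D / (2 * card (T `` {x}))) = (\<Prod>(x, y)\<in>T. (l (ed x y))\<^sup>2 / 2)"
  proof (intro prod.cong refl, clarify)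
    fix x y assume xy: "(x, y) \<in> T"
    then have "adj x y" "(y, x) \<notin> T" using T by (auto simp: is_forest_def)
    then have "l (ed x y) = sqrt D / sqrt (card (T `` {x}))"
      using xy by (simp add: l_def tilt_edge[OF T])
    then show "D / real (2 * card (T `` {x})) = (l (ed x y))\<^sup>2 / 2"
      using D by (simp add: power_divide)
  qed
  also have "\<dots> = (\<Prod>e\<in>?E. (l e)\<^sup>2 / 2)"
    by (subst prod.reindex[OF inj_on_ed_forest[OF T]]) (simp add: case_prod_beta')
  also have "\<dots> = (\<Prod>e\<in>set (edges r). if e \<in> ?E then (l e)\<^sup>2 / 2 else 1)"
    using sub by (subst prod.mono_neutral_cong_right[of "set (edges r)" ?E]) auto
  also have "\<dots> \<le> (\<Prod>e\<in>set (edges r). ((1 + l e) ^ count_list (edges r) e + (l e - 1) ^ count_list (edges r) e) / 2)"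
  proof (intro prod_mono conjI)
    fix e
    show "0 \<le> (if e \<in> ?E then (l e)\<^sup>2 / 2 else 1)" by simp
    show "(if e \<in> ?E then (l e)\<^sup>2 / 2 else 1) \<le>
        ((1 + l e) ^ count_list (edges r) e + (l e - 1) ^ count_list (edges r) e) / 2"
    proof (cases "e \<in> ?E")
      case True
      then have "count_list (edges r) e \<ge> 2"
        using even_walk_edge_twice[OF r] by (auto simp: T_def)
      then show ?thesis using even_power_tilt_ge[OF ev _ l_nonneg, of e e] True by simp
    next
      case False
      then have "tilt T e = 0" unfolding tilt_def by (intro sum.neutral) auto
      then show ?thesis using False ev[of e] by (simp add: l_def)
    qed
  qed
  also have "\<dots> = (\<integral>\<omega>. (\<Prod>(a, b)\<leftarrow>steps r. tilted l \<omega> a b) \<partial>rademacher_space)"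
    using ae by (simp add: expectation_walk)
  finally show ?thesis by (simp add: T_def l_def[abs_def])
qed

text \<open>Since \<open>\<bar>l - 1\<bar> \<le> 1 + l\<close>, every edge factor is nonnegative.
  This permits discarding all walks outside a chosen class when a power of the tilted matrix is
  bounded below.\<close>

lemma expectation_walk_nonneg:
  assumes "\<And>e. l e \<ge> 0"
  shows "(\<integral>\<omega>. (\<Prod>(a, b)\<leftarrow>steps r. tilted l \<omega> a b) \<partial>rademacher_space) \<ge> 0"
proof -
  have "0 \<le> (1 + x) ^ n + (x - 1) ^ n" if "x \<ge> 0" for x :: real and n
  proof -
    have "\<bar>(x - 1) ^ n\<bar> \<le> (1 + x) ^ n" unfolding power_abs using that by (intro power_mono) auto
    then show ?thesis by (simp add: abs_le_iff)
  qed
  then show ?thesis unfolding expectation_walk using assms by (auto intro!: prod_nonneg)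
qed

lemma integrable_mpow:
  assumes "finite V0" "v \<in> V0"
  shows "integrable rademacher_space (\<lambda>\<omega>. mpow V0 (tilted l \<omega>) n v v)"
  unfolding mpow_eq_sum_walks[OF assms(1,2,2)] by (intro Bochner_Integration.integrable_sum integrable_walk)

text \<open>Walks with a common tree share both the tilt and the vertex set, so a single tilted
  matrix on \<open>set r0\<close> accounts for all of them at once.\<close>

lemma expectation_mpow_tilt_ge:
  assumes r0: "r0 \<in> even_walks n v" and D: "D \<ge> 0"
    and W: "W \<subseteq> even_walks n v" "\<And>r. r \<in> W \<Longrightarrow> set r = set r0 \<and> dtree r = dtree r0"
  shows "card W * (\<Prod>x\<in>set r0. (D / (2 * card (dtree r0 `` {x}))) ^ card (dtree r0 `` {x})) \<le>
    (\<integral>\<omega>. mpow (set r0) (tilted (\<lambda>e. sqrt D * tilt (dtree r0) e) \<omega>) n v v \<partial>rademacher_space)"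
proof -
  let ?l = "\<lambda>e. sqrt D * tilt (dtree r0) e"
  let ?P = "\<Prod>x\<in>set r0. (D / (2 * card (dtree r0 `` {x}))) ^ card (dtree r0 `` {x})"
  have v: "v \<in> set r0" using r0 by (cases r0) (auto simp: even_walks_def walks_def)
  have sub: "W \<subseteq> walks (set r0) n v v"
  proof
    fix r assume "r \<in> W"
    then have "r \<in> even_walks n v" "set r = set r0" using W by auto
    then show "r \<in> walks (set r0) n v v" by (simp add: even_walks_def walks_def)
  qed
  have "card W * ?P = (\<Sum>r\<in>W. ?P)" by simp
  also have "\<dots> \<le> (\<Sum>r\<in>W. \<integral>\<omega>. (\<Prod>(a, b)\<leftarrow>steps r. tilted ?l \<omega> a b) \<partial>rademacher_space)"
  proof (rule sum_mono)
    fix r assume "r \<in> W"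
    then show "?P \<le> (\<integral>\<omega>. (\<Prod>(a, b)\<leftarrow>steps r. tilted ?l \<omega> a b) \<partial>rademacher_space)"
      using expectation_even_walk_ge[OF _ D, of r n v] W by auto
  qed
  also have "\<dots> \<le> (\<Sum>r\<in>walks (set r0) n v v. \<integral>\<omega>. (\<Prod>(a, b)\<leftarrow>steps r. tilted ?l \<omega> a b) \<partial>rademacher_space)"
    by (rule sum_mono2[OF finite_walks sub]) (use D in \<open>auto intro!: expectation_walk_nonneg simp: tilt_nonneg\<close>)
  also have "\<dots> = (\<integral>\<omega>. mpow (set r0) (tilted ?l \<omega>) n v v \<partial>rademacher_space)"
    unfolding mpow_eq_sum_walks[OF finite_set v v]
    by (rule Bochner_Integration.integral_sum[symmetric]) (rule integrable_walk)
  finally show ?thesis .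
qed

end

section \<open>Nets\<close>

lemma sum_half_power_int: "(\<Sum>k\<in>{- int n..int n}. (1/2 :: real) ^ nat \<bar>k\<bar>) = 3 - 2 * (1/2) ^ n"
proof (induction n)
  case (Suc n)
  have "{- int (Suc n)..int (Suc n)} = insert (- int (Suc n)) (insert (int (Suc n)) {- int n..int n})"
    by auto
  then have "(\<Sum>k\<in>{- int (Suc n)..int (Suc n)}. (1/2 :: real) ^ nat \<bar>k\<bar>) =
      (1/2) ^ Suc n + ((1/2) ^ Suc n + (\<Sum>k\<in>{- int n..int n}. (1/2 :: real) ^ nat \<bar>k\<bar>))"
    by (simp add: nat_add_distrib)
  then show ?case using Suc by simp
qed simp

text \<open>Counting by exponential weights: every admissible point has weight at least
  \<open>(1/2) ^ L\<close>, and the total weight factors over the coordinates, each giving at most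
  \<open>1 + 2 * (1/2 + 1/4 + ...) = 3\<close>.\<close>

lemma card_lattice_points_le:
  assumes V: "finite V"
  shows "card {z \<in> PiE V (\<lambda>_. {- int L..int L}). (\<Sum>x\<in>V. \<bar>z x\<bar>) \<le> int L} \<le> 2 ^ L * 3 ^ card V"
proof -
  let ?Z = "{z \<in> PiE V (\<lambda>_. {- int L..int L}). (\<Sum>x\<in>V. \<bar>z x\<bar>) \<le> int L}"
  have fin: "finite (PiE V (\<lambda>_. {- int L..int L}))" using V by (intro finite_PiE) auto
  have "real (card ?Z) * (1/2) ^ L = (\<Sum>z\<in>?Z. (1/2) ^ L)" by simp
  also have "\<dots> \<le> (\<Sum>z\<in>?Z. \<Prod>x\<in>V. (1/2) ^ nat \<bar>z x\<bar>)"
  proof (rule sum_mono)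
    fix z assume "z \<in> ?Z"
    then have "int (\<Sum>x\<in>V. nat \<bar>z x\<bar>) \<le> int L" by simp
    then have "(\<Sum>x\<in>V. nat \<bar>z x\<bar>) \<le> L" by linarith
    then have "(1/2 :: real) ^ L \<le> (1/2) ^ (\<Sum>x\<in>V. nat \<bar>z x\<bar>)" by (intro power_decreasing) auto
    then show "(1/2 :: real) ^ L \<le> (\<Prod>x\<in>V. (1/2) ^ nat \<bar>z x\<bar>)" by (simp add: power_sum)
  qed
  also have "\<dots> \<le> (\<Sum>z\<in>PiE V (\<lambda>_. {- int L..int L}). \<Prod>x\<in>V. (1/2) ^ nat \<bar>z x\<bar>)"
    by (rule sum_mono2[OF fin]) (auto intro!: prod_nonneg)
  also have "\<dots> = (\<Prod>x\<in>V. \<Sum>k\<in>{- int L..int L}. (1/2) ^ nat \<bar>k\<bar>)"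
    by (rule prod_sum_PiE[symmetric]) (use V in auto)
  also have "\<dots> \<le> (\<Prod>x\<in>V. 3)"
    by (intro prod_mono conjI sum_nonneg) (simp_all add: sum_half_power_int)
  finally have "real (card ?Z) \<le> real (2 ^ L * 3 ^ card V)" by (simp add: field_simps)
  then show ?thesis by (simp only: of_nat_le_iff)
qed

lemma bform_add_left: "bform V M (\<lambda>x. g x + g' x) h = bform V M g h + bform V M g' h"
  by (simp add: bform_def algebra_simps sum.distrib)

lemma bform_add_right: "bform V M g (\<lambda>x. h x + h' x) = bform V M g h + bform V M g h'"
  by (simp add: bform_def algebra_simps sum.distrib)

lemma bform_scale: "bform V M (\<lambda>x. a * g x) (\<lambda>x. b * h x) = a * b * bform V M g h"
  by (simp add: bform_def sum_distrib_left ac_simps)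

lemma L2_set_scale: "L2_set (\<lambda>x. a * g x) V = \<bar>a\<bar> * L2_set g V"
  unfolding L2_set_def power_mult_distrib sum_distrib_left[symmetric] real_sqrt_mult by simp

lemma L2_set_abs: "L2_set (\<lambda>x. \<bar>g x\<bar>) V = L2_set g V"
  by (simp add: L2_set_def)

lemma abs_le_1_of_L2: "finite V \<Longrightarrow> x \<in> V \<Longrightarrow> L2_set g V \<le> 1 \<Longrightarrow> \<bar>g x\<bar> \<le> 1"
  using member_le_L2_set[of V x "\<lambda>x. \<bar>g x\<bar>"] L2_set_abs[of g V] by linarith

lemma bform_unit_le:
  assumes "finite V" "L2_set g V \<le> 1" "L2_set h V \<le> 1"
  shows "bform V M g h \<le> (\<Sum>x\<in>V. \<Sum>y\<in>V. \<bar>M x y\<bar>)"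
  unfolding bform_def
proof (intro sum_mono)
  fix x y assume "x \<in> V" "y \<in> V"
  then have *: "\<bar>g x\<bar> \<le> 1" "\<bar>h y\<bar> \<le> 1" using abs_le_1_of_L2 assms by metis+
  have "M x y * g x * h y \<le> \<bar>M x y\<bar> * (\<bar>g x\<bar> * \<bar>h y\<bar>)"
    using abs_ge_self[of "M x y * g x * h y"] by (simp add: abs_mult mult.assoc)
  also have "\<dots> \<le> \<bar>M x y\<bar> * (1 * 1)" using * by (intro mult_left_mono mult_mono) auto
  finally show "M x y * g x * h y \<le> \<bar>M x y\<bar>" by simp
qed

lemma bform_le_of_unit:
  assumes V: "finite V" and A: "\<And>g h. L2_set g V = 1 \<Longrightarrow> L2_set h V = 1 \<Longrightarrow> bform V M g h \<le> A"
  shows "bform V M g h \<le> A * L2_set g V * L2_set h V"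
proof (cases "L2_set g V = 0 \<or> L2_set h V = 0")
  case True
  then have "(\<forall>x\<in>V. g x = 0) \<or> (\<forall>x\<in>V. h x = 0)" using V by (simp add: L2_set_eq_0_iff)
  then have "bform V M g h = 0" by (auto simp: bform_def)
  then show ?thesis using True by auto
next
  case False
  let ?a = "L2_set g V" and ?b = "L2_set h V"
  have pos: "?a > 0" "?b > 0" using False L2_set_nonneg by (metis less_eq_real_def)+
  have "bform V M (\<lambda>x. (1 / ?a) * g x) (\<lambda>x. (1 / ?b) * h x) \<le> A"
    by (rule A) (use pos in \<open>simp_all only: L2_set_scale abs_of_pos, simp_all\<close>)
  then have "(1 / ?a) * (1 / ?b) * bform V M g h \<le> A" by (simp only: bform_scale)
  then show ?thesis using pos by (simp add: field_simps)
qed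

lemma round_toward_zero: "\<exists>k::int. \<bar>k\<bar> \<le> \<bar>y\<bar> \<and> \<bar>y - k\<bar> \<le> 1" for y :: real
proof (cases "y \<ge> 0")
  case True
  then show ?thesis by (intro exI[of _ "\<lfloor>y\<rfloor>"]) (auto simp: abs_le_iff; linarith)
next
  case False
  then show ?thesis by (intro exI[of _ "\<lceil>y\<rceil>"]) (auto simp: abs_le_iff; linarith)
qed

text \<open>Round \<open>c * g\<close> toward zero to integers, with \<open>c = 4 * sqrt N\<close>.
  The error is at most \<open>1 / c\<close> per coordinate, hence \<open>1 / 4\<close> in norm;
  rounding toward zero stays in the unit ball. By Cauchy-Schwarz the integer points have absolute
  sum at most \<open>4 * N\<close>, which gives \<open>2 ^ (4 * N) * 3 ^ N = 48 ^ N\<close>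
  points.\<close>

lemma finite_net:
  fixes V :: "'v set"
  assumes V: "finite V" "V \<noteq> {}"
  obtains net :: "('v \<Rightarrow> real) set"
    where "finite net" "card net \<le> 48 ^ card V" "\<And>g. g \<in> net \<Longrightarrow> L2_set g V \<le> 1"
      and "\<And>g. L2_set g V \<le> 1 \<Longrightarrow> \<exists>g'\<in>net. L2_set (\<lambda>x. g x - g' x) V \<le> 1 / 4"
proof -
  define N where "N = card V"
  have N: "N \<ge> 1" using V by (simp add: N_def Suc_le_eq card_gt_0_iff)
  define c where "c = 4 * sqrt N"
  have c: "c > 0" using N by (simp add: c_def)
  define Z where "Z = {z \<in> PiE V (\<lambda>_. {- int (4 * N)..int (4 * N)}). (\<Sum>x\<in>V. \<bar>z x\<bar>) \<le> int (4 * N)}"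
  define Z' where "Z' = {z \<in> Z. L2_set (\<lambda>x. real_of_int (z x) / c) V \<le> 1}"
  define net where "net = (\<lambda>z x. real_of_int (z x) / c) ` Z'"
  have finZ: "finite Z" unfolding Z_def using V by (auto intro!: finite_PiE)
  then have finZ': "finite Z'" by (simp add: Z'_def)
  have "card net \<le> card Z'" unfolding net_def using finZ' by (rule card_image_le)
  also have "\<dots> \<le> card Z" using finZ by (intro card_mono) (auto simp: Z'_def)
  also have "\<dots> \<le> 2 ^ (4 * N) * 3 ^ N" unfolding Z_def N_def by (rule card_lattice_points_le[OF V(1)])
  also have "\<dots> = 48 ^ N" by (simp add: power_mult flip: power_mult_distrib)
  finally have card: "card net \<le> 48 ^ card V" by (simp add: N_def)
  have approx: "\<exists>g'\<in>net. L2_set (\<lambda>x. g x - g' x) V \<le> 1 / 4" if g: "L2_set g V \<le> 1" for g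
  proof -
    obtain z0 where z0: "\<And>x. \<bar>real_of_int (z0 x)\<bar> \<le> \<bar>c * g x\<bar> \<and> \<bar>c * g x - z0 x\<bar> \<le> 1"
      using round_toward_zero[of "c * g _"] by (metis of_int_abs)
    define z where "z = restrict z0 V"
    have zc: "\<bar>real_of_int (z x) / c\<bar> \<le> \<bar>g x\<bar>" if "x \<in> V" for x
      using z0[of x] c that by (simp add: z_def field_simps abs_mult)
    have "(\<Sum>x\<in>V. \<bar>g x\<bar> * \<bar>1\<bar>) \<le> L2_set g V * L2_set (\<lambda>_. 1) V" by (rule L2_set_mult_ineq)
    also have "\<dots> \<le> 1 * sqrt N" using g by (intro mult_mono) (auto simp: L2_set_constant N_def)
    finally have g1: "(\<Sum>x\<in>V. \<bar>g x\<bar>) \<le> sqrt N" by simp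
    have "real_of_int (\<Sum>x\<in>V. \<bar>z x\<bar>) = (\<Sum>x\<in>V. \<bar>real_of_int (z x)\<bar>)" by simp
    also have "\<dots> \<le> (\<Sum>x\<in>V. c * \<bar>g x\<bar>)"
    proof (rule sum_mono)
      fix x assume "x \<in> V"
      then show "\<bar>real_of_int (z x)\<bar> \<le> c * \<bar>g x\<bar>" using z0[of x] c by (simp add: z_def abs_mult)
    qed
    also have "\<dots> \<le> c * sqrt N" using g1 c by (simp add: mult_left_mono flip: sum_distrib_left)
    also have "\<dots> = 4 * N" by (simp add: c_def)
    finally have sum: "(\<Sum>x\<in>V. \<bar>z x\<bar>) \<le> int (4 * N)" by linarith
    have "- int (4 * N) \<le> z x \<and> z x \<le> int (4 * N)" if "x \<in> V" for x
      using member_le_sum[OF that _ V(1), of "\<lambda>x. \<bar>z x\<bar>"] sum by simp linarith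
    then have "z \<in> PiE V (\<lambda>_. {- int (4 * N)..int (4 * N)})"
      by (auto simp: z_def PiE_iff)
    then have "z \<in> Z" using sum by (simp add: Z_def)
    moreover have "L2_set (\<lambda>x. real_of_int (z x) / c) V \<le> L2_set g V"
      unfolding L2_set_def by (intro real_sqrt_le_mono sum_mono) (metis zc abs_le_square_iff)
    ultimately have "z \<in> Z'" using g by (simp add: Z'_def)
    moreover have "L2_set (\<lambda>x. g x - real_of_int (z x) / c) V \<le> 1 / 4"
    proof -
      have "\<bar>g x - real_of_int (z x) / c\<bar> \<le> 1 / c" if "x \<in> V" for x
      proof -
        have "g x - real_of_int (z x) / c = (c * g x - z x) / c" using c by (simp add: field_simps)
        then show ?thesis using z0[of x] c that by (simp add: z_def divide_right_mono)
      qed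
      then have "(\<Sum>x\<in>V. (g x - real_of_int (z x) / c)\<^sup>2) \<le> (\<Sum>x\<in>V. (1 / c)\<^sup>2)"
        using c by (intro sum_mono) (metis abs_le_square_iff abs_of_pos divide_pos_pos zero_less_one)
      also have "\<dots> = (1 / 4)\<^sup>2" using N by (simp add: c_def power_divide power_mult_distrib N_def)
      finally show ?thesis unfolding L2_set_def by (intro real_le_lsqrt) (auto intro: sum_nonneg)
    qed
    ultimately show ?thesis unfolding net_def by auto
  qed
  show ?thesis
    by (rule that[of net]) (use finZ' card approx in \<open>auto simp: net_def Z'_def\<close>)
qed

text \<open>Replacing both arguments by net points shows that the supremum \<open>A\<close> over the
  unit balls satisfies \<open>A \<le> K + A / 4 + A / 4\<close>. Finiteness of \<open>A\<close>,
  needed to absorb, comes from \<open>bform_unit_le\<close>.\<close>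

lemma bform_le_of_net:
  assumes V: "finite V" and net: "\<And>g. g \<in> net \<Longrightarrow> L2_set g V \<le> 1"
      "\<And>g. L2_set g V \<le> 1 \<Longrightarrow> \<exists>g'\<in>net. L2_set (\<lambda>x. g x - g' x) V \<le> 1 / 4"
    and K: "\<And>g h. g \<in> net \<Longrightarrow> h \<in> net \<Longrightarrow> bform V M g h \<le> K"
  shows "bform V M g h \<le> 2 * K * L2_set g V * L2_set h V"
proof -
  define P where "P = {(g, h). L2_set g V \<le> 1 \<and> L2_set h V \<le> 1}"
  define A where "A = (SUP (g, h)\<in>P. bform V M g h)"
  have ne: "P \<noteq> {}" unfolding P_def by (auto intro!: exI[of _ "\<lambda>_. 0"] simp: L2_set_def)
  have bdd: "bdd_above ((\<lambda>(g, h). bform V M g h) ` P)"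
    by (rule bdd_aboveI2) (use bform_unit_le[OF V] in \<open>auto simp: P_def\<close>)
  have A: "bform V M g h \<le> A" if "L2_set g V \<le> 1" "L2_set h V \<le> 1" for g h
    using cSUP_upper[OF _ bdd, of "(g, h)"] that by (simp add: P_def A_def)
  have A': "bform V M g h \<le> A * L2_set g V * L2_set h V" for g h
    by (rule bform_le_of_unit[OF V A]) auto
  have A0: "A \<ge> 0" using A[of "\<lambda>_. 0" "\<lambda>_. 0"] by (simp add: bform_def L2_set_def)
  have "A \<le> K + A / 2"
    unfolding A_def
  proof (rule cSUP_least[OF ne], clarify)
    fix g h assume "(g, h) \<in> P"
    then have gh: "L2_set g V \<le> 1" "L2_set h V \<le> 1" by (auto simp: P_def)
    obtain g' h' where g': "g' \<in> net" "L2_set (\<lambda>x. g x - g' x) V \<le> 1 / 4"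
      and h': "h' \<in> net" "L2_set (\<lambda>x. h x - h' x) V \<le> 1 / 4" using net gh by metis
    have "bform V M g h = bform V M (\<lambda>x. g' x + (g x - g' x)) h" by simp
    also have "\<dots> = bform V M g' (\<lambda>x. h' x + (h x - h' x)) + bform V M (\<lambda>x. g x - g' x) h"
      by (subst bform_add_left) simp
    also have "\<dots> = bform V M g' h' + bform V M g' (\<lambda>x. h x - h' x) + bform V M (\<lambda>x. g x - g' x) h"
      by (subst bform_add_right) simp
    also have "\<dots> \<le> K + A * 1 * (1/4) + A * (1/4) * 1"
    proof (intro add_mono)
      show "bform V M g' h' \<le> K" using g' h' by (intro K)
      have "A * L2_set g' V * L2_set (\<lambda>x. h x - h' x) V \<le> A * 1 * (1/4)"
        using g' h' net A0 by (intro mult_mono) auto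
      then show "bform V M g' (\<lambda>x. h x - h' x) \<le> A * 1 * (1/4)" using A' order.trans by blast
      have "A * L2_set (\<lambda>x. g x - g' x) V * L2_set h V \<le> A * (1/4) * 1"
        using g' gh A0 by (intro mult_mono) auto
      then show "bform V M (\<lambda>x. g x - g' x) h \<le> A * (1/4) * 1" using A' order.trans by blast
    qed
    finally show "bform V M g h \<le> K + (SUP (g, h)\<in>P. bform V M g h) / 2"
      unfolding A_def[symmetric] by simp
  qed
  then have "A \<le> 2 * K" by simp
  then have "A * L2_set g V * L2_set h V \<le> 2 * K * L2_set g V * L2_set h V"
    by (intro mult_right_mono) auto
  then show ?thesis using A'[of g h] by linarith
qed

text \<open>The maximum over pairs of net points is bounded by the sum of the powers
  \<open>2 * p\<close>, at the cost of a factor \<open>2304 ^ card V\<close> with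
  \<open>2304 = 48\<^sup>2\<close>; as \<open>card V \<le> p + 1 \<le> 2 * p\<close>, this is
  harmless after the root. The net argument doubles the constant to 4608. The random bound
  \<open>K\<close> is returned itself, so that a deterministic tilt can be added to it
  pointwise.\<close>

lemma bform_moment_bound:
  fixes Y :: "(nat \<times> nat \<Rightarrow> bool) \<Rightarrow> 'v \<Rightarrow> 'v \<Rightarrow> real"
  assumes V: "finite V" "V \<noteq> {}" "card V \<le> Suc p" and p: "p \<ge> 1"
    and J: "finite J" "\<And>\<omega> \<omega>'. (\<And>e. e \<in> J \<Longrightarrow> \<omega> e = \<omega>' e) \<Longrightarrow> Y \<omega> = Y \<omega>'"
    and \<rho>: "\<rho> \<ge> 0" "\<And>g h. L2_set g V \<le> 1 \<Longrightarrow> L2_set h V \<le> 1 \<Longrightarrow>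
      (\<integral>\<omega>. \<bar>bform V (Y \<omega>) g h\<bar> ^ (2 * p) \<partial>rademacher_space) \<le> \<rho> ^ (2 * p)"
  obtains K where "\<And>\<omega>. K \<omega> \<ge> 0" "\<And>\<omega> \<omega>'. (\<And>e. e \<in> J \<Longrightarrow> \<omega> e = \<omega>' e) \<Longrightarrow> K \<omega> = K \<omega>'"
    "\<And>\<omega> g h. bform V (Y \<omega>) g h \<le> K \<omega> * L2_set g V * L2_set h V"
    "(\<integral>\<omega>. K \<omega> ^ (2 * p) \<partial>rademacher_space) \<le> (4608 * \<rho>) ^ (2 * p)"
proof -
  obtain net where net: "finite net" "card net \<le> 48 ^ card V" "\<And>g. g \<in> net \<Longrightarrow> L2_set g V \<le> 1"
      "\<And>g. L2_set g V \<le> 1 \<Longrightarrow> \<exists>g'\<in>net. L2_set (\<lambda>x. g x - g' x) V \<le> 1 / 4"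
    by (rule finite_net[OF V(1,2)]) blast
  have net_ne: "net \<noteq> {}" using net(4)[of "\<lambda>_. 0"] by (auto simp: L2_set_def)
  define F where "F \<omega> gh = \<bar>bform V (Y \<omega>) (fst gh) (snd gh)\<bar>" for \<omega> gh
  define m where "m \<omega> = (MAX gh\<in>net \<times> net. F \<omega> gh)" for \<omega>
  have fin: "finite (F \<omega> ` (net \<times> net))" "F \<omega> ` (net \<times> net) \<noteq> {}" for \<omega>
    using net net_ne by auto
  have m_ge: "F \<omega> gh \<le> m \<omega>" if "gh \<in> net \<times> net" for \<omega> gh
    unfolding m_def using fin that by (intro Max_ge) auto
  have "\<exists>gh\<in>net \<times> net. m \<omega> = F \<omega> gh" for \<omega>
    using Max_in[OF fin, of \<omega>] unfolding m_def by auto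
  then have m_in: "m \<omega> ^ (2 * p) \<le> (\<Sum>gh\<in>net \<times> net. F \<omega> gh ^ (2 * p))" for \<omega>
  proof -
    obtain gh where gh: "gh \<in> net \<times> net" "m \<omega> = F \<omega> gh"
      using \<open>\<And>\<omega>. \<exists>gh\<in>net \<times> net. m \<omega> = F \<omega> gh\<close> by blast
    show ?thesis unfolding gh(2)
      by (rule member_le_sum[OF gh(1)]) (use net in \<open>auto simp: F_def\<close>)
  qed
  have m0: "m \<omega> \<ge> 0" for \<omega>
  proof -
    obtain g where "g \<in> net" using net_ne by auto
    then have "F \<omega> (g, g) \<le> m \<omega>" by (intro m_ge) auto
    moreover have "F \<omega> (g, g) \<ge> 0" by (simp add: F_def)
    ultimately show ?thesis by linarith
  qed
  have Fint: "integrable rademacher_space (\<lambda>\<omega>. F \<omega> gh ^ (2 * p))" for gh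
    by (rule integrable_finitely_many_signs[OF J(1)]) (metis F_def J(2))
  have mdep: "m \<omega> = m \<omega>'" if "\<And>e. e \<in> J \<Longrightarrow> \<omega> e = \<omega>' e" for \<omega> \<omega>'
    unfolding m_def F_def using J(2)[OF that] by simp
  show ?thesis
  proof (rule that[of "\<lambda>\<omega>. 2 * m \<omega>"])
    show "2 * m \<omega> \<ge> 0" for \<omega> using m0 by simp
    show "2 * m \<omega> = 2 * m \<omega>'" if "\<And>e. e \<in> J \<Longrightarrow> \<omega> e = \<omega>' e" for \<omega> \<omega>' using mdep[OF that] by simp
    show "bform V (Y \<omega>) g h \<le> 2 * m \<omega> * L2_set g V * L2_set h V" for \<omega> g h
    proof (rule bform_le_of_net[OF V(1) net(3,4)])
      fix g h assume "g \<in> net" "h \<in> net"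
      then show "bform V (Y \<omega>) g h \<le> m \<omega>" using m_ge[of "(g, h)" \<omega>] by (simp add: F_def)
    qed
    have card: "real (card (net \<times> net)) \<le> (2304 ^ p) ^ 2"
    proof -
      have "card (net \<times> net) \<le> 48 ^ card V * 48 ^ card V"
        unfolding card_cartesian_product using net by (intro mult_mono) auto
      also have "\<dots> = (2304 :: nat) ^ card V" by (simp flip: power_mult_distrib)
      also have "\<dots> \<le> 2304 ^ (2 * p)" using V p by (intro power_increasing) auto
      finally have "real (card (net \<times> net)) \<le> real (2304 ^ (2 * p))" by (simp only: of_nat_le_iff)
      then show ?thesis by (simp add: power_mult mult.commute)
    qed
    have "(\<integral>\<omega>. m \<omega> ^ (2 * p) \<partial>rademacher_space) \<le>
        (\<integral>\<omega>. (\<Sum>gh\<in>net \<times> net. F \<omega> gh ^ (2 * p)) \<partial>rademacher_space)"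
    proof (intro integral_mono m_in Bochner_Integration.integrable_sum Fint)
      show "integrable rademacher_space (\<lambda>\<omega>. m \<omega> ^ (2 * p))"
        by (rule integrable_finitely_many_signs[OF J(1)]) (metis mdep)
    qed
    also have "\<dots> = (\<Sum>gh\<in>net \<times> net. \<integral>\<omega>. F \<omega> gh ^ (2 * p) \<partial>rademacher_space)"
      by (rule Bochner_Integration.integral_sum) (rule Fint)
    also have "\<dots> \<le> (\<Sum>gh\<in>net \<times> net. \<rho> ^ (2 * p))"
      by (intro sum_mono) (use \<rho>(2) net(3) in \<open>auto simp: F_def\<close>)
    also have "\<dots> = real (card (net \<times> net)) * \<rho> ^ (2 * p)" by simp
    also have "\<dots> \<le> (2304 ^ p) ^ 2 * \<rho> ^ (2 * p)" using card \<rho>(1) by (intro mult_right_mono) auto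
    finally have I: "(\<integral>\<omega>. m \<omega> ^ (2 * p) \<partial>rademacher_space) \<le> (2304 ^ p) ^ 2 * \<rho> ^ (2 * p)" .
    have "(\<integral>\<omega>. (2 * m \<omega>) ^ (2 * p) \<partial>rademacher_space) = 2 ^ (2 * p) * (\<integral>\<omega>. m \<omega> ^ (2 * p) \<partial>rademacher_space)"
      by (simp add: power_mult_distrib)
    also have "\<dots> \<le> 2 ^ (2 * p) * ((2304 ^ p) ^ 2 * \<rho> ^ (2 * p))"
      using I by (intro mult_left_mono) auto
    also have "\<dots> = 2 ^ (2 * p) * (2304 ^ (2 * p) * \<rho> ^ (2 * p))"
      by (simp add: mult.commute[of 2 p] power_mult)
    also have "\<dots> = (4608 * \<rho>) ^ (2 * p)"
    proof -
      have "(4608 :: real) ^ n = 2 ^ n * 2304 ^ n" for n by (simp flip: power_mult_distrib)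
      then show ?thesis by (simp add: power_mult_distrib)
    qed
    finally show "(\<integral>\<omega>. (2 * m \<omega>) ^ (2 * p) \<partial>rademacher_space) \<le> (4608 * \<rho>) ^ (2 * p)" .
  qed
qed

section \<open>Counting even walks\<close>

text \<open>The quotient \<open>k ^ k / fact k\<close> is one term of the exponential series at
  \<open>k\<close>.\<close>

lemma self_power_le_exp_fact: "real k ^ k \<le> exp (real k) * fact k"
proof -
  have "(\<Sum>n\<in>{k}. real k ^ n /\<^sub>R fact n) \<le> (\<Sum>n. real k ^ n /\<^sub>R fact n)"
    by (rule sum_le_suminf[OF summable_exp_generic]) auto
  then show ?thesis by (simp add: exp_def field_simps)
qed

text \<open>The estimate \<open>(n choose k) \<le> (exp 1 * n / k) ^ k\<close>, multiplied out so
  that it also makes sense at \<open>k = 0\<close>.\<close>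

lemma binomial_self_power_le: "real (n choose k) * real k ^ k \<le> (exp 1 * real n) ^ k"
proof -
  have "real (n choose k) * real k ^ k \<le> real (n choose k) * (exp (real k) * fact k)"
    by (intro mult_left_mono self_power_le_exp_fact) simp
  also have "\<dots> = exp (real k) * real ((n choose k) * fact k)" by simp
  also have "\<dots> \<le> exp (real k) * real (n ^ k)"
    by (intro mult_left_mono of_nat_mono binomial_fact_pow) simp
  also have "\<dots> = (exp 1 * real n) ^ k"
    by (simp add: power_mult_distrib flip: exp_of_nat_mult)
  finally show ?thesis .
qed

lemma sum_Pow_card_eq:
  fixes f :: "nat \<Rightarrow> real"
  assumes "finite A"
  shows "(\<Sum>S\<in>Pow A. f (card S)) = (\<Sum>k\<le>card A. real (card A choose k) * f k)"
proof -
  have "(\<Sum>S\<in>Pow A. f (card S)) = (\<Sum>k\<le>card A. \<Sum>S\<in>{S \<in> Pow A. card S = k}. f (card S))"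
    by (rule sum.group[symmetric]) (use assms in \<open>auto simp: card_mono\<close>)
  also have "\<dots> = (\<Sum>k\<le>card A. real (card A choose k) * f k)"
    using n_subsets[OF assms] by (intro sum.cong refl) simp
  finally show ?thesis .
qed

lemma sum_half_power_le_2: "(\<Sum>k\<le>n. (1/2 :: real) ^ k) \<le> 2"
proof -
  have "(\<Sum>k\<le>n. (1/2 :: real) ^ k) = 2 - (1/2) ^ n" by (induction n) auto
  then show ?thesis by simp
qed

text \<open>The weight of a set of children: the total weight of the subsets of a neighbourhood of at
  most \<open>D\<close> vertices is bounded, while a tree with prescribed numbers of children gets weight
  comparable to the product of \<open>(k / D) ^ k\<close>.\<close>

definition child_weight :: "real \<Rightarrow> 'v set \<Rightarrow> real" where
  "child_weight D S = (real (card S) / (2 * exp 1 * D)) ^ card S"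

lemma child_weight_pos:
  assumes "D > 0" "finite S"
  shows "child_weight D S > 0"
  unfolding child_weight_def using assms by (cases "S = {}") (auto simp: card_gt_0_iff)

text \<open>The \<open>2 * exp 1\<close> inside the weight beats the binomial coefficient and leaves
  a geometric series. The empty set alone has weight one, from \<open>0 ^ 0 = 1\<close>.\<close>

lemma sum_child_weight:
  fixes A :: "'v set"
  assumes A: "finite A" "real (card A) \<le> D" and D: "D > 0"
  shows "(\<Sum>S\<in>Pow A. child_weight D S) \<ge> 1" "(\<Sum>S\<in>Pow A. child_weight D S) \<le> 2"
proof -
  have "(\<Sum>S\<in>{{} :: 'v set}. child_weight D S) \<le> (\<Sum>S\<in>Pow A. child_weight D S)"
  proof (rule sum_mono2)
    fix S assume "S \<in> Pow A - {{}}"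
    then have "finite S" using A finite_subset by auto
    then show "0 \<le> child_weight D S" using child_weight_pos[OF D, of S] by linarith
  qed (use A in auto)
  then show "(\<Sum>S\<in>Pow A. child_weight D S) \<ge> 1" by (simp add: child_weight_def)
  have "(\<Sum>S\<in>Pow A. child_weight D S) =
      (\<Sum>k\<le>card A. real (card A choose k) * (real k / (2 * exp 1 * D)) ^ k)"
    unfolding child_weight_def by (rule sum_Pow_card_eq[OF A(1)])
  also have "\<dots> \<le> (\<Sum>k\<le>card A. (1/2) ^ k)"
  proof (rule sum_mono)
    fix k
    have "real (card A choose k) * (real k / (2 * exp 1 * D)) ^ k =
        (real (card A choose k) * real k ^ k) / (2 * exp 1 * D) ^ k"
      by (simp add: power_divide)
    also have "\<dots> \<le> (exp 1 * real (card A)) ^ k / (2 * exp 1 * D) ^ k"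
      using D by (intro divide_right_mono binomial_self_power_le) simp
    also have "\<dots> \<le> (exp 1 * D) ^ k / (2 * exp 1 * D) ^ k"
      using A D by (intro divide_right_mono power_mono mult_left_mono) auto
    also have "\<dots> = (1/2) ^ k" using D by (simp flip: power_divide)
    finally show "real (card A choose k) * (real k / (2 * exp 1 * D)) ^ k \<le> (1/2) ^ k" .
  qed
  also have "\<dots> \<le> 2" by (rule sum_half_power_le_2)
  finally show "(\<Sum>S\<in>Pow A. child_weight D S) \<le> 2" .
qed

context sign_graph
begin

definition nbrs :: "'v \<Rightarrow> 'v set" where
  "nbrs x = {y. adj x y}"

lemma finite_nbrs: "finite (nbrs x)"
  by (rule finite_subset[OF _ finite_V]) (use adj_sym adj_V in \<open>auto simp: nbrs_def\<close>)

lemma dtree_children_nbrs: "along_edges r \<Longrightarrow> dtree r `` {x} \<subseteq> nbrs x"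
  using is_forest_dtree[of r] by (auto simp: is_forest_def nbrs_def)

text \<open>Let every vertex pick a random set of neighbours. A walk is compatible with the picks if
  they agree with its discovery tree at each visited vertex. All compatible walks share one tree,
  so counting walks weighted by inverse probabilities replaces a sum over all trees.\<close>

lemma card_even_walks_le:
  assumes D: "D > 0" "\<And>x. real (card (nbrs x)) \<le> D" and B: "B \<ge> 0"
    and bd: "\<And>r. r \<in> even_walks (2 * p) v \<Longrightarrow>
      (\<integral>\<omega>. mpow (set r) (tilted (\<lambda>e. sqrt D * tilt (dtree r) e) \<omega>) (2 * p) v v \<partial>rademacher_space) \<le> B"
  shows "real (card (even_walks (2 * p) v)) \<le> 2 * (8 * exp 1) ^ p * B"
proof -
  define W where "W = even_walks (2 * p) v"
  have finW: "finite W" unfolding W_def by (rule finite_even_walks)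
  \<comment> \<open>The law of the pick at \<open>x\<close>. Its normaliser lies between 1 and 2, so
    normalising costs at most a factor 2 per visited vertex.\<close>
  define q where "q x S = child_weight D S / (\<Sum>S\<in>Pow (nbrs x). child_weight D S)"
    for x and S :: "'v set"
  define w where "w r = (\<Prod>x\<in>set r. q x (dtree r `` {x}))" for r
  define P where "P = PiE V (\<lambda>x. Pow (nbrs x))"
  define compat where "compat r S \<longleftrightarrow> (\<forall>x\<in>set r. S x = dtree r `` {x})" for r and S :: "'v \<Rightarrow> 'v set"
  have finP: "finite P" unfolding P_def using finite_nbrs finite_V by (intro finite_PiE) auto
  have cw: "child_weight D S > 0" if "S \<subseteq> nbrs x" for S x
    using child_weight_pos[OF D(1)] finite_subset[OF that finite_nbrs] .
  have A: "1 \<le> (\<Sum>S\<in>Pow (nbrs x). child_weight D S)" "(\<Sum>S\<in>Pow (nbrs x). child_weight D S) \<le> 2" for x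
    using sum_child_weight[OF finite_nbrs D(2) D(1)] by auto
  have q_pos: "q x S > 0" if "S \<subseteq> nbrs x" for x S
    using cw[OF that] A(1)[of x] unfolding q_def by (intro divide_pos_pos) auto
  have q_sum: "(\<Sum>S\<in>Pow (nbrs x). q x S) = 1" for x
    using A(1)[of x] unfolding q_def sum_divide_distrib[symmetric] by auto
  have rW: "set r \<subseteq> V" "along_edges r" "r \<noteq> []" "last r = v" if "r \<in> W" for r
    using that by (auto simp: W_def even_walks_def walks_def)
  have w_pos: "w r > 0" if "r \<in> W" for r
    unfolding w_def by (intro prod_pos q_pos dtree_children_nbrs rW that)
  \<comment> \<open>Thus \<open>w r\<close> is the probability that independent picks are compatible
    with \<open>r\<close>: off the walk the picks are free and sum to one.\<close>
  have cyl: "(\<Sum>S\<in>P. if compat r S then (\<Prod>x\<in>V. q x (S x)) else 0) = w r" if r: "r \<in> W" for r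
  proof -
    let ?B = "\<lambda>x. if x \<in> set r then {dtree r `` {x}} else Pow (nbrs x)"
    have "{S \<in> P. compat r S} = PiE V ?B"
    proof (intro set_eqI iffI)
      fix S assume "S \<in> {S \<in> P. compat r S}"
      then show "S \<in> PiE V ?B" by (auto simp: P_def compat_def PiE_iff)
    next
      fix S assume S: "S \<in> PiE V ?B"
      have "S x \<in> Pow (nbrs x)" if "x \<in> V" for x
        using PiE_mem[OF S that] dtree_children_nbrs[OF rW(2)[OF r], of x] by (cases "x \<in> set r") auto
      moreover have "S x = dtree r `` {x}" if "x \<in> set r" for x
        using PiE_mem[OF S, of x] rW(1)[OF r] that by auto
      ultimately show "S \<in> {S \<in> P. compat r S}"
        using S by (auto simp: P_def compat_def PiE_iff)
    qed
    then have "(\<Sum>S\<in>P. if compat r S then (\<Prod>x\<in>V. q x (S x)) else 0) = (\<Sum>S\<in>PiE V ?B. \<Prod>x\<in>V. q x (S x))"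
      using finP by (simp add: sum.inter_filter[symmetric])
    also have "\<dots> = (\<Prod>x\<in>V. \<Sum>S\<in>?B x. q x S)"
      by (rule prod_sum_PiE[symmetric]) (use finite_V finite_nbrs in auto)
    also have "\<dots> = (\<Prod>x\<in>V. if x \<in> set r then q x (dtree r `` {x}) else 1)"
      by (intro prod.cong refl) (simp add: q_sum)
    also have "\<dots> = w r"
      unfolding w_def using rW[OF r] finite_V by (simp add: prod.inter_restrict[symmetric] Int_absorb1)
    finally show ?thesis .
  qed
  define C where "C = 2 * (8 * exp 1) ^ p * B"
  have C: "C \<ge> 0" using B by (simp add: C_def)
  \<comment> \<open>For fixed picks all compatible walks have the same weight. Their number times
    the gain \<open>L\<close> is at most \<open>B\<close>, and the inverse weight is at most an
    exponential in \<open>p\<close> times the same \<open>L\<close>, so \<open>L\<close>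
    disappears.\<close>
  have inner: "(\<Sum>r\<in>{r \<in> W. compat r S}. 1 / w r) \<le> C" for S
  proof (cases "{r \<in> W. compat r S} = {}")
    case True
    then show ?thesis unfolding True using C by simp
  next
    case False
    then obtain r0 where r0: "r0 \<in> W" "compat r0 S" by auto
    let ?WS = "{r \<in> W. compat r S}"
    let ?k = "\<lambda>x. card (dtree r0 `` {x})"
    have same: "set r = set r0 \<and> dtree r = dtree r0" if "r \<in> ?WS" for r
      using that r0 rW by (intro dtree_determined[of r r0 S]) (auto simp: compat_def)
    have fin_k: "finite (dtree r0 `` {x})" for x by (simp add: finite_dtree finite_Image)
    have sumk: "(\<Sum>x\<in>set r0. ?k x) = card (dtree r0)"
    proof -
      have "(\<Sum>x\<in>set r0. ?k x) = card (SIGMA x:set r0. dtree r0 `` {x})"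
        using fin_k by (simp add: card_SigmaI)
      also have "(SIGMA x:set r0. dtree r0 `` {x}) = dtree r0"
        using dtree_vertices by fastforce
      finally show ?thesis .
    qed
    have cardset: "card (set r0) \<le> Suc p"
      using r0 card_even_walk by (simp add: W_def)
    have cardtree: "card (dtree r0) \<le> p"
      using card_dtree[OF rW(3)[OF r0(1)]] cardset by simp
    define L where "L = (\<Prod>x\<in>set r0. (D / (2 * ?k x)) ^ ?k x)"
    have L: "real (card ?WS) * L \<le> B"
    proof -
      have "real (card ?WS) * L \<le>
        (\<integral>\<omega>. mpow (set r0) (tilted (\<lambda>e. sqrt D * tilt (dtree r0) e) \<omega>) (2 * p) v v \<partial>rademacher_space)"
        unfolding L_def
      proof (rule expectation_mpow_tilt_ge)
        show "r0 \<in> even_walks (2 * p) v" "?WS \<subseteq> even_walks (2 * p) v" "0 \<le> D"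
          using r0 D by (auto simp: W_def)
      qed (rule same)
      also have "\<dots> \<le> B" by (rule bd) (use r0 in \<open>simp add: W_def\<close>)
      finally show ?thesis .
    qed
    have L_nonneg: "L \<ge> 0" unfolding L_def using D by (intro prod_nonneg) auto
    have "1 / w r0 = (\<Prod>x\<in>set r0. 1 / q x (dtree r0 `` {x}))"
      unfolding w_def by (simp add: prod_dividef)
    also have "\<dots> \<le> (\<Prod>x\<in>set r0. 2 * (4 * exp 1) ^ ?k x * (D / (2 * ?k x)) ^ ?k x)"
    proof (intro prod_mono conjI)
      fix x assume "x \<in> set r0"
      have sub: "dtree r0 `` {x} \<subseteq> nbrs x" by (rule dtree_children_nbrs) (use rW r0 in auto)
      show "0 \<le> 1 / q x (dtree r0 `` {x})" using q_pos[OF sub] by simp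
      \<comment> \<open>Per tree edge the inverse weight is \<open>2 * exp 1 * D / k\<close> and the
        gain is \<open>D / (2 * k)\<close>. Their ratio \<open>4 * exp 1\<close> depends on neither
        \<open>D\<close> nor \<open>k\<close>.\<close>
      have inv: "1 / child_weight D (dtree r0 `` {x}) = (4 * exp 1) ^ ?k x * (D / (2 * ?k x)) ^ ?k x"
      proof -
        have "1 / (real (?k x) / (2 * exp 1 * D)) = 4 * exp 1 * (D / (2 * ?k x))"
          using D by (cases "?k x = 0") (auto simp: field_simps)
        then show ?thesis
          unfolding child_weight_def by (simp only: power_mult_distrib[symmetric] power_one_over[symmetric])
      qed
      have "1 / q x (dtree r0 `` {x}) =
          (\<Sum>S\<in>Pow (nbrs x). child_weight D S) * (1 / child_weight D (dtree r0 `` {x}))"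
        by (simp add: q_def)
      also have "\<dots> \<le> 2 * (1 / child_weight D (dtree r0 `` {x}))"
        using A(2)[of x] cw[OF sub] by (intro mult_right_mono) auto
      finally show "1 / q x (dtree r0 `` {x}) \<le> 2 * (4 * exp 1) ^ ?k x * (D / (2 * ?k x)) ^ ?k x"
        unfolding inv by (simp add: mult.assoc)
    qed
    also have "\<dots> = 2 ^ card (set r0) * (4 * exp 1) ^ card (dtree r0) * L"
      by (simp add: prod.distrib L_def sumk flip: power_sum)
    \<comment> \<open>At most \<open>p + 1\<close> vertices carry the normaliser 2, and at most
      \<open>p\<close> tree edges carry the ratio \<open>4 * exp 1\<close>.\<close>
    also have "\<dots> \<le> (2 ^ Suc p * (4 * exp 1) ^ p) * L"
    proof (intro mult_right_mono mult_mono power_increasing cardset cardtree)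
      show "(1::real) \<le> 4 * exp 1" using exp_ge_add_one_self[of 1] by linarith
    qed (use L_nonneg in auto)
    also have "\<dots> = 2 * (8 * exp 1) ^ p * L" by (simp add: power_mult_distrib flip: power_mult_distrib[of 2 4])
    finally have w0: "1 / w r0 \<le> 2 * (8 * exp 1) ^ p * L" .
    have "(\<Sum>r\<in>?WS. 1 / w r) = (\<Sum>r\<in>?WS. 1 / w r0)"
    proof (intro sum.cong refl)
      fix r assume "r \<in> ?WS"
      then have "set r = set r0" "dtree r = dtree r0" using same by blast+
      then show "1 / w r = 1 / w r0" by (simp only: w_def)
    qed
    also have "\<dots> = real (card ?WS) * (1 / w r0)" by simp
    also have "\<dots> \<le> real (card ?WS) * (2 * (8 * exp 1) ^ p * L)" by (intro mult_left_mono w0) simp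
    also have "\<dots> = 2 * (8 * exp 1) ^ p * (real (card ?WS) * L)" by simp
    also have "\<dots> \<le> C" unfolding C_def by (intro mult_left_mono L) simp
    finally show ?thesis .
  qed
  \<comment> \<open>Double counting: write 1 as the inverse weight times the probability of
    compatibility and exchange the sums, so that the walks are grouped by picks.\<close>
  have "real (card W) = (\<Sum>r\<in>W. (1 / w r) * (\<Sum>S\<in>P. if compat r S then (\<Prod>x\<in>V. q x (S x)) else 0))"
  proof -
    have "real (card W) = (\<Sum>r\<in>W. (1 / w r) * w r)"
    proof -
      have "(1 / w r) * w r = 1" if "r \<in> W" for r using w_pos[OF that] by simp
      then show ?thesis by simp
    qed
    then show ?thesis using cyl by simp
  qed
  also have "\<dots> = (\<Sum>r\<in>W. \<Sum>S\<in>P. if compat r S then (\<Prod>x\<in>V. q x (S x)) * (1 / w r) else 0)"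
    unfolding sum_distrib_left by (intro sum.cong refl) auto
  also have "\<dots> = (\<Sum>S\<in>P. \<Sum>r\<in>W. if compat r S then (\<Prod>x\<in>V. q x (S x)) * (1 / w r) else 0)"
    by (rule sum.swap)
  also have "\<dots> = (\<Sum>S\<in>P. (\<Prod>x\<in>V. q x (S x)) * (\<Sum>r\<in>{r \<in> W. compat r S}. 1 / w r))"
    unfolding sum_distrib_left by (rule sum.cong[OF refl]) (rule sum.inter_filter[OF finW, symmetric])
  also have "\<dots> \<le> (\<Sum>S\<in>P. (\<Prod>x\<in>V. q x (S x)) * C)"
  proof (intro sum_mono mult_left_mono inner prod_nonneg)
    fix S x assume "S \<in> P" "x \<in> V"
    then have "S x \<subseteq> nbrs x" by (auto simp: P_def PiE_iff)
    then show "0 \<le> q x (S x)" using q_pos[of "S x" x] by simp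
  qed
  also have "\<dots> = (\<Prod>x\<in>V. \<Sum>S\<in>Pow (nbrs x). q x S) * C"
    unfolding P_def sum_distrib_right[symmetric]
    by (subst prod_sum_PiE) (use finite_V finite_nbrs in auto)
  also have "\<dots> = C" by (simp add: q_sum)
  finally show ?thesis by (simp add: W_def C_def)
qed

end

section \<open>The moment bound\<close>

lemma power_add_le: "(a + b) ^ n \<le> 2 ^ n * (a ^ n + b ^ n)" if "a \<ge> 0" "b \<ge> 0" for a b :: real
proof -
  have "(a + b) ^ n \<le> (2 * max a b) ^ n" using that by (intro power_mono) auto
  also have "\<dots> = 2 ^ n * max a b ^ n" by (rule power_mult_distrib)
  also have "\<dots> \<le> 2 ^ n * (a ^ n + b ^ n)"
    using that by (intro mult_left_mono) (auto simp: max_def)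
  finally show ?thesis .
qed

lemma add_power_le: "a ^ n + b ^ n \<le> (a + b) ^ n" if "a \<ge> 0" "b \<ge> 0" "n \<ge> 1" for a b :: real
  using that(3)
proof (induction n rule: dec_induct)
  case (step n)
  have "a ^ Suc n + b ^ Suc n \<le> (a + b) * (a ^ n + b ^ n)"
    using that by (simp add: algebra_simps)
  also have "\<dots> \<le> (a + b) * (a + b) ^ n" using that step by (intro mult_left_mono) auto
  finally show ?case by simp
qed simp

lemma bform_restrict:
  assumes "finite V" "V0 \<subseteq> V"
  shows "bform V M (\<lambda>x. if x \<in> V0 then g x else 0) (\<lambda>x. if x \<in> V0 then h x else 0) = bform V0 M g h"
proof -
  have "bform V0 M g h = (\<Sum>x\<in>V0. \<Sum>y\<in>V. M x y * g x * (if y \<in> V0 then h y else 0))"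
    unfolding bform_def using assms by (intro sum.cong refl sum.mono_neutral_cong_left) auto
  also have "\<dots> = bform V M (\<lambda>x. if x \<in> V0 then g x else 0) (\<lambda>x. if x \<in> V0 then h x else 0)"
    unfolding bform_def using assms by (intro sum.mono_neutral_cong_left) auto
  finally show ?thesis by simp
qed

lemma L2_set_restrict:
  assumes "finite V" "V0 \<subseteq> V"
  shows "L2_set (\<lambda>x. if x \<in> V0 then g x else 0) V = L2_set g V0"
proof -
  have "(\<Sum>x\<in>V0. (g x)\<^sup>2) = (\<Sum>x\<in>V. (if x \<in> V0 then g x else 0)\<^sup>2)"
    by (rule sum.mono_neutral_cong_left) (use assms in auto)
  then show ?thesis by (simp add: L2_set_def)
qed

context sign_graph
begin

lemma tilted_cong:
  assumes "\<And>e. e \<in> (\<lambda>(x, y). ed x y) ` (V \<times> V) \<Longrightarrow> \<omega> e = \<omega>' e"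
  shows "tilted l \<omega> = tilted l \<omega>'"
proof (intro ext)
  fix x y
  show "tilted l \<omega> x y = tilted l \<omega>' x y"
  proof (cases "adj x y")
    case True
    then have "\<omega> (ed x y) = \<omega>' (ed x y)" using adj_sym adj_V by (intro assms) force
    then show ?thesis by (simp add: tilted_def)
  qed (simp add: tilted_def)
qed

lemma bform_tilted:
  "bform V0 (tilted l \<omega>) g h =
    bform V0 (tilted (\<lambda>_. 0) \<omega>) g h + bform V0 (\<lambda>x y. if adj x y then l (ed x y) else 0) g h"
  unfolding bform_def sum.distrib[symmetric]
  by (intro sum.cong refl) (auto simp: tilted_def algebra_simps)

text \<open>On the at most \<open>p + 1\<close> vertices of \<open>r\<close> the untilted part has
  the random norm bound \<open>K\<close> from the net, and the tilt adds the deterministic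
  \<open>2 * sqrt D\<close>. The moment hypothesis on \<open>V\<close> passes to
  \<open>set r\<close> by extending vectors by zero. The constant is
  \<open>9216 = 2 * 4608\<close>.\<close>

lemma expectation_mpow_even_walk_le:
  assumes p: "p \<ge> 1" and D: "D \<ge> 0" and r: "r \<in> even_walks (2 * p) v"
    and \<rho>: "\<rho> \<ge> 0" "\<And>g h. L2_set g V \<le> 1 \<Longrightarrow> L2_set h V \<le> 1 \<Longrightarrow>
      (\<integral>\<omega>. \<bar>bform V (tilted (\<lambda>_. 0) \<omega>) g h\<bar> ^ (2 * p) \<partial>rademacher_space) \<le> \<rho> ^ (2 * p)"
  shows "(\<integral>\<omega>. mpow (set r) (tilted (\<lambda>e. sqrt D * tilt (dtree r) e) \<omega>) (2 * p) v v \<partial>rademacher_space)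
    \<le> (9216 * (\<rho> + sqrt D)) ^ (2 * p)"
proof -
  interpret prob_space rademacher_space by (rule prob_space_rademacher_space)
  let ?J = "(\<lambda>(x, y). ed x y) ` (V \<times> V)"
  let ?l = "\<lambda>e. sqrt D * tilt (dtree r) e"
  have sub: "set r \<subseteq> V" and v: "v \<in> set r" and ae: "along_edges r" and ne: "set r \<noteq> {}"
    using r by (cases r; auto simp: even_walks_def walks_def)+
  have finJ: "finite ?J" using finite_V by simp
  have mom: "(\<integral>\<omega>. \<bar>bform (set r) (tilted (\<lambda>_. 0) \<omega>) g h\<bar> ^ (2 * p) \<partial>rademacher_space) \<le> \<rho> ^ (2 * p)"
    if gh: "L2_set g (set r) \<le> 1" "L2_set h (set r) \<le> 1" for g h
  proof -
    have "(\<integral>\<omega>. \<bar>bform V (tilted (\<lambda>_. 0) \<omega>) (\<lambda>x. if x \<in> set r then g x else 0)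
        (\<lambda>x. if x \<in> set r then h x else 0)\<bar> ^ (2 * p) \<partial>rademacher_space) \<le> \<rho> ^ (2 * p)"
      by (rule \<rho>(2)) (use gh in \<open>simp_all add: L2_set_restrict[OF finite_V sub]\<close>)
    then show ?thesis by (simp only: bform_restrict[OF finite_V sub])
  qed
  obtain K where K: "\<And>\<omega>. K \<omega> \<ge> 0" "\<And>\<omega> \<omega>'. (\<And>e. e \<in> ?J \<Longrightarrow> \<omega> e = \<omega>' e) \<Longrightarrow> K \<omega> = K \<omega>'"
    "\<And>\<omega> g h. bform (set r) (tilted (\<lambda>_. 0) \<omega>) g h \<le> K \<omega> * L2_set g (set r) * L2_set h (set r)"
    "(\<integral>\<omega>. K \<omega> ^ (2 * p) \<partial>rademacher_space) \<le> (4608 * \<rho>) ^ (2 * p)"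
    by (rule bform_moment_bound[OF finite_set ne card_even_walk[OF r] p finJ tilted_cong \<rho>(1) mom]) blast+
  have Kint: "integrable rademacher_space (\<lambda>\<omega>. f (K \<omega>) :: real)" for f
    by (rule integrable_signs[OF finJ K(2)])
  have le: "mpow (set r) (tilted ?l \<omega>) (2 * p) v v \<le> 2 ^ (2 * p) * (K \<omega> ^ (2 * p) + (2 * sqrt D) ^ (2 * p))" for \<omega>
  proof -
    have "bform (set r) (tilted ?l \<omega>) g h \<le> (K \<omega> + 2 * sqrt D) * L2_set g (set r) * L2_set h (set r)" for g h
    proof -
      have "bform (set r) (\<lambda>x y. if adj x y then ?l (ed x y) else 0) g h =
          sqrt D * bform (set r) (\<lambda>x y. if adj x y then tilt (dtree r) (ed x y) else 0) g h"
        unfolding bform_def sum_distrib_left by (intro sum.cong refl) auto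
      also have "\<dots> \<le> sqrt D * (2 * L2_set g (set r) * L2_set h (set r))"
        using D dtree_vertices[of _ _ r]
        by (intro mult_left_mono bform_tilt_le is_forest_dtree ae) auto
      finally show ?thesis using K(3)[of \<omega> g h] unfolding bform_tilted[of "set r" ?l]
        by (simp add: algebra_simps)
    qed
    then have "mpow (set r) (tilted ?l \<omega>) (2 * p) v v \<le> (K \<omega> + 2 * sqrt D) ^ (2 * p)"
      using K(1)[of \<omega>] D by (intro mpow_diag_le[OF finite_set v]) auto
    also have "\<dots> \<le> 2 ^ (2 * p) * (K \<omega> ^ (2 * p) + (2 * sqrt D) ^ (2 * p))"
      by (rule power_add_le) (use K(1) D in auto)
    finally show ?thesis .
  qed
  have "(\<integral>\<omega>. mpow (set r) (tilted ?l \<omega>) (2 * p) v v \<partial>rademacher_space) \<le>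
      (\<integral>\<omega>. 2 ^ (2 * p) * (K \<omega> ^ (2 * p) + (2 * sqrt D) ^ (2 * p)) \<partial>rademacher_space)"
    by (intro integral_mono le integrable_mpow Kint finite_set v)
  also have "\<dots> = 2 ^ (2 * p) * ((\<integral>\<omega>. K \<omega> ^ (2 * p) \<partial>rademacher_space) + (2 * sqrt D) ^ (2 * p))"
    using Kint[of "\<lambda>x. x ^ (2 * p)"] by (simp add: prob_space[unfolded space_rademacher_space])
  also have "\<dots> \<le> 2 ^ (2 * p) * ((4608 * \<rho>) ^ (2 * p) + (2 * sqrt D) ^ (2 * p))"
    by (intro mult_left_mono add_mono K(4)) auto
  also have "\<dots> \<le> 2 ^ (2 * p) * (4608 * \<rho> + 2 * sqrt D) ^ (2 * p)"
    by (intro mult_left_mono add_power_le) (use \<rho>(1) D p in auto)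
  also have "\<dots> = (9216 * \<rho> + 4 * sqrt D) ^ (2 * p)"
    by (simp only: power_mult_distrib[symmetric]) (simp add: algebra_simps)
  also have "\<dots> \<le> (9216 * (\<rho> + sqrt D)) ^ (2 * p)"
    by (intro power_mono) (use \<rho>(1) D in \<open>auto simp: algebra_simps\<close>)
  finally show ?thesis .
qed

lemma expectation_trace_le:
  assumes p: "p \<ge> 1" and D: "D > 0" "\<And>x. real (card (nbrs x)) \<le> D"
    and \<rho>: "\<rho> \<ge> 0" "\<And>g h. L2_set g V \<le> 1 \<Longrightarrow> L2_set h V \<le> 1 \<Longrightarrow>
      (\<integral>\<omega>. \<bar>bform V (tilted (\<lambda>_. 0) \<omega>) g h\<bar> ^ (2 * p) \<partial>rademacher_space) \<le> \<rho> ^ (2 * p)"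
  shows "(\<integral>\<omega>. (\<Sum>v\<in>V. mpow V (tilted (\<lambda>_. 0) \<omega>) (2 * p) v v) \<partial>rademacher_space)
    \<le> card V * (2 * (8 * exp 1) ^ p * (9216 * (\<rho> + sqrt D)) ^ (2 * p))"
proof -
  have "(\<integral>\<omega>. (\<Sum>v\<in>V. mpow V (tilted (\<lambda>_. 0) \<omega>) (2 * p) v v) \<partial>rademacher_space)
      = (\<Sum>v\<in>V. \<integral>\<omega>. mpow V (tilted (\<lambda>_. 0) \<omega>) (2 * p) v v \<partial>rademacher_space)"
    by (rule Bochner_Integration.integral_sum) (rule integrable_mpow[OF finite_V])
  also have "\<dots> = (\<Sum>v\<in>V. real (card (even_walks (2 * p) v)))"
    by (intro sum.cong refl expectation_mpow_zero)
  also have "\<dots> \<le> (\<Sum>v\<in>V. 2 * (8 * exp 1) ^ p * (9216 * (\<rho> + sqrt D)) ^ (2 * p))"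
  proof (rule sum_mono)
    fix v
    show "real (card (even_walks (2 * p) v)) \<le> 2 * (8 * exp 1) ^ p * (9216 * (\<rho> + sqrt D)) ^ (2 * p)"
    proof (rule card_even_walks_le[OF D])
      show "0 \<le> (9216 * (\<rho> + sqrt D)) ^ (2 * p)" using \<rho>(1) D by simp
      show "(\<integral>\<omega>. mpow (set r) (tilted (\<lambda>e. sqrt D * tilt (dtree r) e) \<omega>) (2 * p) v v \<partial>rademacher_space)
          \<le> (9216 * (\<rho> + sqrt D)) ^ (2 * p)" if "r \<in> even_walks (2 * p) v" for r
        by (rule expectation_mpow_even_walk_le[OF p _ that \<rho>]) (use D in auto)
    qed
  qed
  finally show ?thesis by simp
qed

end

section \<open>Operator norms, through the bipartite graph of rows and columns\<close>

lemma bform_le_op_norm: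
  assumes "finite J" "L2_set s J \<le> 1" "L2_set t J \<le> 1"
  shows "bform J M s t \<le> op_norm J M"
proof -
  have "bdd_above ((\<lambda>(s, t). bform J M s t) ` ball_pairs J)"
    by (rule bdd_aboveI2) (use bform_unit_le[OF assms(1)] in \<open>auto simp: ball_pairs_def\<close>)
  then show ?thesis
    using cSUP_upper[of "(s, t)" "ball_pairs J" "\<lambda>(s, t). bform J M s t"] assms
    by (simp add: op_norm_def ball_pairs_def bform_def)
qed

lemma ball_pairs_nonempty: "ball_pairs J \<noteq> {}"
  unfolding ball_pairs_def by (auto intro!: exI[of _ "\<lambda>_. 0"] simp: L2_set_def)

lemma op_norm_le:
  assumes "\<And>s t. L2_set s J \<le> 1 \<Longrightarrow> L2_set t J \<le> 1 \<Longrightarrow> bform J M s t \<le> K"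
  shows "op_norm J M \<le> K"
  unfolding op_norm_def
  by (rule cSUP_least[OF ball_pairs_nonempty]) (use assms in \<open>auto simp: ball_pairs_def bform_def\<close>)

lemma op_norm_nonneg: "finite J \<Longrightarrow> op_norm J M \<ge> 0"
  using bform_le_op_norm[of J "\<lambda>_. 0" "\<lambda>_. 0" M] by (simp add: bform_def L2_set_def)

lemma bform_le_op_norm_mult: "finite J \<Longrightarrow> bform J M s t \<le> op_norm J M * L2_set s J * L2_set t J"
  by (rule bform_le_of_unit) (auto intro: bform_le_op_norm)

lemma integrable_bform:
  assumes "finite J"
  shows "integrable rademacher_space (\<lambda>\<omega>. f (bform J (\<lambda>i j. a i j * eps i j \<omega>) s t) :: real)"
proof (rule integrable_signs[where J = "J \<times> J" and h = f])
  fix \<omega> \<omega>' :: "nat \<times> nat \<Rightarrow> bool"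
  assume "\<And>e. e \<in> J \<times> J \<Longrightarrow> \<omega> e = \<omega>' e"
  then show "bform J (\<lambda>i j. a i j * eps i j \<omega>) s t = bform J (\<lambda>i j. a i j * eps i j \<omega>') s t"
    unfolding bform_def by (intro sum.cong refl) (simp add: eps_def)
qed (use assms in simp)

lemma op_norm_cong:
  assumes "\<And>i j. i \<in> J \<Longrightarrow> j \<in> J \<Longrightarrow> M i j = M' i j"
  shows "op_norm J M = op_norm J M'"
  unfolding op_norm_def using assms by (intro SUP_cong refl) (auto intro!: sum.cong)

lemma integrable_op_norm:
  assumes "finite J"
  shows "integrable rademacher_space (\<lambda>\<omega>. f (op_norm J (\<lambda>i j. a i j * eps i j \<omega>)) :: real)"
  by (rule integrable_signs[where J = "J \<times> J" and h = f]) (use assms in \<open>auto intro!: op_norm_cong simp: eps_def\<close>)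

text \<open>Rows are \<open>Inl\<close>, columns are \<open>Inr\<close>: the symmetric matrix on the
  disjoint union has the given matrix and its transpose as off-diagonal blocks. The last clause
  concerns only pairs that are never adjacent.\<close>

fun bip_edge :: "nat + nat \<Rightarrow> nat + nat \<Rightarrow> nat \<times> nat" where
  "bip_edge (Inl i) (Inr j) = (i, j)"
| "bip_edge (Inr j) (Inl i) = (i, j)"
| "bip_edge _ _ = (0, 0)"

fun bip_adj :: "nat set \<Rightarrow> (nat \<Rightarrow> nat \<Rightarrow> real) \<Rightarrow> nat + nat \<Rightarrow> nat + nat \<Rightarrow> bool" where
  "bip_adj J b (Inl i) (Inr j) \<longleftrightarrow> i \<in> J \<and> j \<in> J \<and> b i j = 1"
| "bip_adj J b (Inr j) (Inl i) \<longleftrightarrow> i \<in> J \<and> j \<in> J \<and> b i j = 1"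
| "bip_adj J b _ _ \<longleftrightarrow> False"

lemma sign_graph_bip:
  assumes "finite J"
  shows "sign_graph (J <+> J) (bip_adj J b) bip_edge"
proof
  show "finite (J <+> J)" using assms by simp
  show "bip_adj J b x y \<Longrightarrow> bip_adj J b y x" for x y by (cases x; cases y) auto
  show "bip_adj J b x y \<Longrightarrow> x \<in> J <+> J" for x y by (cases x; cases y) auto
  show "bip_edge x y = bip_edge y x" for x y by (cases x; cases y) auto
  show "bip_adj J b x y \<Longrightarrow> bip_adj J b x' y' \<Longrightarrow> bip_edge x y = bip_edge x' y' \<Longrightarrow>
    x' = x \<and> y' = y \<or> x' = y \<and> y' = x" for x y x' y'
    by (cases x; cases y; cases x'; cases y') auto
qed

text \<open>A form of the symmetrised matrix is a sum of two forms of the original one, each with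
  arguments in the unit balls, so its moments are controlled with \<open>4 * \<rho>\<close>.
  Conversely a vector supported on the rows against one supported on the columns recovers the
  original form. Doubling the vertex set turns the factor 2 into 4, and
  \<open>36864 = 4 * 9216\<close>.\<close>

theorem op_norm_moment_le:
  assumes J: "finite J" and b: "\<And>i j. i \<in> J \<Longrightarrow> j \<in> J \<Longrightarrow> b i j \<in> {0, 1}"
    and D: "D > 0" "\<And>i. i \<in> J \<Longrightarrow> real (card {j \<in> J. b i j = 1}) \<le> D"
      "\<And>j. j \<in> J \<Longrightarrow> real (card {i \<in> J. b i j = 1}) \<le> D"
    and p: "p \<ge> 1"
    and \<rho>: "\<rho> \<ge> 0" "\<And>s t. L2_set s J \<le> 1 \<Longrightarrow> L2_set t J \<le> 1 \<Longrightarrow>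
      (\<integral>\<omega>. \<bar>bform J (\<lambda>i j. b i j * eps i j \<omega>) s t\<bar> ^ (2 * p) \<partial>rademacher_space) \<le> \<rho> ^ (2 * p)"
  shows "(\<integral>\<omega>. op_norm J (\<lambda>i j. b i j * eps i j \<omega>) ^ (2 * p) \<partial>rademacher_space) \<le>
    card J * (4 * (8 * exp 1) ^ p * (36864 * (\<rho> + sqrt D)) ^ (2 * p))"
proof -
  define V where "V = J <+> J"
  interpret sign_graph V "bip_adj J b" bip_edge unfolding V_def by (rule sign_graph_bip[OF J])
  let ?X = "\<lambda>\<omega> i j. b i j * eps i j \<omega>"
  let ?Y = "\<lambda>\<omega>. tilted (\<lambda>_. 0) \<omega>"
  have Y: "?Y \<omega> (Inl i) (Inr j) = ?X \<omega> i j" "?Y \<omega> (Inr j) (Inl i) = ?X \<omega> i j"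
      "?Y \<omega> (Inl i) (Inl j) = 0" "?Y \<omega> (Inr i) (Inr j) = 0" if "i \<in> J" "j \<in> J" for \<omega> i j
    using b[OF that] that by (auto simp: tilted_def eps_def)
  have form: "bform V (?Y \<omega>) g h =
      bform J (?X \<omega>) (g \<circ> Inl) (h \<circ> Inr) + bform J (?X \<omega>) (h \<circ> Inl) (g \<circ> Inr)" for \<omega> g h
  proof -
    have "bform V (?Y \<omega>) g h = (\<Sum>i\<in>J. \<Sum>j\<in>J. ?X \<omega> i j * g (Inl i) * h (Inr j)) +
        (\<Sum>j\<in>J. \<Sum>i\<in>J. ?X \<omega> i j * g (Inr j) * h (Inl i))"
      unfolding bform_def V_def sum.Plus[OF J J] comp_def using Y by simp
    also have "(\<Sum>j\<in>J. \<Sum>i\<in>J. ?X \<omega> i j * g (Inr j) * h (Inl i)) =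
        (\<Sum>i\<in>J. \<Sum>j\<in>J. ?X \<omega> i j * h (Inl i) * g (Inr j))"
      by (subst sum.swap) (simp add: ac_simps)
    finally show ?thesis by (simp add: bform_def)
  qed
  have L2_split: "(L2_set g V)\<^sup>2 = (L2_set (g \<circ> Inl) J)\<^sup>2 + (L2_set (g \<circ> Inr) J)\<^sup>2" for g
    unfolding L2_set_power2 V_def sum.Plus[OF J J] by simp
  have L2_part: "L2_set (g \<circ> Inl) J \<le> 1" "L2_set (g \<circ> Inr) J \<le> 1" if "L2_set g V \<le> 1" for g
  proof -
    have "(L2_set g V)\<^sup>2 \<le> 1" using that by (simp add: power_le_one)
    then have "(L2_set (g \<circ> Inl) J)\<^sup>2 \<le> 1\<^sup>2" "(L2_set (g \<circ> Inr) J)\<^sup>2 \<le> 1\<^sup>2"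
      unfolding L2_split by (smt (verit) zero_le_power2 one_power2)+
    then show "L2_set (g \<circ> Inl) J \<le> 1" "L2_set (g \<circ> Inr) J \<le> 1"
      by (simp_all only: abs_le_square_iff[symmetric] abs_of_nonneg[OF L2_set_nonneg] abs_one)
  qed
  have nbrs: "real (card (nbrs x)) \<le> D" for x
  proof (cases x)
    case (Inl i)
    have "nbrs x = (if i \<in> J then Inr ` {j \<in> J. b i j = 1} else {})"
      unfolding nbrs_def Inl by (auto elim!: bip_adj.elims)
    then show ?thesis using D by (simp add: card_image less_imp_le)
  next
    case (Inr j)
    have "nbrs x = (if j \<in> J then Inl ` {i \<in> J. b i j = 1} else {})"
      unfolding nbrs_def Inr by (auto elim!: bip_adj.elims)
    then show ?thesis using D by (simp add: card_image less_imp_le)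
  qed
  have moment: "(\<integral>\<omega>. \<bar>bform V (?Y \<omega>) g h\<bar> ^ (2 * p) \<partial>rademacher_space) \<le> (4 * \<rho>) ^ (2 * p)"
    if gh: "L2_set g V \<le> 1" "L2_set h V \<le> 1" for g h
  proof -
    let ?A = "\<lambda>\<omega>. \<bar>bform J (?X \<omega>) (g \<circ> Inl) (h \<circ> Inr)\<bar>" and ?B = "\<lambda>\<omega>. \<bar>bform J (?X \<omega>) (h \<circ> Inl) (g \<circ> Inr)\<bar>"
    have "(\<integral>\<omega>. \<bar>bform V (?Y \<omega>) g h\<bar> ^ (2 * p) \<partial>rademacher_space) \<le>
        (\<integral>\<omega>. 2 ^ (2 * p) * (?A \<omega> ^ (2 * p) + ?B \<omega> ^ (2 * p)) \<partial>rademacher_space)"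
    proof (rule integral_mono)
      show "integrable rademacher_space (\<lambda>\<omega>. \<bar>bform V (?Y \<omega>) g h\<bar> ^ (2 * p))"
        by (rule integrable_signs[where J = "(\<lambda>(x, y). bip_edge x y) ` (V \<times> V)" and g = ?Y
              and h = "\<lambda>M. \<bar>bform V M g h\<bar> ^ (2 * p)"])
          (simp add: finite_V, rule tilted_cong, blast)
      show "integrable rademacher_space (\<lambda>\<omega>. 2 ^ (2 * p) * (?A \<omega> ^ (2 * p) + ?B \<omega> ^ (2 * p)))"
        by (intro integrable_mult_right Bochner_Integration.integrable_add integrable_bform[OF J])
      fix \<omega>
      have "\<bar>bform V (?Y \<omega>) g h\<bar> ^ (2 * p) \<le> (?A \<omega> + ?B \<omega>) ^ (2 * p)"
        unfolding form by (intro power_mono) auto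
      also have "\<dots> \<le> 2 ^ (2 * p) * (?A \<omega> ^ (2 * p) + ?B \<omega> ^ (2 * p))" by (rule power_add_le) auto
      finally show "\<bar>bform V (?Y \<omega>) g h\<bar> ^ (2 * p) \<le> \<dots>" .
    qed
    also have "\<dots> = 2 ^ (2 * p) * ((\<integral>\<omega>. ?A \<omega> ^ (2 * p) \<partial>rademacher_space) + (\<integral>\<omega>. ?B \<omega> ^ (2 * p) \<partial>rademacher_space))"
      unfolding integral_mult_right_zero
      by (subst Bochner_Integration.integral_add) (rule integrable_bform[OF J] refl)+
    also have "\<dots> \<le> 2 ^ (2 * p) * (\<rho> ^ (2 * p) + \<rho> ^ (2 * p))"
      by (intro mult_left_mono add_mono \<rho>(2) L2_part gh) auto
    also have "\<dots> \<le> 2 ^ (2 * p) * (\<rho> + \<rho>) ^ (2 * p)"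
      by (intro mult_left_mono add_power_le) (use \<rho>(1) p in auto)
    also have "\<dots> = (4 * \<rho>) ^ (2 * p)" by (simp only: power_mult_distrib[symmetric]) simp
    finally show ?thesis .
  qed
  have sym: "?Y \<omega> x y = ?Y \<omega> y x" for \<omega> x y
    by (cases x; cases y) (auto simp: tilted_def)
  let ?tr = "\<lambda>\<omega>. \<Sum>v\<in>V. mpow V (?Y \<omega>) (2 * p) v v"
  have "op_norm J (?X \<omega>) ^ (2 * p) \<le> ?tr \<omega>" for \<omega>
  proof -
    have le: "\<bar>bform V (?Y \<omega>) g h\<bar> ^ (2 * p) \<le> ?tr \<omega>" if "L2_set g V \<le> 1" "L2_set h V \<le> 1" for g h
      by (rule bform_power_le_trace[OF finite_V sym p that])
    have "0 \<le> \<bar>bform V (?Y \<omega>) (\<lambda>_. 0) (\<lambda>_. 0)\<bar> ^ (2 * p)" by simp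
    also have "\<dots> \<le> ?tr \<omega>" by (rule le) (auto simp: L2_set_def)
    finally have tr0: "?tr \<omega> \<ge> 0" .
    have p2: "0 < 2 * p" using p by simp
    have "op_norm J (?X \<omega>) \<le> root (2 * p) (?tr \<omega>)"
    proof (rule op_norm_le)
      fix s t assume st: "L2_set s J \<le> 1" "L2_set t J \<le> 1"
      let ?g = "case_sum s (\<lambda>_. 0)" and ?h = "case_sum (\<lambda>_. 0) t"
      have sq: "L2_set f V \<le> 1" if "(L2_set f V)\<^sup>2 \<le> 1" for f
        using that by (simp add: power_le_one_iff abs_square_le_1)
      have "L2_set ?g V \<le> 1" "L2_set ?h V \<le> 1"
        by (rule sq, use st in \<open>simp add: L2_split comp_def power_le_one L2_set_0'\<close>)+
      then have "\<bar>bform V (?Y \<omega>) ?g ?h\<bar> ^ (2 * p) \<le> ?tr \<omega>" by (rule le)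
      moreover have "bform V (?Y \<omega>) ?g ?h = bform J (?X \<omega>) s t"
        unfolding form by (simp add: comp_def bform_def)
      ultimately have "\<bar>bform J (?X \<omega>) s t\<bar> ^ (2 * p) \<le> ?tr \<omega>" by simp
      then have "root (2 * p) (\<bar>bform J (?X \<omega>) s t\<bar> ^ (2 * p)) \<le> root (2 * p) (?tr \<omega>)"
        using p2 by (intro real_root_le_mono)
      then show "bform J (?X \<omega>) s t \<le> root (2 * p) (?tr \<omega>)"
        unfolding real_root_power_cancel[OF p2 abs_ge_zero] by linarith
    qed
    then have "op_norm J (?X \<omega>) ^ (2 * p) \<le> root (2 * p) (?tr \<omega>) ^ (2 * p)"
      by (intro power_mono op_norm_nonneg J)
    also have "\<dots> = ?tr \<omega>" by (rule real_root_pow_pos2[OF p2 tr0])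
    finally show ?thesis .
  qed
  then have "(\<integral>\<omega>. op_norm J (?X \<omega>) ^ (2 * p) \<partial>rademacher_space) \<le> (\<integral>\<omega>. ?tr \<omega> \<partial>rademacher_space)"
    by (intro integral_mono integrable_op_norm[OF J] Bochner_Integration.integrable_sum integrable_mpow finite_V)
  also have "\<dots> \<le> card V * (2 * (8 * exp 1) ^ p * (9216 * (4 * \<rho> + sqrt D)) ^ (2 * p))"
    by (rule expectation_trace_le[OF p D(1) nbrs _ moment]) (use \<rho>(1) in auto)
  also have "\<dots> \<le> card V * (2 * (8 * exp 1) ^ p * (36864 * (\<rho> + sqrt D)) ^ (2 * p))"
    by (intro mult_left_mono power_mono) (use \<rho>(1) D(1) in auto)
  also have "\<dots> = card J * (4 * (8 * exp 1) ^ p * (36864 * (\<rho> + sqrt D)) ^ (2 * p))"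
    using J by (simp add: V_def card_Plus)
  finally show ?thesis .
qed

section \<open>The bound by moments of bilinear forms\<close>

lemma bform_eps_eq_sum:
  "bform J (\<lambda>i j. a i j * eps i j \<omega>) s t =
    (\<Sum>e\<in>J \<times> J. (a (fst e) (snd e) * s (fst e) * t (snd e)) * sgb (\<omega> e))"
  unfolding bform_def sum.cartesian_product
  by (intro sum.cong refl) (auto simp: eps_def)

lemma bform_khintchine:
  assumes J: "finite J" and p: "p \<ge> 1" and a: "\<And>i j. i \<in> J \<Longrightarrow> j \<in> J \<Longrightarrow> \<bar>a i j\<bar> \<le> 1"
    and st: "L2_set s J \<le> 1" "L2_set t J \<le> 1"
  shows "(\<integral>\<omega>. \<bar>bform J (\<lambda>i j. a i j * eps i j \<omega>) s t\<bar> powr p \<partial>rademacher_space) \<le> (2 * sqrt p) powr p"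
proof -
  have "(\<Sum>e\<in>J \<times> J. (a (fst e) (snd e) * s (fst e) * t (snd e))\<^sup>2) \<le> (\<Sum>e\<in>J \<times> J. (s (fst e))\<^sup>2 * (t (snd e))\<^sup>2)"
  proof (rule sum_mono)
    fix e assume "e \<in> J \<times> J"
    then have "(a (fst e) (snd e))\<^sup>2 \<le> 1" using a by (auto simp: abs_square_le_1)
    then have "(a (fst e) (snd e))\<^sup>2 * ((s (fst e))\<^sup>2 * (t (snd e))\<^sup>2) \<le> 1 * ((s (fst e))\<^sup>2 * (t (snd e))\<^sup>2)"
      by (intro mult_right_mono) auto
    then show "(a (fst e) (snd e) * s (fst e) * t (snd e))\<^sup>2 \<le> (s (fst e))\<^sup>2 * (t (snd e))\<^sup>2"
      by (simp add: power_mult_distrib mult.assoc)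
  qed
  also have "\<dots> = (\<Sum>i\<in>J. (s i)\<^sup>2) * (\<Sum>j\<in>J. (t j)\<^sup>2)"
    unfolding sum_product sum.cartesian_product by (simp add: case_prod_beta')
  also have "\<dots> \<le> 1 * 1"
    using st by (intro mult_mono) (auto simp: L2_set_def sum_nonneg)
  finally show ?thesis
    unfolding bform_eps_eq_sum using khintchine[of "J \<times> J" p 1] J p by simp
qed

lemma Lp_norm_nonneg: "Lp_norm p S \<ge> 0"
  by (simp add: Lp_norm_def)

lemma Lp_norm_le:
  assumes "p > 0" "K \<ge> 0" "(\<integral>\<omega>. \<bar>S \<omega>\<bar> powr p \<partial>rademacher_space) \<le> K powr p"
  shows "Lp_norm p S \<le> K"
proof -
  have "Lp_norm p S \<le> (K powr p) powr (1 / p)"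
    unfolding Lp_norm_def using assms by (intro powr_mono2 integral_nonneg_AE) auto
  then show ?thesis using assms by (simp add: powr_powr)
qed

lemma integral_le_Lp_norm_powr:
  assumes "p > 0" "Lp_norm p S \<le> K"
  shows "(\<integral>\<omega>. \<bar>S \<omega>\<bar> powr p \<partial>rademacher_space) \<le> K powr p"
proof -
  let ?I = "\<integral>\<omega>. \<bar>S \<omega>\<bar> powr p \<partial>rademacher_space"
  have I: "?I \<ge> 0" by (intro integral_nonneg_AE) auto
  have "?I = Lp_norm p S powr p" unfolding Lp_norm_def using I assms(1) by (simp add: powr_powr)
  also have "\<dots> \<le> K powr p" using assms by (intro powr_mono2 Lp_norm_nonneg) auto
  finally show ?thesis .
qed

lemma Lp_norm_mono:
  assumes "1 \<le> p" "p \<le> q" and int: "\<And>h. integrable rademacher_space (\<lambda>\<omega>. h (S \<omega>) :: real)"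
  shows "Lp_norm p S \<le> Lp_norm q S"
proof -
  have "(\<integral>\<omega>. \<bar>S \<omega>\<bar> powr p \<partial>rademacher_space) powr (q / p) \<le>
      (\<integral>\<omega>. (\<bar>S \<omega>\<bar> powr p) powr (q / p) \<partial>rademacher_space)"
    by (rule powr_expectation_le[OF prob_space_rademacher_space])
      (use assms in \<open>auto intro: int[of "\<lambda>x. \<bar>x\<bar> powr p"] int[of "\<lambda>x. (\<bar>x\<bar> powr p) powr (q / p)"]\<close>)
  also have "\<dots> = (\<integral>\<omega>. \<bar>S \<omega>\<bar> powr q \<partial>rademacher_space)"
    using assms(1) by (simp add: powr_powr)
  finally have "((\<integral>\<omega>. \<bar>S \<omega>\<bar> powr p \<partial>rademacher_space) powr (q / p)) powr (1 / q) \<le>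
      (\<integral>\<omega>. \<bar>S \<omega>\<bar> powr q \<partial>rademacher_space) powr (1 / q)"
    using assms by (intro powr_mono2) auto
  then show ?thesis unfolding Lp_norm_def using assms by (simp add: powr_powr)
qed

lemma Lp_norm_bform_le:
  assumes "finite J" "p \<ge> 1" "\<And>i j. i \<in> J \<Longrightarrow> j \<in> J \<Longrightarrow> \<bar>a i j\<bar> \<le> 1" "L2_set s J \<le> 1" "L2_set t J \<le> 1"
  shows "Lp_norm p (\<lambda>\<omega>. bform J (\<lambda>i j. a i j * eps i j \<omega>) s t) \<le> 2 * sqrt p"
  by (rule Lp_norm_le) (use assms bform_khintchine in auto)

lemma Lp_norm_le_R_norm:
  assumes J: "finite J" and p: "p \<ge> 1" and a: "\<And>i j. i \<in> J \<Longrightarrow> j \<in> J \<Longrightarrow> \<bar>a i j\<bar> \<le> 1"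
    and st: "L2_set s J \<le> 1" "L2_set t J \<le> 1"
  shows "Lp_norm p (\<lambda>\<omega>. bform J (\<lambda>i j. a i j * eps i j \<omega>) s t) \<le> R_norm J a p"
proof -
  let ?f = "\<lambda>(s, t). Lp_norm p (\<lambda>\<omega>. bform J (\<lambda>i j. a i j * eps i j \<omega>) s t)"
  have "bdd_above (?f ` ball_pairs J)"
    by (rule bdd_aboveI2[of _ _ "2 * sqrt p"]) (use Lp_norm_bform_le[OF J p a] in \<open>auto simp: ball_pairs_def\<close>)
  then have "?f (s, t) \<le> (SUP st\<in>ball_pairs J. ?f st)"
    by (rule cSUP_upper[rotated]) (use st in \<open>simp add: ball_pairs_def\<close>)
  then show ?thesis by (simp add: R_norm_def bform_def)
qed

lemma R_norm_nonneg:
  assumes "finite J" "p \<ge> 1" "\<And>i j. i \<in> J \<Longrightarrow> j \<in> J \<Longrightarrow> \<bar>a i j\<bar> \<le> 1"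
  shows "R_norm J a p \<ge> 0"
proof -
  have "Lp_norm p (\<lambda>\<omega>. bform J (\<lambda>i j. a i j * eps i j \<omega>) (\<lambda>_. 0) (\<lambda>_. 0)) \<le> R_norm J a p"
    by (rule Lp_norm_le_R_norm[OF assms]) (auto simp: L2_set_def)
  then show ?thesis by (rule order.trans[OF Lp_norm_nonneg])
qed

lemma moment_le_of_Lp_norm:
  assumes "n \<ge> 1" "Lp_norm (real n) S \<le> \<rho>"
  shows "(\<integral>\<omega>. \<bar>S \<omega>\<bar> ^ n \<partial>rademacher_space) \<le> \<rho> ^ n"
proof -
  have \<rho>: "\<rho> \<ge> 0" using assms(2) Lp_norm_nonneg order.trans by blast
  have "y powr real n = y ^ n" if "y \<ge> 0" for y :: real
    using that assms(1) by (intro powr_realpow') auto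
  then show ?thesis using integral_le_Lp_norm_powr[of "real n" S \<rho>] assms \<rho> by simp
qed

text \<open>\<open>36864\<close> comes from the moment bound; the square of
  \<open>6 * 3 ^ 14\<close> absorbs the remaining factor
  \<open>exp 1 ^ 26 * (4 * (8 * exp 1))\<close> per unit of \<open>p\<close>, using
  \<open>exp 1 \<le> 3\<close>.\<close>

definition op_const :: real where
  "op_const = 6 * 3 ^ 14 * 36864"

lemma op_const_ge_1: "op_const \<ge> 1"
  by (simp add: op_const_def)

text \<open>The dimension is at most exponential in \<open>p\<close> and so becomes a constant after
  the root of order \<open>2 * p\<close>. The rate 26 fits the blocks of the layer decomposition,
  which have at most \<open>2 ^ (24 * p + 1)\<close> indices.\<close>

lemma op_norm_moment_le_of_card:
  assumes J: "finite J" and b: "\<And>i j. i \<in> J \<Longrightarrow> j \<in> J \<Longrightarrow> b i j \<in> {0, 1}"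
    and D: "D > 0" "\<And>i. i \<in> J \<Longrightarrow> real (card {j \<in> J. b i j = 1}) \<le> D"
      "\<And>j. j \<in> J \<Longrightarrow> real (card {i \<in> J. b i j = 1}) \<le> D"
    and p: "p \<ge> 1" and card: "real (card J) \<le> exp (26 * real p)"
    and \<rho>: "\<rho> \<ge> 0" "\<And>s t. L2_set s J \<le> 1 \<Longrightarrow> L2_set t J \<le> 1 \<Longrightarrow>
      (\<integral>\<omega>. \<bar>bform J (\<lambda>i j. b i j * eps i j \<omega>) s t\<bar> ^ (2 * p) \<partial>rademacher_space) \<le> \<rho> ^ (2 * p)"
  shows "(\<integral>\<omega>. op_norm J (\<lambda>i j. b i j * eps i j \<omega>) ^ (2 * p) \<partial>rademacher_space) \<le>
    (op_const * (\<rho> + sqrt D)) ^ (2 * p)"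
proof -
  let ?x = "36864 * (\<rho> + sqrt D)"
  have x: "?x \<ge> 0" using \<rho>(1) D(1) by simp
  have e: "exp 1 \<le> (3::real)" by (rule exp_le)
  have "(\<integral>\<omega>. op_norm J (\<lambda>i j. b i j * eps i j \<omega>) ^ (2 * p) \<partial>rademacher_space) \<le>
      card J * (4 * (8 * exp 1) ^ p * ?x ^ (2 * p))"
    by (rule op_norm_moment_le[OF J b D p \<rho>])
  also have "\<dots> \<le> (exp 1 ^ 26) ^ p * (4 ^ p * (8 * exp 1) ^ p * ?x ^ (2 * p))"
  proof (rule mult_mono)
    have "exp (26 * real p) = (exp 1 ^ 26) ^ p"
      by (simp flip: exp_of_nat_mult power_mult)
    then show "real (card J) \<le> (exp 1 ^ 26) ^ p" using card by simp
    have "(4::real) \<le> 4 ^ p" using p self_le_power[of "4::real" p] by simp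
    then show "4 * (8 * exp 1) ^ p * ?x ^ (2 * p) \<le> 4 ^ p * (8 * exp 1) ^ p * ?x ^ (2 * p)"
      using x by (intro mult_right_mono) auto
  qed (use x in auto)
  also have "\<dots> = (exp 1 ^ 26 * (4 * (8 * exp 1))) ^ p * ?x ^ (2 * p)"
    by (simp only: power_mult_distrib mult.assoc)
  also have "\<dots> \<le> ((6 * 3 ^ 14) ^ 2) ^ p * ?x ^ (2 * p)"
  proof (intro mult_right_mono power_mono)
    have "exp 1 ^ 26 * (4 * (8 * exp 1)) \<le> (3::real) ^ 26 * (4 * (8 * 3))"
      using e by (intro mult_mono power_mono) auto
    also have "\<dots> \<le> (6 * 3 ^ 14) ^ 2" by simp
    finally show "exp 1 ^ 26 * (4 * (8 * exp 1)) \<le> (6 * 3 ^ 14 :: real) ^ 2" .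
  qed (use x in auto)
  also have "\<dots> = (6 * 3 ^ 14 * ?x) ^ (2 * p)"
    by (simp only: power_mult[symmetric] power_mult_distrib[symmetric])
  also have "6 * 3 ^ 14 * ?x = op_const * (\<rho> + sqrt D)" by (simp add: op_const_def)
  finally show ?thesis .
qed

lemma expected_op_norm_le:
  assumes J: "finite J" and b: "\<And>i j. i \<in> J \<Longrightarrow> j \<in> J \<Longrightarrow> b i j \<in> {0, 1}"
    and D: "D > 0" "\<And>i. i \<in> J \<Longrightarrow> real (card {j \<in> J. b i j = 1}) \<le> D"
      "\<And>j. j \<in> J \<Longrightarrow> real (card {i \<in> J. b i j = 1}) \<le> D"
    and p: "p \<ge> 1" and card: "real (card J) \<le> exp (26 * real p)"
    and \<rho>: "\<rho> \<ge> 0" "\<And>s t. L2_set s J \<le> 1 \<Longrightarrow> L2_set t J \<le> 1 \<Longrightarrow>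
      (\<integral>\<omega>. \<bar>bform J (\<lambda>i j. b i j * eps i j \<omega>) s t\<bar> ^ (2 * p) \<partial>rademacher_space) \<le> \<rho> ^ (2 * p)"
  shows "expected_op_norm J b \<le> op_const * (\<rho> + sqrt D)"
proof -
  have "expected_op_norm J b ^ (2 * p) \<le> (\<integral>\<omega>. op_norm J (\<lambda>i j. b i j * eps i j \<omega>) ^ (2 * p) \<partial>rademacher_space)"
    unfolding expected_op_norm_def
    by (rule power_expectation_le[OF prob_space_rademacher_space])
      (use p J in \<open>auto intro!: op_norm_nonneg integrable_op_norm[of J "\<lambda>x. x"] integrable_op_norm[of J "\<lambda>x. x ^ (2 * p)"]\<close>)
  also have "\<dots> \<le> (op_const * (\<rho> + sqrt D)) ^ (2 * p)"
    by (rule op_norm_moment_le_of_card[OF J b D p card \<rho>])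
  finally have *: "expected_op_norm J b ^ (2 * p) \<le> (op_const * (\<rho> + sqrt D)) ^ (2 * p)" .
  have Suc: "Suc (2 * p - 1) = 2 * p" using p by simp
  show ?thesis
  proof (rule power_le_imp_le_base[of _ "2 * p - 1"])
    show "expected_op_norm J b ^ Suc (2 * p - 1) \<le> (op_const * (\<rho> + sqrt D)) ^ Suc (2 * p - 1)"
      unfolding Suc by (rule *)
    show "0 \<le> op_const * (\<rho> + sqrt D)" using \<rho>(1) D(1) op_const_ge_1 by simp
  qed
qed

lemma max_row_ge: "finite J \<Longrightarrow> i \<in> J \<Longrightarrow> L2_set (\<lambda>j. M i j) J \<le> max_row J M"
  unfolding max_row_def by (intro Max_ge) auto

lemma max_col_ge: "finite J \<Longrightarrow> j \<in> J \<Longrightarrow> L2_set (\<lambda>i. M i j) J \<le> max_col J M"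
  unfolding max_col_def by (intro Max_ge) auto

lemma max_row_nonneg: "finite J \<Longrightarrow> J \<noteq> {} \<Longrightarrow> max_row J M \<ge> 0"
  using max_row_ge[of J _ M] L2_set_nonneg order.trans by (metis all_not_in_conv)

lemma max_col_nonneg: "finite J \<Longrightarrow> J \<noteq> {} \<Longrightarrow> max_col J M \<ge> 0"
  using max_col_ge[of J _ M] L2_set_nonneg order.trans by (metis all_not_in_conv)

lemma card_eq_L2_set_sq:
  assumes "finite J" "\<And>j. j \<in> J \<Longrightarrow> f j \<in> {0, 1 :: real}"
  shows "real (card {j \<in> J. f j = 1}) = (L2_set f J)\<^sup>2"
proof -
  have "(L2_set f J)\<^sup>2 = (\<Sum>j\<in>J. if f j = 1 then 1 else 0)"
    unfolding L2_set_power2 by (intro sum.cong refl) (use assms(2) in force)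
  then show ?thesis using assms(1) by (simp add: sum.inter_filter[symmetric])
qed

lemma degrees_le_max_row_col:
  assumes J: "finite J" "J \<noteq> {}" and b: "\<And>i j. i \<in> J \<Longrightarrow> j \<in> J \<Longrightarrow> b i j \<in> {0, 1}"
  shows "i \<in> J \<Longrightarrow> real (card {j \<in> J. b i j = 1}) \<le> (max_row J b + max_col J b)\<^sup>2"
    and "j \<in> J \<Longrightarrow> real (card {i \<in> J. b i j = 1}) \<le> (max_row J b + max_col J b)\<^sup>2"
proof -
  show "real (card {j \<in> J. b i j = 1}) \<le> (max_row J b + max_col J b)\<^sup>2" if i: "i \<in> J"
    using max_row_ge[OF J(1) i, of b] max_col_nonneg[OF J, of b] b[OF i]
    by (subst card_eq_L2_set_sq[OF J(1)]) (auto intro!: power_mono)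
  show "real (card {i \<in> J. b i j = 1}) \<le> (max_row J b + max_col J b)\<^sup>2" if j: "j \<in> J"
    using max_col_ge[OF J(1) j, of b] max_row_nonneg[OF J, of b] b[OF _ j]
    by (subst card_eq_L2_set_sq[OF J(1), of "\<lambda>i. b i j"]) (auto intro!: power_mono)
qed

text \<open>Lets absolute constants be absorbed into the row and column norms as soon as one entry
  is nonzero.\<close>

lemma max_row_col_ge_1:
  assumes J: "finite J" and b: "i \<in> J" "j \<in> J" "b i j = (1::real)"
  shows "max_row J b \<ge> 1" "max_col J b \<ge> 1"
proof -
  have "b i j \<le> L2_set (\<lambda>j. b i j) J" "b i j \<le> L2_set (\<lambda>i. b i j) J"
    using member_le_L2_set[OF J b(2), of "\<lambda>j. b i j"] member_le_L2_set[OF J b(1), of "\<lambda>i. b i j"] by auto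
  then show "max_row J b \<ge> 1" "max_col J b \<ge> 1"
    using max_row_ge[OF J b(1), of b] max_col_ge[OF J b(2), of b] b(3) by auto
qed

lemma expected_op_norm_zero:
  assumes "finite J" "\<And>i j. i \<in> J \<Longrightarrow> j \<in> J \<Longrightarrow> a i j = 0"
  shows "expected_op_norm J a = 0"
proof -
  have "op_norm J (\<lambda>i j. a i j * eps i j \<omega>) = 0" for \<omega>
  proof (rule antisym)
    show "op_norm J (\<lambda>i j. a i j * eps i j \<omega>) \<le> 0"
      by (rule op_norm_le) (use assms in \<open>simp add: bform_def\<close>)
  qed (rule op_norm_nonneg[OF assms(1)])
  then show ?thesis by (simp add: expected_op_norm_def)
qed

lemma Log_ge_1: "Log x \<ge> 1"
  unfolding Log_def by (subst ln_ge_iff) (auto simp: less_max_iff_disj)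

text \<open>Take \<open>p\<close> with \<open>2 * p \<le> ln m \<le> 2 * p + 2\<close>: the first
  inequality makes moments of order \<open>2 * p\<close> at most \<open>R_norm\<close> at
  \<open>Log m\<close>, the second keeps the dimension exponential in \<open>p\<close>. This
  requires \<open>ln m \<ge> 2\<close>, which holds for \<open>m \<ge> 8\<close>; smaller
  \<open>m\<close> is covered by second moments, where Khintchine's bound
  \<open>2 * sqrt 2 \<le> 3\<close> is absorbed by the row and column norms.\<close>

theorem expected_op_norm_le_R_norm:
  assumes m: "m \<ge> 1" and b: "\<And>i j. i \<in> {1..m} \<Longrightarrow> j \<in> {1..m} \<Longrightarrow> b i j \<in> {0, 1}"
  shows "expected_op_norm {1..m} b \<le>
    4 * op_const * (max_row {1..m} b + max_col {1..m} b + R_norm {1..m} b (Log (real m)))"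
proof -
  let ?J = "{1..m}"
  define \<delta> where "\<delta> = max_row ?J b + max_col ?J b"
  have J: "finite ?J" "?J \<noteq> {}" using m by auto
  have b1: "\<bar>b i j\<bar> \<le> 1" if "i \<in> ?J" "j \<in> ?J" for i j using b[OF that] by auto
  have \<delta>0: "\<delta> \<ge> 0" using max_row_nonneg[OF J] max_col_nonneg[OF J] by (simp add: \<delta>_def)
  have R0: "R_norm ?J b (Log m) \<ge> 0" by (rule R_norm_nonneg[OF J(1) Log_ge_1 b1])
  show ?thesis
  proof (cases "\<exists>i\<in>?J. \<exists>j\<in>?J. b i j = 1")
    case False
    then have "b i j = 0" if "i \<in> ?J" "j \<in> ?J" for i j using b[OF that] that by auto
    then have "expected_op_norm ?J b = 0" by (intro expected_op_norm_zero J)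
    then show ?thesis using \<delta>0 R0 op_const_ge_1 by (simp add: \<delta>_def)
  next
    case True
    then obtain i j where "i \<in> ?J" "j \<in> ?J" "b i j = 1" by blast
    then have \<delta>1: "\<delta> \<ge> 1" using max_row_col_ge_1[OF J(1), of i j b] by (simp add: \<delta>_def)
    have D: "\<delta>\<^sup>2 > 0" "sqrt (\<delta>\<^sup>2) = \<delta>" using \<delta>1 by auto
    have deg: "i \<in> ?J \<Longrightarrow> real (card {j \<in> ?J. b i j = 1}) \<le> \<delta>\<^sup>2"
      "i \<in> ?J \<Longrightarrow> real (card {j \<in> ?J. b j i = 1}) \<le> \<delta>\<^sup>2" for i
      unfolding \<delta>_def by (rule degrees_le_max_row_col[OF J b]; assumption)+
    show ?thesis
    proof (cases "m \<ge> 8")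
      case True
      define p where "p = nat \<lfloor>ln (real m) / 2\<rfloor>"
      have "exp 2 \<le> (8::real)"
      proof -
        have "exp (2::real) = exp 1 ^ 2" by (simp flip: exp_of_nat_mult)
        also have "\<dots> \<le> 2.75 ^ 2" using e_less_272 by (intro power_mono) auto
        finally show ?thesis by (simp add: power2_eq_square)
      qed
      then have ln2: "ln (real m) \<ge> 2" using True by (subst ln_ge_iff) auto
      then have p1: "p \<ge> 1" by (simp add: p_def le_nat_iff le_floor_iff)
      have p2: "2 * real p \<le> ln (real m)" "ln (real m) \<le> 2 * real p + 2"
        using ln2 by (auto simp: p_def) linarith+
      have Log: "Log m = ln (real m)"
        using True exp_le by (simp add: Log_def max_def)
      have "real m = exp (ln (real m))" using m by simp
      also have "\<dots> \<le> exp (26 * real p)" using p2 p1 by simp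
      finally have card: "real (card ?J) \<le> exp (26 * real p)" by simp
      have "expected_op_norm ?J b \<le> op_const * (R_norm ?J b (Log m) + sqrt (\<delta>\<^sup>2))"
      proof (rule expected_op_norm_le[OF J(1) b D(1) deg p1 card R0])
        fix s t assume st: "L2_set s ?J \<le> 1" "L2_set t ?J \<le> 1"
        let ?S = "\<lambda>\<omega>. bform ?J (\<lambda>i j. b i j * eps i j \<omega>) s t"
        have "Lp_norm (real (2 * p)) ?S \<le> Lp_norm (Log m) ?S"
          by (rule Lp_norm_mono) (use p1 p2 Log integrable_bform[OF J(1)] in auto)
        also have "\<dots> \<le> R_norm ?J b (Log m)" by (rule Lp_norm_le_R_norm[OF J(1) Log_ge_1 b1 st])
        finally show "(\<integral>\<omega>. \<bar>?S \<omega>\<bar> ^ (2 * p) \<partial>rademacher_space) \<le> R_norm ?J b (Log m) ^ (2 * p)"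
          using p1 by (intro moment_le_of_Lp_norm) auto
      qed
      also have "\<dots> \<le> 4 * op_const * (\<delta> + R_norm ?J b (Log m))"
        using R0 \<delta>0 op_const_ge_1 D(2) by (simp add: algebra_simps mult_nonneg_nonneg)
      finally show ?thesis by (simp add: \<delta>_def)
    next
      case False
      have card: "real (card ?J) \<le> exp (26 * real 1)"
        using False exp_ge_add_one_self[of "26 :: real"] by simp
      have "expected_op_norm ?J b \<le> op_const * (3 + sqrt (\<delta>\<^sup>2))"
      proof (rule expected_op_norm_le[OF J(1) b D(1) deg _ card])
        fix s t assume st: "L2_set s ?J \<le> 1" "L2_set t ?J \<le> 1"
        let ?S = "\<lambda>\<omega>. bform ?J (\<lambda>i j. b i j * eps i j \<omega>) s t"
        have "Lp_norm (real (2 * 1)) ?S \<le> 2 * sqrt (real (2 * 1))"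
          by (rule Lp_norm_bform_le[OF J(1) _ b1 st]) auto
        also have "\<dots> \<le> 3" by (rule power2_le_imp_le) (simp_all add: power_mult_distrib)
        finally show "(\<integral>\<omega>. \<bar>?S \<omega>\<bar> ^ (2 * 1) \<partial>rademacher_space) \<le> 3 ^ (2 * 1)"
          by (intro moment_le_of_Lp_norm) auto
      qed auto
      also have "\<dots> = op_const * (3 + \<delta>)" using D(2) by simp
      also have "\<dots> \<le> op_const * (4 * \<delta> + 4 * R_norm ?J b (Log m))"
        using \<delta>1 R0 op_const_ge_1 by (intro mult_left_mono) auto
      finally show ?thesis by (simp add: \<delta>_def algebra_simps)
    qed
  qed
qed

section \<open>Block tridiagonal decomposition\<close>

lemma sum_card_indices:
  fixes f :: "'a \<Rightarrow> real"
  assumes "finite R" "finite J" "\<And>r. r \<in> R \<Longrightarrow> T r \<subseteq> J"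
    and "\<And>j. j \<in> J \<Longrightarrow> real (card {r \<in> R. j \<in> T r}) \<le> c" "\<And>j. f j \<ge> 0"
  shows "(\<Sum>r\<in>R. \<Sum>j\<in>T r. f j) \<le> c * (\<Sum>j\<in>J. f j)"
proof -
  have "(\<Sum>r\<in>R. \<Sum>j\<in>T r. f j) = (\<Sum>r\<in>R. \<Sum>j\<in>J. if j \<in> T r then f j else 0)"
  proof (rule sum.cong[OF refl])
    fix r assume "r \<in> R"
    then show "(\<Sum>j\<in>T r. f j) = (\<Sum>j\<in>J. if j \<in> T r then f j else 0)"
      using assms(2,3) by (intro sum.mono_neutral_cong_left) auto
  qed
  also have "\<dots> = (\<Sum>j\<in>J. \<Sum>r\<in>R. if j \<in> T r then f j else 0)" by (rule sum.swap)
  also have "\<dots> = (\<Sum>j\<in>J. real (card {r \<in> R. j \<in> T r}) * f j)"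
    using assms(1) by (intro sum.cong refl) (simp add: sum.inter_filter[symmetric])
  also have "\<dots> \<le> (\<Sum>j\<in>J. c * f j)"
    by (intro sum_mono mult_right_mono assms)
  finally show ?thesis by (simp add: sum_distrib_left)
qed

text \<open>A row in layer \<open>r\<close> meets only columns in the layers \<open>r - 1\<close>,
  \<open>r\<close> and \<open>r + 1\<close>, whose union is \<open>S (r + 2) - S (r - 1)\<close>;
  for \<open>r = 0\<close> truncated subtraction gives \<open>S 0 = {}\<close>. Rows lie in one
  block and columns in at most three, so the mean inequality in each block yields the factor
  \<open>(1 + 3) / 2\<close>.\<close>

lemma op_norm_layers_le:
  assumes J: "finite J" and S0: "S 0 = {}" and S_mono: "\<And>r. S r \<subseteq> S (Suc r)"
    and SJ: "\<And>r. S r \<subseteq> J" and Sn: "S (Suc n) = J"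
    and nb: "\<And>r i j. i \<in> S (Suc r) - S r \<Longrightarrow> j \<in> J \<Longrightarrow> X i j \<noteq> 0 \<Longrightarrow> j \<in> S (r + 2) - S (r - 1)"
    and Y: "\<And>r. r \<le> n \<Longrightarrow> op_norm (S (r + 2) - S (r - 1)) X \<le> Y"
  shows "op_norm J X \<le> 2 * Y"
proof (rule op_norm_le)
  fix s t :: "nat \<Rightarrow> real" assume st: "L2_set s J \<le> 1" "L2_set t J \<le> 1"
  define T where "T r = S (r + 2) - S (r - 1)" for r
  define L where "L r = S (Suc r) - S r" for r
  have mono: "S a \<subseteq> S b" if "a \<le> b" for a b using S_mono that by (rule lift_Suc_mono_le)
  have TJ: "T r \<subseteq> J" and LT: "L r \<subseteq> T r" for r
    using SJ[of "r + 2"] mono[of "Suc r" "r + 2"] mono[of "r - 1" r] by (auto simp: T_def L_def)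
  have finT: "finite (T r)" and finL: "finite (L r)" for r
    using TJ[of r] LT[of r] J by (meson finite_subset)+
  have Y0: "Y \<ge> 0" using op_norm_nonneg[OF finT, of 0 X] Y[of 0] by (simp add: T_def)
  define lay where "lay j = (LEAST r. j \<in> S (Suc r))" for j
  have lay: "j \<in> S (Suc r) \<longleftrightarrow> lay j \<le> r" if "j \<in> J" for j r
  proof
    assume "j \<in> S (Suc r)"
    then show "lay j \<le> r" unfolding lay_def by (rule Least_le)
  next
    assume "lay j \<le> r"
    moreover have "j \<in> S (Suc (lay j))"
      unfolding lay_def by (rule LeastI[of _ n]) (use that Sn in simp)
    ultimately show "j \<in> S (Suc r)" using mono[of "Suc (lay j)" "Suc r"] by auto
  qed
  have in_L: "j \<in> L r \<longleftrightarrow> lay j = r" if "j \<in> J" for j r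
  proof (cases r)
    case 0
    then show ?thesis using lay[OF that, of 0] S0 by (simp add: L_def)
  next
    case (Suc r')
    then show ?thesis using lay[OF that, of r] lay[OF that, of r'] by (auto simp: L_def)
  qed
  have in_T: "r \<in> {lay j - 1..lay j + 1}" if "j \<in> J" "j \<in> T r" for j r
  proof -
    have "lay j \<le> Suc r" using lay[OF that(1), of "Suc r"] that(2) by (simp add: T_def)
    moreover have "r \<le> lay j + 1"
    proof (cases "r \<ge> 2")
      case True
      then have "j \<notin> S (Suc (r - 2))" using that(2) by (simp add: T_def numeral_2_eq_2 Suc_diff_Suc)
      then show ?thesis using lay[OF that(1), of "r - 2"] by simp
    qed simp
    ultimately show ?thesis by auto
  qed
  have sumL: "(\<Sum>r\<in>{..n}. \<Sum>j\<in>L r. (s j)\<^sup>2) \<le> 1 * (\<Sum>j\<in>J. (s j)\<^sup>2)"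
  proof (rule sum_card_indices[OF _ J])
    fix j assume j: "j \<in> J"
    have "card {r \<in> {..n}. j \<in> L r} \<le> card {lay j}"
      by (rule card_mono) (use in_L[OF j] in auto)
    then show "real (card {r \<in> {..n}. j \<in> L r}) \<le> 1" by simp
  qed (use LT TJ in auto)
  have sumT: "(\<Sum>r\<in>{..n}. \<Sum>j\<in>T r. (t j)\<^sup>2) \<le> 3 * (\<Sum>j\<in>J. (t j)\<^sup>2)"
  proof (rule sum_card_indices[OF _ J])
    fix j assume j: "j \<in> J"
    have "card {r \<in> {..n}. j \<in> T r} \<le> card {lay j - 1..lay j + 1}"
      by (rule card_mono) (use in_T[OF j] in auto)
    also have "\<dots> \<le> 3" by simp
    finally show "real (card {r \<in> {..n}. j \<in> T r}) \<le> 3" by simp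
  qed (use TJ in auto)
  define s' where "s' r = (\<lambda>i. if i \<in> L r then s i else 0)" for r
  have block: "(\<Sum>i\<in>L r. \<Sum>j\<in>J. X i j * s i * t j) \<le> Y * (((\<Sum>i\<in>L r. (s i)\<^sup>2) + (\<Sum>j\<in>T r. (t j)\<^sup>2)) / 2)"
    if "r \<le> n" for r
  proof -
    have "(\<Sum>i\<in>L r. \<Sum>j\<in>J. X i j * s i * t j) = (\<Sum>i\<in>L r. \<Sum>j\<in>T r. X i j * s i * t j)"
    proof (rule sum.cong[OF refl], rule sum.mono_neutral_right[OF J TJ], rule ballI)
      fix i j assume "i \<in> L r" "j \<in> J - T r"
      then have "X i j = 0" using nb[of i r j] by (auto simp: L_def T_def)
      then show "X i j * s i * t j = 0" by simp
    qed
    also have "\<dots> = bform (T r) X (s' r) t"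
      unfolding bform_def
      by (rule sum.mono_neutral_cong_left) (use finT LT in \<open>auto simp: s'_def\<close>)
    also have "\<dots> \<le> op_norm (T r) X * L2_set (s' r) (T r) * L2_set t (T r)"
      by (rule bform_le_op_norm_mult[OF finT])
    also have "\<dots> = op_norm (T r) X * (L2_set (s' r) (T r) * L2_set t (T r))" by (simp only: mult.assoc)
    also have "\<dots> \<le> Y * (((L2_set (s' r) (T r))\<^sup>2 + (L2_set t (T r))\<^sup>2) / 2)"
    proof (intro mult_mono Y0)
      show "op_norm (T r) X \<le> Y" using Y[OF that] by (simp add: T_def)
      show "L2_set (s' r) (T r) * L2_set t (T r) \<le> ((L2_set (s' r) (T r))\<^sup>2 + (L2_set t (T r))\<^sup>2) / 2"
        using sum_squares_bound[of "L2_set (s' r) (T r)" "L2_set t (T r)"] by simp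
    qed simp
    also have "L2_set (s' r) (T r) = L2_set s (L r)"
      unfolding s'_def by (rule L2_set_restrict[OF finT LT])
    finally show ?thesis by (simp add: L2_set_power2)
  qed
  have J_split: "J = (\<Union>r\<in>{..n}. L r)"
  proof
    show "J \<subseteq> (\<Union>r\<in>{..n}. L r)"
    proof
      fix j assume j: "j \<in> J"
      then have "lay j \<le> n" using lay[OF j, of n] Sn by simp
      then show "j \<in> (\<Union>r\<in>{..n}. L r)" using in_L[OF j] by auto
    qed
  qed (use LT TJ in blast)
  have "bform J X s t = (\<Sum>i\<in>(\<Union>r\<in>{..n}. L r). \<Sum>j\<in>J. X i j * s i * t j)"
    unfolding bform_def J_split[symmetric] ..
  also have "\<dots> = (\<Sum>r\<in>{..n}. \<Sum>i\<in>L r. \<Sum>j\<in>J. X i j * s i * t j)"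
  proof (rule sum.UNION_disjoint)
    show "\<forall>r\<in>{..n}. \<forall>r'\<in>{..n}. r \<noteq> r' \<longrightarrow> L r \<inter> L r' = {}"
    proof (intro ballI impI)
      fix r r' :: nat assume "r \<noteq> r'"
      show "L r \<inter> L r' = {}"
      proof (rule ccontr)
        assume "L r \<inter> L r' \<noteq> {}"
        then obtain j where j: "j \<in> L r" "j \<in> L r'" by blast
        then have "j \<in> J" using LT TJ by blast
        then show False using in_L j \<open>r \<noteq> r'\<close> by metis
      qed
    qed
  qed (use finL in auto)
  also have "\<dots> \<le> (\<Sum>r\<in>{..n}. Y * (((\<Sum>i\<in>L r. (s i)\<^sup>2) + (\<Sum>j\<in>T r. (t j)\<^sup>2)) / 2))"
    by (intro sum_mono block) simp
  also have "\<dots> = Y * (((\<Sum>r\<in>{..n}. \<Sum>i\<in>L r. (s i)\<^sup>2) + (\<Sum>r\<in>{..n}. \<Sum>j\<in>T r. (t j)\<^sup>2)) / 2)"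
    by (simp only: sum_distrib_left[symmetric] sum_divide_distrib[symmetric] sum.distrib)
  also have "\<dots> \<le> Y * ((1 * 1 + 3 * 1) / 2)"
  proof (intro mult_left_mono Y0 divide_right_mono add_mono)
    have "(\<Sum>j\<in>J. (s j)\<^sup>2) \<le> 1" "(\<Sum>j\<in>J. (t j)\<^sup>2) \<le> 1"
      using st by (auto simp: L2_set_def)
    then show "(\<Sum>r\<in>{..n}. \<Sum>i\<in>L r. (s i)\<^sup>2) \<le> 1 * 1" "(\<Sum>r\<in>{..n}. \<Sum>j\<in>T r. (t j)\<^sup>2) \<le> 3 * 1"
      using sumL sumT by linarith+
  qed simp
  finally show "bform J X s t \<le> 2 * Y" by simp
qed

text \<open>Each set is obtained from its predecessor by adding all neighbours and the prescribed
  \<open>I r\<close>. Sizes remain under control because the scale \<open>\<kappa>\<close> is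
  squared at every step and \<open>4 * d + 2 \<le> \<kappa> r\<close> absorbs the growth by the
  degree.\<close>

lemma layers_exist:
  fixes E :: "(nat \<times> nat) set" and I :: "nat \<Rightarrow> nat set" and d :: nat
  assumes J: "finite J" and d: "d \<ge> 1" "\<And>i. i \<in> J \<Longrightarrow> card {j \<in> J. (i, j) \<in> E} \<le> d"
      "\<And>i. i \<in> J \<Longrightarrow> card {j \<in> J. (j, i) \<in> E} \<le> d"
    and I: "\<And>r. I r \<subseteq> J" "\<And>r. card (I r) \<le> 2 ^ (12 * d * 2 ^ r)" and In: "I n = J"
  obtains S where "S 0 = {}" "\<And>r. S r \<subseteq> S (Suc r)" "\<And>r. S r \<subseteq> J" "S (Suc n) = J"
    "\<And>r. I r \<subseteq> S (Suc r)" "\<And>r. card (S (Suc r)) \<le> 2 * 2 ^ (12 * d * 2 ^ r)"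
    "\<And>r i j. i \<in> S (Suc r) - S r \<Longrightarrow> j \<in> J \<Longrightarrow> (i, j) \<in> E \<Longrightarrow> j \<in> S (r + 2) - S (r - 1)"
proof -
  define N where "N A = {j \<in> J. \<exists>i\<in>A. (i, j) \<in> E \<or> (j, i) \<in> E}" for A
  define S where "S = rec_nat {} (\<lambda>r A. A \<union> N A \<union> I r)"
  have S0: "S 0 = {}" and S_Suc: "S (Suc r) = S r \<union> N (S r) \<union> I r" for r by (simp_all add: S_def)
  have SJ: "S r \<subseteq> J" for r
    by (induction r) (use I(1) in \<open>auto simp: S0 S_Suc N_def\<close>)
  have cardN: "card (N A) \<le> card A * (2 * d)" if "A \<subseteq> J" for A
  proof -
    have finA: "finite A" using that J finite_subset by blast
    have "N A \<subseteq> (\<Union>i\<in>A. {j \<in> J. (i, j) \<in> E} \<union> {j \<in> J. (j, i) \<in> E})" by (auto simp: N_def)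
    then have "card (N A) \<le> card (\<Union>i\<in>A. {j \<in> J. (i, j) \<in> E} \<union> {j \<in> J. (j, i) \<in> E})"
      using J finA by (intro card_mono) auto
    also have "\<dots> \<le> (\<Sum>i\<in>A. card ({j \<in> J. (i, j) \<in> E} \<union> {j \<in> J. (j, i) \<in> E}))"
      by (rule card_UN_le[OF finA])
    also have "\<dots> \<le> (\<Sum>i\<in>A. d + d)"
    proof (rule sum_mono)
      fix i assume "i \<in> A"
      then show "card ({j \<in> J. (i, j) \<in> E} \<union> {j \<in> J. (j, i) \<in> E}) \<le> d + d"
        using d(2,3)[of i] that card_Un_le[of "{j \<in> J. (i, j) \<in> E}" "{j \<in> J. (j, i) \<in> E}"] by auto
    qed
    finally show ?thesis by (simp add: mult_2)
  qed
  define \<kappa> :: "nat \<Rightarrow> nat" where "\<kappa> r = 2 ^ (12 * d * 2 ^ r)" for r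
  have \<kappa>_Suc: "\<kappa> (Suc r) = \<kappa> r * \<kappa> r" for r
    by (simp add: \<kappa>_def mult_2 flip: power_add)
  have \<kappa>_ge: "4 * d + 2 \<le> \<kappa> r" for r
  proof -
    have "4 * d + 2 \<le> 12 * d" using d(1) by simp
    also have "\<dots> \<le> 12 * d * 2 ^ r" by simp
    also have "\<dots> < \<kappa> r" unfolding \<kappa>_def by (rule less_exp)
    finally show ?thesis by simp
  qed
  have cardS: "card (S (Suc r)) \<le> 2 * \<kappa> r" for r
  proof (induction r)
    case 0
    have "N {} = {}" by (simp add: N_def)
    then show ?case using I(2)[of 0] by (simp add: S_Suc S0 \<kappa>_def)
  next
    case (Suc r)
    have "card (S (Suc (Suc r))) \<le> card (S (Suc r)) + card (N (S (Suc r))) + card (I (Suc r))"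
      unfolding S_Suc[of "Suc r"] by (meson add_mono card_Un_le le_refl order.trans)
    also have "\<dots> \<le> card (S (Suc r)) + card (S (Suc r)) * (2 * d) + \<kappa> (Suc r)"
      using cardN[OF SJ] I(2)[of "Suc r"] by (intro add_mono) (auto simp: \<kappa>_def)
    also have "\<dots> = card (S (Suc r)) * (2 * d + 1) + \<kappa> (Suc r)" by simp
    also have "\<dots> \<le> (2 * \<kappa> r) * (2 * d + 1) + \<kappa> (Suc r)"
      by (intro add_mono mult_right_mono Suc.IH) auto
    also have "\<dots> = \<kappa> r * (4 * d + 2) + \<kappa> (Suc r)" by (simp add: algebra_simps)
    also have "\<dots> \<le> \<kappa> r * \<kappa> r + \<kappa> (Suc r)" by (intro add_mono mult_left_mono \<kappa>_ge) auto
    finally show ?case by (simp add: \<kappa>_Suc)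
  qed
  show ?thesis
  proof (rule that[of S])
    show "S 0 = {}" by (rule S0)
    show "S r \<subseteq> S (Suc r)" "I r \<subseteq> S (Suc r)" for r by (auto simp: S_Suc)
    show "S r \<subseteq> J" for r by (rule SJ)
    show "S (Suc n) = J" using SJ[of "Suc n"] In by (auto simp: S_Suc)
    show "card (S (Suc r)) \<le> 2 * 2 ^ (12 * d * 2 ^ r)" for r using cardS[of r] by (simp add: \<kappa>_def)
    fix r i j assume i: "i \<in> S (Suc r) - S r" and j: "j \<in> J" "(i, j) \<in> E"
    have "j \<in> N (S (Suc r))" using i j by (auto simp: N_def)
    then have "j \<in> S (r + 2)" by (simp add: S_Suc)
    moreover have "j \<notin> S (r - 1)"
    proof (cases r)
      case 0
      then show ?thesis by (simp add: S0)
    next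
      case (Suc r')
      show ?thesis
      proof
        \<comment> \<open>Neighbourhood is taken in both directions, so such an early
          \<open>j\<close> would already have pulled \<open>i\<close> into
          \<open>S r\<close>.\<close>
        assume "j \<in> S (r - 1)"
        then have "i \<in> N (S r')" using i j SJ[of "Suc r"] Suc by (auto simp: N_def)
        then have "i \<in> S r" by (simp add: Suc S_Suc)
        then show False using i by simp
      qed
    qed
    ultimately show "j \<in> S (r + 2) - S (r - 1)" by simp
  qed
qed

section \<open>The tail term of \<open>Q\<close>, and the upper bound by \<open>Q\<close>\<close>

lemma L2_set_subset: "finite J \<Longrightarrow> A \<subseteq> J \<Longrightarrow> L2_set s A \<le> L2_set s J"
  unfolding L2_set_def by (intro real_sqrt_le_mono sum_mono2) auto

definition tail_norm :: "nat \<Rightarrow> (nat \<times> nat) set \<Rightarrow> nat \<Rightarrow> nat set \<Rightarrow> real" where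
  "tail_norm n E k I = (SUP (s, t)\<in>ball_pairs {1..n}. Lp_norm (Log (real k))
     (\<lambda>\<omega>. bform ({1..n} - I) (\<lambda>i j. indicator E (i, j) * eps i j \<omega>) s t))"

definition tail_max :: "nat \<Rightarrow> (nat \<times> nat) set \<Rightarrow> real" where
  "tail_max n E = (MAX k\<in>{1..n}. MIN I\<in>{I. I \<subseteq> {1..n} \<and> card I \<le> k}. tail_norm n E k I)"

lemma Q_quantity_eq:
  "Q_quantity n E = max_row {1..n} (\<lambda>i j. indicator E (i, j)) + max_col {1..n} (\<lambda>i j. indicator E (i, j)) + tail_max n E"
  by (simp add: Q_quantity_def tail_max_def tail_norm_def bform_def)

lemma abs_indicator_le_1: "\<bar>indicator E x :: real\<bar> \<le> 1"
  by (simp add: indicator_def)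

lemma Lp_norm_le_tail_norm:
  assumes "L2_set s {1..n} \<le> 1" "L2_set t {1..n} \<le> 1"
  shows "Lp_norm (Log (real k)) (\<lambda>\<omega>. bform ({1..n} - I) (\<lambda>i j. indicator E (i, j) * eps i j \<omega>) s t) \<le> tail_norm n E k I"
proof -
  let ?f = "\<lambda>(s, t). Lp_norm (Log (real k)) (\<lambda>\<omega>. bform ({1..n} - I) (\<lambda>i j. indicator E (i, j) * eps i j \<omega>) s t)"
  have "bdd_above (?f ` ball_pairs {1..n})"
  proof (rule bdd_aboveI2[of _ _ "2 * sqrt (Log (real k))"], clarify)
    fix s t assume "(s, t) \<in> ball_pairs {1..n}"
    then have "L2_set s ({1..n} - I) \<le> 1" "L2_set t ({1..n} - I) \<le> 1"
      using L2_set_subset[of "{1..n}" "{1..n} - I"] by (auto simp: ball_pairs_def intro: order.trans)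
    then show "Lp_norm (Log (real k)) (\<lambda>\<omega>. bform ({1..n} - I) (\<lambda>i j. indicator E (i, j) * eps i j \<omega>) s t)
        \<le> 2 * sqrt (Log (real k))"
      by (intro Lp_norm_bform_le Log_ge_1 abs_indicator_le_1) auto
  qed
  then have "?f (s, t) \<le> (SUP st\<in>ball_pairs {1..n}. ?f st)"
    by (rule cSUP_upper[rotated]) (use assms in \<open>simp add: ball_pairs_def\<close>)
  then show ?thesis by (simp add: tail_norm_def)
qed

lemma tail_norm_le:
  assumes "\<And>s t. L2_set s {1..n} \<le> 1 \<Longrightarrow> L2_set t {1..n} \<le> 1 \<Longrightarrow>
    Lp_norm (Log (real k)) (\<lambda>\<omega>. bform ({1..n} - I) (\<lambda>i j. indicator E (i, j) * eps i j \<omega>) s t) \<le> K"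
  shows "tail_norm n E k I \<le> K"
  unfolding tail_norm_def
  by (rule cSUP_least[OF ball_pairs_nonempty]) (use assms in \<open>auto simp: ball_pairs_def\<close>)

lemma tail_norm_nonneg: "tail_norm n E k I \<ge> 0"
  by (rule order.trans[OF Lp_norm_nonneg Lp_norm_le_tail_norm[of "\<lambda>_. 0" n "\<lambda>_. 0"]]) (auto simp: L2_set_def)

lemma removable_sets: "finite {I. I \<subseteq> {1..n::nat} \<and> card I \<le> k}" "{I. I \<subseteq> {1..n::nat} \<and> card I \<le> k} \<noteq> {}"
  by (auto intro!: exI[of _ "{}"])

lemma tail_max_obtains:
  assumes "k \<in> {1..n}"
  obtains I where "I \<subseteq> {1..n}" "card I \<le> k" "tail_norm n E k I \<le> tail_max n E"
proof -
  let ?A = "{I. I \<subseteq> {1..n} \<and> card I \<le> k}"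
  have "(MIN I\<in>?A. tail_norm n E k I) \<in> tail_norm n E k ` ?A"
    by (rule Min_in) (use removable_sets[of n k] in auto)
  then obtain I where I: "I \<in> ?A" "(MIN I\<in>?A. tail_norm n E k I) = tail_norm n E k I" by auto
  have "(MIN I\<in>?A. tail_norm n E k I) \<le> tail_max n E"
    unfolding tail_max_def by (rule Max_ge) (use assms in auto)
  then show ?thesis using that[of I] I by auto
qed

lemma tail_max_le:
  assumes "n \<ge> 1" "\<And>k. k \<in> {1..n} \<Longrightarrow> \<exists>I. I \<subseteq> {1..n} \<and> card I \<le> k \<and> tail_norm n E k I \<le> K"
  shows "tail_max n E \<le> K"
  unfolding tail_max_def
proof (rule Max.boundedI)
  fix a assume "a \<in> (\<lambda>k. MIN I\<in>{I. I \<subseteq> {1..n} \<and> card I \<le> k}. tail_norm n E k I) ` {1..n}"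
  then obtain k where k: "k \<in> {1..n}" "a = (MIN I\<in>{I. I \<subseteq> {1..n} \<and> card I \<le> k}. tail_norm n E k I)" by auto
  obtain I where I: "I \<subseteq> {1..n}" "card I \<le> k" "tail_norm n E k I \<le> K" using assms(2)[OF k(1)] by auto
  have "a \<le> tail_norm n E k I" unfolding k(2) by (rule Min_le) (use removable_sets[of n k] I in auto)
  then show "a \<le> K" using I by simp
qed (use assms(1) in auto)

lemma tail_max_nonneg: "n \<ge> 1 \<Longrightarrow> tail_max n E \<ge> 0"
proof -
  assume "n \<ge> 1"
  then obtain I where "tail_norm n E 1 I \<le> tail_max n E" using tail_max_obtains[of 1 n E] by auto
  then show ?thesis using tail_norm_nonneg[of n E 1 I] by linarith
qed

text \<open>A maximum over arbitrarily many layers at no loss: always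
  \<open>y \<le> A + y ^ (2 * p) / A ^ (2 * p - 1)\<close>, since for \<open>y > A\<close> the extra
  factors \<open>y / A\<close> exceed one. With \<open>A = 2 * B\<close> the expected excess of
  layer \<open>r\<close> is at most \<open>A * (1/2) ^ (2 * p r)\<close>, which is summable because
  \<open>p r \<ge> Suc r\<close>; the total excess is at most \<open>A\<close>.\<close>

lemma expectation_layers_le:
  fixes y :: "nat \<Rightarrow> (nat \<times> nat \<Rightarrow> bool) \<Rightarrow> real" and p :: "nat \<Rightarrow> nat"
  assumes B: "B > 0" and p: "\<And>r. p r \<ge> Suc r"
    and y: "\<And>r \<omega>. y r \<omega> \<ge> 0" "\<And>r. integrable rademacher_space (\<lambda>\<omega>. y r \<omega> ^ (2 * p r))"
      "\<And>r. r \<le> n \<Longrightarrow> (\<integral>\<omega>. y r \<omega> ^ (2 * p r) \<partial>rademacher_space) \<le> B ^ (2 * p r)"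
    and f: "integrable rademacher_space f" "\<And>\<omega> Y. (\<And>r. r \<le> n \<Longrightarrow> y r \<omega> \<le> Y) \<Longrightarrow> f \<omega> \<le> 2 * Y"
  shows "integral\<^sup>L rademacher_space f \<le> 8 * B"
proof -
  interpret prob_space rademacher_space by (rule prob_space_rademacher_space)
  define A where "A = 2 * B"
  have A: "A > 0" using B by (simp add: A_def)
  define Z where "Z \<omega> = A + (\<Sum>r\<le>n. y r \<omega> ^ (2 * p r) / A ^ (2 * p r - 1))" for \<omega>
  have "y r \<omega> \<le> Z \<omega>" if "r \<le> n" for r \<omega>
  proof -
    have "y r \<omega> \<le> A + y r \<omega> ^ (2 * p r) / A ^ (2 * p r - 1)"
    proof (cases "y r \<omega> \<le> A")
      case True
      then show ?thesis using y(1)[of r \<omega>] A by (smt (verit) divide_nonneg_pos zero_le_power zero_less_power)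
    next
      case False
      have "Suc (2 * p r - 1) = 2 * p r" using p[of r] by simp
      then have eq: "y r \<omega> ^ (2 * p r) = y r \<omega> * y r \<omega> ^ (2 * p r - 1)" by (metis power_Suc)
      have "A ^ (2 * p r - 1) \<le> y r \<omega> ^ (2 * p r - 1)" using False A by (intro power_mono) auto
      then have "y r \<omega> * A ^ (2 * p r - 1) \<le> y r \<omega> ^ (2 * p r)"
        unfolding eq using y(1) by (intro mult_left_mono)
      then have "y r \<omega> \<le> y r \<omega> ^ (2 * p r) / A ^ (2 * p r - 1)" using A by (simp add: field_simps)
      then show ?thesis using A by simp
    qed
    also have "\<dots> \<le> Z \<omega>"
      unfolding Z_def using that y(1) A
      by (intro add_left_mono member_le_sum[where f = "\<lambda>r. y r \<omega> ^ (2 * p r) / A ^ (2 * p r - 1)"]) auto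
    finally show ?thesis .
  qed
  then have fZ: "f \<omega> \<le> 2 * Z \<omega>" for \<omega> using f(2)[of \<omega> "Z \<omega>"] by simp
  have intZ: "integrable rademacher_space Z"
    unfolding Z_def using y(2) by auto
  have "integral\<^sup>L rademacher_space f \<le> (\<integral>\<omega>. 2 * Z \<omega> \<partial>rademacher_space)"
    by (rule integral_mono) (use f intZ fZ in auto)
  also have "\<dots> = 2 * (A + (\<Sum>r\<le>n. (\<integral>\<omega>. y r \<omega> ^ (2 * p r) \<partial>rademacher_space) / A ^ (2 * p r - 1)))"
    unfolding Z_def using y(2)
    by (simp add: Bochner_Integration.integral_add prob_space[unfolded space_rademacher_space])
  also have "\<dots> \<le> 2 * (A + (\<Sum>r\<le>n. A / 2 * (1/2) ^ r))"
  proof (intro mult_left_mono add_left_mono sum_mono)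
    fix r assume r: "r \<in> {..n}"
    have eq: "A ^ (2 * p r) = A * A ^ (2 * p r - 1)"
      using p[of r] by (metis Suc_le_lessD less_Suc_eq_0_disj mult_is_0 not_less_zero power_eq_if zero_neq_numeral)
    have "(\<integral>\<omega>. y r \<omega> ^ (2 * p r) \<partial>rademacher_space) / A ^ (2 * p r - 1) \<le> B ^ (2 * p r) / A ^ (2 * p r - 1)"
      using y(3)[of r] r A by (intro divide_right_mono) auto
    also have "B ^ (2 * p r) = (1/2) ^ (2 * p r) * A ^ (2 * p r)"
      unfolding A_def power_mult_distrib[symmetric] by simp
    also have "\<dots> / A ^ (2 * p r - 1) = A * (1/2) ^ (2 * p r)" unfolding eq using A by simp
    also have "\<dots> \<le> A * (1/2) ^ Suc r"
      using A p[of r] by (intro mult_left_mono power_decreasing) auto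
    finally show "(\<integral>\<omega>. y r \<omega> ^ (2 * p r) \<partial>rademacher_space) / A ^ (2 * p r - 1) \<le> A / 2 * (1/2) ^ r" by simp
  qed simp
  also have "\<dots> \<le> 2 * (A + A / 2 * 2)"
    unfolding sum_distrib_left[symmetric]
    by (intro mult_left_mono add_left_mono sum_half_power_le_2) (use A in auto)
  finally show ?thesis by (simp add: A_def)
qed

text \<open>The block \<open>T r\<close> avoids \<open>S (r - 1)\<close>, which contains
  \<open>I (r - 2)\<close> for \<open>r \<ge> 2\<close>; its moments of order \<open>2 * p r\<close>
  are then covered by the tail term at \<open>\<kappa> (r - 2)\<close>. Nothing is removed from the
  first two blocks, and Khintchine handles them because the exponents start at the order of the
  degree \<open>d\<close>, so that the root of the exponent is comparable to the row and column
  norms.\<close>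

theorem expected_op_norm_le_Q:
  assumes n: "n \<ge> 1" and E: "E \<subseteq> {1..n} \<times> {1..n}"
  shows "expected_op_norm {1..n} (\<lambda>i j. indicator E (i, j)) \<le> 80 * op_const * Q_quantity n E"
proof -
  let ?J = "{1..n}"
  let ?a = "\<lambda>i j. indicator E (i, j) :: real"
  let ?X = "\<lambda>\<omega> i j. ?a i j * eps i j \<omega>"
  define \<delta> where "\<delta> = max_row ?J ?a + max_col ?J ?a"
  define \<tau> where "\<tau> = tail_max n E"
  have J: "finite ?J" "?J \<noteq> {}" using n by auto
  have a01: "?a i j \<in> {0, 1}" for i j by (simp add: indicator_def)
  have \<tau>0: "\<tau> \<ge> 0" unfolding \<tau>_def by (rule tail_max_nonneg[OF n])
  have \<delta>0: "\<delta> \<ge> 0" using max_row_nonneg[OF J] max_col_nonneg[OF J] by (simp add: \<delta>_def)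
  have Q: "Q_quantity n E = \<delta> + \<tau>" by (simp add: Q_quantity_eq \<delta>_def \<tau>_def)
  show ?thesis
  proof (cases "E = {}")
    case True
    then have "expected_op_norm ?J ?a = 0" by (intro expected_op_norm_zero) auto
    then show ?thesis using \<delta>0 \<tau>0 op_const_ge_1 by (simp add: Q)
  next
    case False
    then obtain i0 j0 where "(i0, j0) \<in> E" by auto
    then have \<delta>1: "\<delta> \<ge> 1" using max_row_col_ge_1[OF J(1), of i0 j0 ?a] E by (auto simp: \<delta>_def)
    \<comment> \<open>Rounding the degree bound up to a natural number costs at most a factor 2 in
      its root, because \<open>\<delta> \<ge> 1\<close>.\<close>
    define d where "d = nat \<lceil>\<delta>\<^sup>2\<rceil>"
    have d\<delta>: "\<delta>\<^sup>2 \<le> real d" "real d \<le> \<delta>\<^sup>2 + 1" using of_nat_ceiling[of "\<delta>\<^sup>2"] of_int_ceiling_le_add_one[of "\<delta>\<^sup>2"] by (simp_all add: d_def)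
    have d1: "d \<ge> 1" using d\<delta>(1) \<delta>1 one_le_power[OF \<delta>1, of 2] by linarith
    have "real d \<le> (2 * \<delta>)\<^sup>2" using d\<delta>(2) one_le_power[OF \<delta>1, of 2] by (simp add: power_mult_distrib)
    then have sqrt_d: "sqrt (real d) \<le> 2 * \<delta>" using \<delta>0 by (intro real_le_lsqrt) auto
    have eq1: "{j \<in> A. (i, j) \<in> E} = {j \<in> A. ?a i j = 1}" "{j \<in> A. (j, i) \<in> E} = {j \<in> A. ?a j i = 1}" for A i
      by (auto simp: indicator_def)
    have deg: "i \<in> ?J \<Longrightarrow> real (card {j \<in> ?J. ?a i j = 1}) \<le> \<delta>\<^sup>2"
      "i \<in> ?J \<Longrightarrow> real (card {j \<in> ?J. ?a j i = 1}) \<le> \<delta>\<^sup>2" for i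
      unfolding \<delta>_def by (rule degrees_le_max_row_col[OF J a01]; assumption)+
    have deg1: "card {j \<in> ?J. (i, j) \<in> E} \<le> d" "card {j \<in> ?J. (j, i) \<in> E} \<le> d" if "i \<in> ?J" for i
      using deg(1)[OF that] deg(2)[OF that] d\<delta>(1) unfolding eq1 by linarith+
    define \<kappa> :: "nat \<Rightarrow> nat" where "\<kappa> r = 2 ^ (12 * d * 2 ^ r)" for r
    \<comment> \<open>Scales beyond \<open>n\<close> are outside the range of the maximum in
      \<open>Q\<close>. There the whole index set may be removed: it respects the size bound and
      leaves a zero tail, which also makes the layers end at stage \<open>n\<close>.\<close>
    have "\<exists>I. I \<subseteq> ?J \<and> card I \<le> \<kappa> r \<and> (\<kappa> r > n \<longrightarrow> I = ?J) \<and> tail_norm n E (\<kappa> r) I \<le> \<tau>" for r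
    proof (cases "\<kappa> r \<le> n")
      case True
      then have "\<kappa> r \<in> {1..n}" by (simp add: \<kappa>_def)
      then show ?thesis using tail_max_obtains[of "\<kappa> r" n E] True unfolding \<tau>_def by (metis not_le)
    next
      case False
      have "tail_norm n E (\<kappa> r) ?J \<le> \<tau>"
        by (rule tail_norm_le) (use \<tau>0 in \<open>simp add: bform_def Lp_norm_def\<close>)
      then show ?thesis using False by (intro exI[of _ ?J]) auto
    qed
    then obtain I where I: "\<And>r. I r \<subseteq> ?J" "\<And>r. card (I r) \<le> \<kappa> r" "\<And>r. \<kappa> r > n \<Longrightarrow> I r = ?J"
      "\<And>r. tail_norm n E (\<kappa> r) (I r) \<le> \<tau>" by metis
    have "n < 2 ^ n" by (rule less_exp)
    also have "\<dots> \<le> (12 * d) * 2 ^ n" using d1 by simp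
    also have "\<dots> < \<kappa> n" unfolding \<kappa>_def by (rule less_exp)
    finally have In: "I n = ?J" by (rule I(3))
    obtain S where S: "S 0 = {}" "\<And>r. S r \<subseteq> S (Suc r)" "\<And>r. S r \<subseteq> ?J" "S (Suc n) = ?J"
      "\<And>r. I r \<subseteq> S (Suc r)" "\<And>r. card (S (Suc r)) \<le> 2 * 2 ^ (12 * d * 2 ^ r)"
      "\<And>r i j. i \<in> S (Suc r) - S r \<Longrightarrow> j \<in> ?J \<Longrightarrow> (i, j) \<in> E \<Longrightarrow> j \<in> S (r + 2) - S (r - 1)"
      by (rule layers_exist[OF J(1) d1 deg1 I(1) I(2)[unfolded \<kappa>_def] In]) blast+
    define T where "T r = S (r + 2) - S (r - 1)" for r
    have TJ: "T r \<subseteq> ?J" for r using S(3) by (auto simp: T_def)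
    have finT: "finite (T r)" for r using TJ[of r] finite_subset by blast
    define p where "p r = d * 2 ^ r" for r
    have p_ge: "p r \<ge> Suc r" for r
    proof -
      have "Suc r \<le> 2 ^ r" by (simp add: Suc_le_eq)
      also have "\<dots> \<le> p r" using d1 by (simp add: p_def)
      finally show ?thesis .
    qed
    then have p1: "p r \<ge> 1" for r using le_trans[of 1 "Suc r" "p r"] by simp
    \<comment> \<open>The second summand serves the blocks \<open>r \<le> 1\<close>, where
      \<open>2 * p r \<le> 4 * d\<close> and Khintchine gives
      \<open>2 * sqrt (4 * d)\<close>.\<close>
    define \<rho> where "\<rho> = \<tau> + 4 * sqrt (real d)"
    have \<rho>0: "\<rho> \<ge> 0" using \<tau>0 by (simp add: \<rho>_def)
    have ext: "L2_set (\<lambda>x. if x \<in> T r then f x else 0) ?J = L2_set f (T r)" for f r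
      by (rule L2_set_restrict[OF J(1) TJ])
    have mom: "(\<integral>\<omega>. \<bar>bform (T r) (?X \<omega>) s t\<bar> ^ (2 * p r) \<partial>rademacher_space) \<le> \<rho> ^ (2 * p r)"
      if st: "L2_set s (T r) \<le> 1" "L2_set t (T r) \<le> 1" for r s t
    proof (rule moment_le_of_Lp_norm)
      show "Lp_norm (real (2 * p r)) (\<lambda>\<omega>. bform (T r) (?X \<omega>) s t) \<le> \<rho>"
      proof (cases "r \<ge> 2")
        case True
        then obtain q where q: "r = Suc (Suc q)" by (metis Suc_le_D numeral_2_eq_2 Suc_le_mono)
        have sub: "T r \<subseteq> ?J - I q" using TJ[of r] S(5)[of q] by (auto simp: T_def q)
        have "real (2 * p r) \<le> Log (real (\<kappa> q))"
        proof -
          \<comment> \<open>With \<open>r = q + 2\<close> the exponent is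
            \<open>8 * d * 2 ^ q\<close>. The factor 12 in \<open>\<kappa>\<close> is chosen so that
            12 times the lower bound 2/3 for \<open>ln 2\<close> is 8.\<close>
          have "real (2 * p r) = 12 * real d * 2 ^ q * (2/3)" by (simp add: p_def q)
          also have "\<dots> \<le> 12 * real d * 2 ^ q * ln 2" using ln2_ge_two_thirds by (intro mult_left_mono) auto
          also have "\<dots> = ln (real (\<kappa> q))" by (simp add: \<kappa>_def ln_realpow)
          also have "\<dots> \<le> Log (real (\<kappa> q))"
            unfolding Log_def by (subst ln_le_cancel_iff) (auto simp: \<kappa>_def less_max_iff_disj)
          finally show ?thesis .
        qed
        then have "Lp_norm (real (2 * p r)) (\<lambda>\<omega>. bform (T r) (?X \<omega>) s t) \<le>
            Lp_norm (Log (real (\<kappa> q))) (\<lambda>\<omega>. bform (T r) (?X \<omega>) s t)"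
          using p1[of r] by (intro Lp_norm_mono integrable_bform finT) auto
        also have "\<dots> = Lp_norm (Log (real (\<kappa> q))) (\<lambda>\<omega>. bform (?J - I q) (?X \<omega>)
            (\<lambda>x. if x \<in> T r then s x else 0) (\<lambda>x. if x \<in> T r then t x else 0))"
          by (subst bform_restrict[OF _ sub]) auto
        also have "\<dots> \<le> tail_norm n E (\<kappa> q) (I q)"
          by (rule Lp_norm_le_tail_norm) (simp_all only: ext st)
        also have "\<dots> \<le> \<tau> + 4 * sqrt (real d)" using I(4)[of q] by (rule add_increasing2[rotated]) simp
        also have "\<dots> = \<rho>" by (simp add: \<rho>_def)
        finally show ?thesis .
      next
        case False
        then have "r = 0 \<or> r = 1" by auto
        then have "real (2 * p r) \<le> 4 * real d" by (auto simp: p_def)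
        then have "sqrt (real (2 * p r)) \<le> 2 * sqrt (real d)"
          using real_sqrt_le_mono[of "real (2 * p r)" "4 * real d"] by (simp add: real_sqrt_mult)
        moreover have "Lp_norm (real (2 * p r)) (\<lambda>\<omega>. bform (T r) (?X \<omega>) s t) \<le> 2 * sqrt (real (2 * p r))"
          by (rule Lp_norm_bform_le[OF finT _ abs_indicator_le_1 st]) (use p1[of r] in linarith)
        ultimately show ?thesis using \<tau>0 by (simp add: \<rho>_def)
      qed
      show "1 \<le> 2 * p r" using p1[of r] by simp
    qed
    have cardT: "real (card (T r)) \<le> exp (26 * real (p r))" for r
    proof -
      have "card (T r) \<le> card (S (Suc (Suc r)))"
        by (rule card_mono) (use finite_subset[OF S(3)] in \<open>auto simp: T_def\<close>)
      also have "\<dots> \<le> 2 ^ Suc (24 * p r)" using S(6)[of "Suc r"] by (simp add: p_def mult.assoc)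
      finally have "real (card (T r)) \<le> 2 ^ Suc (24 * p r)" by (simp only: of_nat_le_iff[symmetric, where 'a = real] of_nat_power of_nat_numeral)
      also have "\<dots> \<le> exp 1 ^ Suc (24 * p r)"
        using exp_ge_add_one_self[of "1::real"] by (intro power_mono) auto
      also have "\<dots> = exp (real (Suc (24 * p r)))" by (simp only: exp_of_nat_mult[symmetric] mult_1_right)
      also have "\<dots> \<le> exp (26 * real (p r))" using p1[of r] by simp
      finally show ?thesis .
    qed
    define B where "B = op_const * (\<rho> + sqrt (real d))"
    have B: "B > 0" using \<rho>0 d1 op_const_ge_1 by (simp add: B_def add_nonneg_pos)
    have degT: "real (card {j \<in> T r. ?a i j = 1}) \<le> real d" "real (card {j \<in> T r. ?a j i = 1}) \<le> real d"
      if "i \<in> T r" for r i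
    proof -
      have "card {j \<in> T r. (i, j) \<in> E} \<le> card {j \<in> ?J. (i, j) \<in> E}"
        "card {j \<in> T r. (j, i) \<in> E} \<le> card {j \<in> ?J. (j, i) \<in> E}"
        using TJ[of r] by (intro card_mono; auto)+
      then show "real (card {j \<in> T r. ?a i j = 1}) \<le> real d" "real (card {j \<in> T r. ?a j i = 1}) \<le> real d"
        using deg1[of i] subsetD[OF TJ that] unfolding eq1 by linarith+
    qed
    have moments: "(\<integral>\<omega>. op_norm (T r) (?X \<omega>) ^ (2 * p r) \<partial>rademacher_space) \<le> B ^ (2 * p r)" for r
      unfolding B_def
      by (rule op_norm_moment_le_of_card[OF finT a01 _ degT p1 cardT \<rho>0 mom]) (use d1 in auto)
    have "expected_op_norm ?J ?a \<le> 8 * B"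
      unfolding expected_op_norm_def
    proof (rule expectation_layers_le[OF B p_ge, where y = "\<lambda>r \<omega>. op_norm (T r) (?X \<omega>)"])
      show "op_norm ?J (?X \<omega>) \<le> 2 * Y" if "\<And>r. r \<le> n \<Longrightarrow> op_norm (T r) (?X \<omega>) \<le> Y" for \<omega> Y
        by (rule op_norm_layers_le[OF J(1) S(1,2,3,4)])
          (use S(7) that in \<open>auto simp: T_def indicator_def split: if_splits\<close>)
      show "integrable rademacher_space (\<lambda>\<omega>. op_norm ?J (?X \<omega>))"
        by (rule integrable_op_norm[OF J(1), of "\<lambda>x. x"])
      show "integrable rademacher_space (\<lambda>\<omega>. op_norm (T r) (?X \<omega>) ^ (2 * p r))" for r
        by (rule integrable_op_norm[OF finT])
    qed (use op_norm_nonneg[OF finT] moments in auto)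
    also have "\<dots> = 8 * op_const * (\<tau> + 5 * sqrt (real d))" by (simp add: B_def \<rho>_def)
    also have "\<dots> \<le> 8 * op_const * (\<tau> + 5 * (2 * \<delta>))"
      using sqrt_d op_const_ge_1 by (intro mult_left_mono add_left_mono) auto
    also have "\<dots> \<le> 80 * op_const * Q_quantity n E"
      using \<tau>0 op_const_ge_1 by (simp add: Q algebra_simps)
    finally show ?thesis .
  qed
qed

section \<open>Small subgraphs\<close>

text \<open>Greedy selection against the fractional relaxation: \<open>B\<close> is a largest set
  closed under passing to heavier items that fits the budget. The fractional optimum exceeds it by
  at most the part of one further item \<open>j0\<close>, whose squared weight is bounded by that of
  any member of \<open>B\<close>; hence the factor 2.\<close>

lemma knapsack:
  fixes w :: "'a \<Rightarrow> nat" and x :: "'a \<Rightarrow> real" and q :: nat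
  assumes A: "finite A" and w: "\<And>j. j \<in> A \<Longrightarrow> w j \<le> q"
    and x: "\<And>j. j \<in> A \<Longrightarrow> 0 \<le> x j" "\<And>j. j \<in> A \<Longrightarrow> x j \<le> real (w j)" "(\<Sum>j\<in>A. x j) \<le> real q"
  obtains B where "B \<subseteq> A" "(\<Sum>j\<in>B. w j) \<le> q" "(\<Sum>j\<in>A. x j * real (w j)) \<le> 2 * (\<Sum>j\<in>B. (real (w j))\<^sup>2)"
proof -
  define U where "U = {B. B \<subseteq> A \<and> (\<forall>j\<in>B. \<forall>k\<in>A - B. w k \<le> w j) \<and> (\<Sum>j\<in>B. w j) \<le> q}"
  have "finite U" unfolding U_def using A by (auto intro: finite_subset[of _ "Pow A"])
  moreover have "{} \<in> U" by (simp add: U_def)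
  ultimately have "Max (card ` U) \<in> card ` U" by (intro Max_in) auto
  then obtain B where B: "B \<in> U" "card B = Max (card ` U)" by auto
  have max: "card B' \<le> card B" if "B' \<in> U" for B'
    using that \<open>finite U\<close> B(2) by (simp add: Max_ge)
  have BA: "B \<subseteq> A" and up: "\<And>j k. j \<in> B \<Longrightarrow> k \<in> A - B \<Longrightarrow> w k \<le> w j" and sumB: "(\<Sum>j\<in>B. w j) \<le> q"
    using B(1) by (auto simp: U_def)
  have finB: "finite B" using BA A finite_subset by blast
  have "(\<Sum>j\<in>A. x j * real (w j)) \<le> 2 * (\<Sum>j\<in>B. (real (w j))\<^sup>2)"
  proof (cases "B = A")
    case True
    have "(\<Sum>j\<in>A. x j * real (w j)) \<le> (\<Sum>j\<in>A. real (w j) * real (w j))"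
      by (intro sum_mono mult_right_mono x(2)) auto
    also have "\<dots> = (\<Sum>j\<in>B. (real (w j))\<^sup>2)" using True by (simp add: power2_eq_square)
    also have "\<dots> \<le> 2 * (\<Sum>j\<in>B. (real (w j))\<^sup>2)" by (simp add: sum_nonneg)
    finally show ?thesis .
  next
    case False
    then have ne: "A - B \<noteq> {}" using BA by auto
    have "Max (w ` (A - B)) \<in> w ` (A - B)" using A ne by (intro Max_in) auto
    then obtain j0 where j0: "j0 \<in> A - B" "w j0 = Max (w ` (A - B))" by auto
    have j0_max: "w k \<le> w j0" if "k \<in> A - B" for k using that A j0(2) by simp
    have "insert j0 B \<notin> U" using max[of "insert j0 B"] j0(1) finB by auto
    then have "q < (\<Sum>j\<in>B. w j) + w j0"
      using BA j0 j0_max up finB by (auto simp: U_def)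
    then have over: "real q - (\<Sum>j\<in>B. real (w j)) \<le> real (w j0)"
      by (simp flip: of_nat_sum)
    \<comment> \<open>Every single item fits the budget, so the overflow caused by \<open>j0\<close>
      implies that something was already selected.\<close>
    have B_ne: "B \<noteq> {}" using \<open>q < (\<Sum>j\<in>B. w j) + w j0\<close> w[of j0] j0(1) by auto
    let ?m = "real (w j0)"
    have split: "(\<Sum>j\<in>A. f j) = (\<Sum>j\<in>B. f j) + (\<Sum>j\<in>A - B. f j)" for f :: "'a \<Rightarrow> real"
      using sum.subset_diff[OF BA A, of f] by simp
    \<comment> \<open>The weight \<open>?m\<close> of \<open>j0\<close> acts as the Lagrange
      multiplier of the budget: on \<open>B\<close> the excess \<open>w j - ?m\<close> is
      nonnegative and \<open>x j \<le> w j\<close>, off \<open>B\<close> all weights are at most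
      \<open>?m\<close>.\<close>
    have "(\<Sum>j\<in>A. x j * real (w j)) \<le> (\<Sum>j\<in>B. real (w j) * (real (w j) - ?m) + x j * ?m) + (\<Sum>j\<in>A - B. x j * ?m)"
      unfolding split
    proof (intro add_mono sum_mono)
      fix j assume j: "j \<in> B"
      have "x j * (real (w j) - ?m) \<le> real (w j) * (real (w j) - ?m)"
        using x(2)[of j] up[OF j j0(1)] j BA by (intro mult_right_mono) auto
      then show "x j * real (w j) \<le> real (w j) * (real (w j) - ?m) + x j * ?m" by (simp add: algebra_simps)
    next
      fix j assume j: "j \<in> A - B"
      then show "x j * real (w j) \<le> x j * ?m" using j0_max[OF j] x(1)[of j] by (intro mult_left_mono) auto
    qed
    also have "\<dots> = (\<Sum>j\<in>B. (real (w j))\<^sup>2) - ?m * (\<Sum>j\<in>B. real (w j)) + (\<Sum>j\<in>A. x j) * ?m"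
      unfolding split by (simp add: sum.distrib sum_subtractf algebra_simps power2_eq_square sum_distrib_left sum_distrib_right)
    also have "\<dots> \<le> (\<Sum>j\<in>B. (real (w j))\<^sup>2) - ?m * (\<Sum>j\<in>B. real (w j)) + real q * ?m"
      using x(3) by (intro add_left_mono mult_right_mono) auto
    also have "\<dots> = (\<Sum>j\<in>B. (real (w j))\<^sup>2) + ?m * (real q - (\<Sum>j\<in>B. real (w j)))" by (simp add: algebra_simps)
    also have "\<dots> \<le> (\<Sum>j\<in>B. (real (w j))\<^sup>2) + ?m * ?m"
      using over by (intro add_left_mono mult_left_mono) auto
    also have "?m * ?m \<le> (\<Sum>j\<in>B. (real (w j))\<^sup>2)"
    proof -
      obtain j where j: "j \<in> B" using B_ne by auto
      have "?m * ?m \<le> (real (w j))\<^sup>2" using up[OF j j0(1)] by (simp add: power2_eq_square mult_mono)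
      also have "\<dots> \<le> (\<Sum>j\<in>B. (real (w j))\<^sup>2)" by (rule member_le_sum[OF j]) (use finB in auto)
      finally show ?thesis .
    qed
    finally show ?thesis by simp
  qed
  then show ?thesis using that BA sumB by blast
qed

text \<open>A geometric sum over any set of exponents is at most twice its largest term.\<close>

lemma sum_dyadic_le:
  fixes y :: real
  assumes "finite S" "\<And>a. a \<in> S \<Longrightarrow> (1/2) ^ a \<le> y" "y \<ge> 0"
  shows "(\<Sum>a\<in>S. (1/2 :: real) ^ a) \<le> 2 * y"
proof (cases "S = {}")
  case False
  define m where "m = Min S"
  have m: "m \<in> S" "\<And>a. a \<in> S \<Longrightarrow> m \<le> a" using assms(1) False by (auto simp: m_def)
  have sub: "S \<subseteq> (+) m ` {..Max S}"
  proof
    fix a assume a: "a \<in> S"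
    then have "a = m + (a - m)" "a - m \<le> Max S"
      using m(2)[OF a] Max_ge[OF assms(1) a] by auto
    then show "a \<in> (+) m ` {..Max S}" by blast
  qed
  have "(\<Sum>a\<in>S. (1/2 :: real) ^ a) \<le> (\<Sum>a\<in>(+) m ` {..Max S}. (1/2) ^ a)"
    by (rule sum_mono2[OF _ sub]) auto
  also have "\<dots> = (\<Sum>k\<le>Max S. (1/2) ^ (m + k))"
    by (subst sum.reindex) (auto simp: inj_on_def)
  also have "\<dots> = (1/2) ^ m * (\<Sum>k\<le>Max S. (1/2) ^ k)" by (simp add: power_add sum_distrib_left)
  also have "\<dots> \<le> y * 2"
    by (intro mult_mono sum_half_power_le_2) (use assms(2)[OF m(1)] assms(3) in \<open>auto intro: sum_nonneg\<close>)
  finally show ?thesis by simp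
qed (use assms in auto)

lemma dyadic_level_exists:
  fixes x :: real
  assumes "0 < x" "x \<le> 1"
  obtains a where "(1/2) ^ Suc a < x" "x \<le> (1/2) ^ a"
proof -
  obtain k where k: "(1/2 :: real) ^ k < x" using real_arch_pow_inv[of x "1/2"] assms by auto
  define a where "a = (LEAST k. (1/2 :: real) ^ k < x)"
  have a: "(1/2 :: real) ^ a < x" unfolding a_def by (rule LeastI) (rule k)
  have "a \<noteq> 0" using a assms(2) by (cases a) auto
  then obtain b where b: "a = Suc b" by (cases a) auto
  then have "\<not> (1/2 :: real) ^ b < x" unfolding a_def using not_less_Least by (metis lessI)
  then show ?thesis using that[of b] a b by auto
qed

text \<open>The bound on small products is proved one dyadic level of \<open>s\<close> at a time. For columns meeting
  a level in few edges the constraint on \<open>s i * t j\<close> makes the sum over levels geometric; for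
  the other columns a knapsack selection of at most \<open>q\<close> edges, tested on uniform weights over the
  level, shows that they contribute at most the mass of the level.\<close>

lemma small_products_le:
  fixes s t :: "nat \<Rightarrow> real" and q :: nat
  assumes J: "finite J" and E: "E \<subseteq> J \<times> J" and q: "q \<ge> 1" and A: "A \<ge> 0"
    and s: "\<And>i. s i \<ge> 0" "L2_set s J \<le> 1" and t: "\<And>j. t j \<ge> 0" "L2_set t J \<le> 1"
    and deg: "\<And>j. j \<in> J \<Longrightarrow> card {i \<in> J. (i, j) \<in> E} \<le> q"
    and H: "\<And>F u v. F \<subseteq> E \<Longrightarrow> card F \<le> q \<Longrightarrow> L2_set u J \<le> 1 \<Longrightarrow> L2_set v J \<le> 1 \<Longrightarrow>
      (\<Sum>e\<in>F. u (fst e) * v (snd e)) \<le> A"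
  shows "real q * (\<Sum>e\<in>{e \<in> E. s (fst e) * t (snd e) \<le> A / q}. (s (fst e))\<^sup>2 * (t (snd e))\<^sup>2) \<le> 8 * A\<^sup>2"
proof -
  define G where "G = {e \<in> E. s (fst e) * t (snd e) \<le> A / q}"
  have finE: "finite E" using finite_subset[OF E] J by simp
  have sum_s: "(\<Sum>i\<in>J. (s i)\<^sup>2) \<le> 1" and sum_t: "(\<Sum>j\<in>J. (t j)\<^sup>2) \<le> 1"
    using s t by (auto simp: L2_set_def)
  define J' where "J' = {i \<in> J. s i > 0}"
  have finJ': "finite J'" using J by (simp add: J'_def)
  \<comment> \<open>Levels are dyadic in the squares, so that the mass of a level is its cardinality
    times \<open>(1/2) ^ a\<close> up to a factor 2.\<close>
  have "\<exists>a. (1/2) ^ Suc a < (s i)\<^sup>2 \<and> (s i)\<^sup>2 \<le> (1/2) ^ a" if "i \<in> J'" for i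
  proof -
    have "(s i)\<^sup>2 \<le> (\<Sum>i\<in>J. (s i)\<^sup>2)" by (rule member_le_sum) (use that J in \<open>auto simp: J'_def\<close>)
    then have "(s i)\<^sup>2 \<le> 1" using sum_s by simp
    moreover have "0 < (s i)\<^sup>2" using that by (simp add: J'_def)
    ultimately show ?thesis using dyadic_level_exists by metis
  qed
  then obtain lev where lev: "\<And>i. i \<in> J' \<Longrightarrow> (1/2) ^ Suc (lev i) < (s i)\<^sup>2 \<and> (s i)\<^sup>2 \<le> (1/2) ^ lev i"
    by metis
  define I where "I a = {i \<in> J'. lev i = a}" for a
  define N where "N a j = {i \<in> I a. (i, j) \<in> E}" for a j
  define n where "n a j = card (N a j)" for a j
  have finI: "finite (I a)" and finN: "finite (N a j)" for a j using finJ' by (auto simp: I_def N_def)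
  define act where "act a j \<longleftrightarrow> (\<exists>i\<in>I a. (i, j) \<in> G)" for a j
  \<comment> \<open>An upper bound for the contribution of all edges between level \<open>a\<close>
    and column \<open>j\<close>. Once a single one of them obeys the product constraint, the column
    is active and all its edges to the level are counted.\<close>
  define c where "c a j = (1/2) ^ a * (t j)\<^sup>2 * real (n a j)" for a j
  have c0: "c a j \<ge> 0" for a j by (simp add: c_def)
  have n_le: "n a j \<le> q" if "j \<in> J" for a j
  proof -
    have "n a j \<le> card {i \<in> J. (i, j) \<in> E}"
      unfolding n_def using J by (intro card_mono) (auto simp: N_def I_def J'_def)
    then show ?thesis using deg[OF that] by simp
  qed
  let ?Lv = "lev ` J'"
  have total: "(\<Sum>e\<in>G. (s (fst e))\<^sup>2 * (t (snd e))\<^sup>2) \<le> (\<Sum>a\<in>?Lv. \<Sum>j\<in>J. if act a j then c a j else 0)"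
  proof -
    have "(\<Sum>e\<in>G. (s (fst e))\<^sup>2 * (t (snd e))\<^sup>2) =
        (\<Sum>e\<in>{e \<in> G. fst e \<in> J'}. (s (fst e))\<^sup>2 * (t (snd e))\<^sup>2)"
    proof (rule sum.mono_neutral_right)
      show "\<forall>e\<in>G - {e \<in> G. fst e \<in> J'}. (s (fst e))\<^sup>2 * (t (snd e))\<^sup>2 = 0"
        using E s(1) by (fastforce simp: G_def J'_def order.strict_iff_order)
    qed (use finE in \<open>auto simp: G_def\<close>)
    also have "\<dots> \<le> (\<Sum>e\<in>(SIGMA a:?Lv. SIGMA j:{j \<in> J. act a j}. N a j). (1/2) ^ fst e * (t (fst (snd e)))\<^sup>2)"
    proof (rule sum_le_included[where i = "\<lambda>e. (snd (snd e), fst (snd e))"])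
      show "finite {e \<in> G. fst e \<in> J'}" using finE by (simp add: G_def)
      show "finite (SIGMA a:?Lv. SIGMA j:{j \<in> J. act a j}. N a j)" using finJ' J finN by auto
      show "\<forall>e\<in>{e \<in> G. fst e \<in> J'}. \<exists>z\<in>(SIGMA a:?Lv. SIGMA j:{j \<in> J. act a j}. N a j).
          (snd (snd z), fst (snd z)) = e \<and> (s (fst e))\<^sup>2 * (t (snd e))\<^sup>2 \<le> (1/2) ^ fst z * (t (fst (snd z)))\<^sup>2"
      proof
        fix e assume e: "e \<in> {e \<in> G. fst e \<in> J'}"
        obtain i j where ij: "e = (i, j)" by (cases e)
        have "i \<in> J'" "(i, j) \<in> G" "(i, j) \<in> E" "j \<in> J" using e E by (auto simp: ij G_def)
        then have "i \<in> N (lev i) j" "act (lev i) j" by (auto simp: N_def I_def act_def)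
        moreover have "(s i)\<^sup>2 * (t j)\<^sup>2 \<le> (1/2) ^ lev i * (t j)\<^sup>2"
          using lev[OF \<open>i \<in> J'\<close>] by (intro mult_right_mono) auto
        ultimately show "\<exists>z\<in>(SIGMA a:?Lv. SIGMA j:{j \<in> J. act a j}. N a j).
          (snd (snd z), fst (snd z)) = e \<and> (s (fst e))\<^sup>2 * (t (snd e))\<^sup>2 \<le> (1/2) ^ fst z * (t (fst (snd z)))\<^sup>2"
          using \<open>i \<in> J'\<close> \<open>j \<in> J\<close> by (intro bexI[of _ "(lev i, j, i)"]) (auto simp: ij)
      qed
    qed auto
    also have "\<dots> = (\<Sum>a\<in>?Lv. \<Sum>e\<in>(SIGMA j:{j \<in> J. act a j}. N a j). (1/2) ^ a * (t (fst e))\<^sup>2)"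
      using sum.Sigma[of ?Lv "\<lambda>a. SIGMA j:{j \<in> J. act a j}. N a j" "\<lambda>a e. (1/2) ^ a * (t (fst e))\<^sup>2"]
        finJ' J finN by (simp add: case_prod_beta')
    also have "\<dots> = (\<Sum>a\<in>?Lv. \<Sum>j\<in>{j \<in> J. act a j}. c a j)"
    proof (rule sum.cong[OF refl])
      fix a
      show "(\<Sum>e\<in>(SIGMA j:{j \<in> J. act a j}. N a j). (1/2) ^ a * (t (fst e))\<^sup>2) = (\<Sum>j\<in>{j \<in> J. act a j}. c a j)"
        using sum.Sigma[of "{j \<in> J. act a j}" "N a" "\<lambda>j e. (1/2) ^ a * (t j)\<^sup>2"] J finN
        by (simp add: case_prod_beta' c_def n_def ac_simps)
    qed
    also have "\<dots> = (\<Sum>a\<in>?Lv. \<Sum>j\<in>J. if act a j then c a j else 0)"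
      by (rule sum.cong[OF refl], rule sum.inter_filter[OF J])
    finally show ?thesis .
  qed
  \<comment> \<open>The threshold \<open>q * (t j)\<^sup>2\<close> is the share of column
    \<open>j\<close> in the edge budget \<open>q\<close>. These shares sum to at most
    \<open>q\<close> and, for the other columns, lie below the edge counts: the hypotheses of
    \<open>knapsack\<close>.\<close>
  define few where "few a j \<longleftrightarrow> real (n a j) \<le> real q * (t j)\<^sup>2" for a j
  have few_sum: "real q * (\<Sum>a\<in>?Lv. if act a j \<and> few a j then c a j else 0) \<le> 4 * A\<^sup>2 * (t j)\<^sup>2" if j: "j \<in> J" for j
  proof (cases "t j = 0")
    case True
    then have "c a j = 0" for a by (simp add: c_def)
    then have "(\<Sum>a\<in>?Lv. if act a j \<and> few a j then c a j else 0) = 0"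
      by (intro sum.neutral ballI) auto
    then show ?thesis using True by simp
  next
    case False
    then have tj: "t j > 0" using t(1)[of j] by simp
    let ?S = "{a \<in> ?Lv. act a j \<and> few a j}"
    \<comment> \<open>An active level contains some \<open>i\<close> with
      \<open>s i * t j \<le> A / q\<close>, and \<open>(1/2) ^ a\<close> is at most twice
      \<open>(s i)\<^sup>2\<close>; so every active level of the column has
      \<open>(1/2) ^ a \<le> y\<close>.\<close>
    define y where "y = 2 * (A / q)\<^sup>2 / (t j)\<^sup>2"
    have dy: "(\<Sum>a\<in>?S. (1/2) ^ a) \<le> 2 * y"
    proof (rule sum_dyadic_le)
      fix a assume "a \<in> ?S"
      then obtain i where i: "i \<in> J'" "lev i = a" "(i, j) \<in> G" by (auto simp: act_def I_def)
      have "(1/2) ^ a \<le> 2 * (s i)\<^sup>2" using lev[OF i(1)] i(2) by simp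
      then have "(1/2) ^ a * (t j)\<^sup>2 \<le> 2 * (s i * t j)\<^sup>2"
        by (simp add: power_mult_distrib mult_right_mono flip: mult.assoc)
      also have "\<dots> \<le> 2 * (A / q)\<^sup>2"
        using i(3) s(1)[of i] t(1)[of j] by (intro mult_left_mono power_mono) (auto simp: G_def)
      finally show "(1/2) ^ a \<le> y" unfolding y_def using tj by (subst pos_le_divide_eq) auto
    qed (use finJ' in \<open>auto simp: y_def\<close>)
    have "real q * (\<Sum>a\<in>?Lv. if act a j \<and> few a j then c a j else 0) = real q * (\<Sum>a\<in>?S. c a j)"
      using finJ' by (simp add: sum.inter_filter)
    also have "\<dots> \<le> real q * (\<Sum>a\<in>?S. (1/2) ^ a * ((t j)\<^sup>2 * (real q * (t j)\<^sup>2)))"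
    proof (intro mult_left_mono sum_mono)
      fix a assume "a \<in> ?S"
      then show "c a j \<le> (1/2) ^ a * ((t j)\<^sup>2 * (real q * (t j)\<^sup>2))"
        unfolding c_def mult.assoc by (intro mult_left_mono) (auto simp: few_def)
    qed simp
    also have "\<dots> = real q * ((t j)\<^sup>2 * (real q * (t j)\<^sup>2)) * (\<Sum>a\<in>?S. (1/2) ^ a)"
      by (simp add: sum_distrib_left sum_distrib_right ac_simps)
    also have "\<dots> \<le> real q * ((t j)\<^sup>2 * (real q * (t j)\<^sup>2)) * (2 * y)"
      by (intro mult_left_mono dy) auto
    also have "\<dots> = 4 * A\<^sup>2 * (t j)\<^sup>2"
      using q tj by (simp add: y_def power_divide field_simps power2_eq_square)
    finally show ?thesis .
  qed
  have many_sum: "real q * (\<Sum>j\<in>J. if \<not> few a j then c a j else 0) \<le> 4 * A\<^sup>2 * (\<Sum>i\<in>I a. (s i)\<^sup>2)" for a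
  proof -
    let ?K = "{j \<in> J. \<not> few a j}"
    have finK: "finite ?K" using J by simp
    obtain B where B: "B \<subseteq> ?K" "(\<Sum>j\<in>B. n a j) \<le> q"
      "(\<Sum>j\<in>?K. (real q * (t j)\<^sup>2) * real (n a j)) \<le> 2 * (\<Sum>j\<in>B. (real (n a j))\<^sup>2)"
    proof (rule knapsack[OF finK, of "n a" q "\<lambda>j. real q * (t j)\<^sup>2"])
      have "(\<Sum>j\<in>?K. real q * (t j)\<^sup>2) \<le> (\<Sum>j\<in>J. real q * (t j)\<^sup>2)" by (rule sum_mono2) (use J in auto)
      also have "\<dots> \<le> real q * 1" unfolding sum_distrib_left[symmetric] by (intro mult_left_mono sum_t) simp
      finally show "(\<Sum>j\<in>?K. real q * (t j)\<^sup>2) \<le> real q" by simp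
    qed (use n_le in \<open>auto simp: few_def\<close>)
    have finB: "finite B" using B(1) finK finite_subset by blast
    define V where "V = (\<Sum>j\<in>B. (real (n a j))\<^sup>2)"
    have V0: "V \<ge> 0" by (simp add: V_def sum_nonneg)
    have VA: "V \<le> A\<^sup>2 * real (card (I a))"
    proof (cases "V = 0")
      case False
      then have Vpos: "V > 0" using V0 by simp
      have "I a \<noteq> {}"
      proof
        assume "I a = {}"
        then have "V = 0" by (simp add: V_def n_def N_def)
        then show False using Vpos by simp
      qed
      then have Npos: "card (I a) > 0" using finI by (simp add: card_gt_0_iff)
      \<comment> \<open>Test vectors for the selected edges: uniform on the level and proportional
        to the edge counts on \<open>B\<close>. Their form equals
        \<open>sqrt V / sqrt (card (I a))\<close>, so the bound \<open>A\<close> for small subgraphs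
        becomes the bound on \<open>V\<close>.\<close>
      define u where "u i = (if i \<in> I a then 1 / sqrt (card (I a)) else 0)" for i
      define v where "v j = (if j \<in> B then real (n a j) / sqrt V else 0)" for j
      have "(\<Sum>i\<in>J. (u i)\<^sup>2) = (\<Sum>i\<in>I a. 1 / real (card (I a)))"
        by (rule sum.mono_neutral_cong_right) (use J in \<open>auto simp: u_def I_def J'_def power_divide\<close>)
      then have u: "L2_set u J \<le> 1" using Npos by (simp add: L2_set_def)
      have "(\<Sum>j\<in>J. (v j)\<^sup>2) = (\<Sum>j\<in>B. (real (n a j))\<^sup>2 / V)"
        by (rule sum.mono_neutral_cong_right) (use J B(1) V0 in \<open>auto simp: v_def power_divide\<close>)
      also have "\<dots> = 1" using Vpos by (simp add: V_def flip: sum_divide_distrib)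
      finally have v: "L2_set v J \<le> 1" by (simp add: L2_set_def)
      define F where "F = (\<lambda>(j, i). (i, j)) ` (SIGMA j:B. N a j)"
      have inj: "inj_on (\<lambda>(j, i). (i, j)) (SIGMA j:B. N a j)" by (auto simp: inj_on_def)
      have "card F = (\<Sum>j\<in>B. n a j)"
        unfolding F_def card_image[OF inj] n_def using finB finN by (simp add: card_SigmaI)
      then have cardF: "card F \<le> q" using B(2) by simp
      have "sqrt V / sqrt (card (I a)) = (\<Sum>j\<in>B. (real (n a j))\<^sup>2) / (sqrt V * sqrt (card (I a)))"
        by (simp only: V_def[symmetric] divide_divide_eq_left[symmetric] real_div_sqrt[OF V0])
      also have "\<dots> = (\<Sum>j\<in>B. real (n a j) * (1 / sqrt (card (I a)) * (real (n a j) / sqrt V)))"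
        by (simp add: sum_divide_distrib power2_eq_square ac_simps)
      also have "\<dots> = (\<Sum>j\<in>B. \<Sum>i\<in>N a j. u i * v j)"
        by (intro sum.cong refl) (simp add: u_def v_def n_def N_def)
      also have "\<dots> = (\<Sum>e\<in>F. u (fst e) * v (snd e))"
        unfolding F_def sum.reindex[OF inj] using sum.Sigma[of B "N a" "\<lambda>j i. u i * v j"] finB finN
        by (simp add: case_prod_beta' comp_def)
      also have "\<dots> \<le> A" by (rule H[OF _ cardF u v]) (auto simp: F_def N_def)
      finally have "sqrt V \<le> A * sqrt (card (I a))" using Npos by (simp add: field_simps)
      then have "(sqrt V)\<^sup>2 \<le> (A * sqrt (card (I a)))\<^sup>2" using V0 by (intro power_mono) auto
      then show ?thesis using V0 by (simp add: power_mult_distrib)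
    qed (use A in simp)
    have "real q * (\<Sum>j\<in>J. if \<not> few a j then c a j else 0) = real q * (\<Sum>j\<in>?K. c a j)"
      using J by (simp add: sum.inter_filter)
    also have "\<dots> = (1/2) ^ a * (\<Sum>j\<in>?K. (real q * (t j)\<^sup>2) * real (n a j))"
      by (simp add: c_def sum_distrib_left ac_simps)
    also have "\<dots> \<le> (1/2) ^ a * (2 * V)" using B(3) by (intro mult_left_mono) (auto simp: V_def)
    also have "\<dots> \<le> (1/2) ^ a * (2 * (A\<^sup>2 * real (card (I a))))" using VA by (intro mult_left_mono) auto
    also have "\<dots> = A\<^sup>2 * (\<Sum>i\<in>I a. 2 * (1/2) ^ a)" by (simp add: ac_simps)
    also have "\<dots> \<le> A\<^sup>2 * (\<Sum>i\<in>I a. 4 * (s i)\<^sup>2)"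
    proof (intro mult_left_mono sum_mono)
      fix i assume "i \<in> I a"
      then show "2 * (1/2) ^ a \<le> 4 * (s i)\<^sup>2" using lev[of i] by (auto simp: I_def)
    qed simp
    finally show ?thesis by (simp add: sum_distrib_left ac_simps)
  qed
  have "real q * (\<Sum>e\<in>G. (s (fst e))\<^sup>2 * (t (snd e))\<^sup>2) \<le>
      real q * (\<Sum>a\<in>?Lv. \<Sum>j\<in>J. if act a j then c a j else 0)"
    by (intro mult_left_mono total) simp
  also have "\<dots> \<le> real q * (\<Sum>a\<in>?Lv. \<Sum>j\<in>J. (if act a j \<and> few a j then c a j else 0) + (if \<not> few a j then c a j else 0))"
    using c0 by (intro mult_left_mono sum_mono) auto
  also have "\<dots> = (\<Sum>j\<in>J. real q * (\<Sum>a\<in>?Lv. if act a j \<and> few a j then c a j else 0)) +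
      (\<Sum>a\<in>?Lv. real q * (\<Sum>j\<in>J. if \<not> few a j then c a j else 0))"
    unfolding sum.distrib distrib_left sum_distrib_left by (subst sum.swap) simp
  also have "\<dots> \<le> (\<Sum>j\<in>J. 4 * A\<^sup>2 * (t j)\<^sup>2) + (\<Sum>a\<in>?Lv. 4 * A\<^sup>2 * (\<Sum>i\<in>I a. (s i)\<^sup>2))"
    by (intro add_mono sum_mono few_sum many_sum)
  also have "\<dots> = 4 * A\<^sup>2 * (\<Sum>j\<in>J. (t j)\<^sup>2) + 4 * A\<^sup>2 * (\<Sum>a\<in>?Lv. \<Sum>i\<in>I a. (s i)\<^sup>2)"
    by (simp add: sum_distrib_left)
  also have "(\<Sum>a\<in>?Lv. \<Sum>i\<in>I a. (s i)\<^sup>2) = (\<Sum>i\<in>J'. (s i)\<^sup>2)"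
    unfolding I_def by (rule sum.group) (use finJ' in auto)
  also have "4 * A\<^sup>2 * (\<Sum>j\<in>J. (t j)\<^sup>2) + 4 * A\<^sup>2 * (\<Sum>i\<in>J'. (s i)\<^sup>2) \<le> 4 * A\<^sup>2 * 1 + 4 * A\<^sup>2 * 1"
  proof (intro add_mono mult_left_mono sum_t)
    have "(\<Sum>i\<in>J'. (s i)\<^sup>2) \<le> (\<Sum>i\<in>J. (s i)\<^sup>2)" by (rule sum_mono2) (use J in \<open>auto simp: J'_def\<close>)
    then show "(\<Sum>i\<in>J'. (s i)\<^sup>2) \<le> 1" using sum_s by simp
  qed auto
  finally show ?thesis by (simp add: G_def)
qed

lemma powr_add_le: "(a + b) powr p \<le> 2 powr p * (a powr p + b powr p)" if "a \<ge> 0" "b \<ge> 0" "p \<ge> 0" for a b p :: real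
proof -
  have "(a + b) powr p \<le> (2 * max a b) powr p" using that by (intro powr_mono2) auto
  also have "\<dots> = 2 powr p * max a b powr p" by (rule powr_mult)
  also have "\<dots> \<le> 2 powr p * (a powr p + b powr p)"
    by (intro mult_left_mono) (auto simp: max_def)
  finally show ?thesis .
qed

text \<open>Split the edges at coefficient size \<open>A / q\<close>. More than \<open>q\<close>
  large coefficients would violate the bound on \<open>q\<close> of them, so the large part is
  itself a small subgraph and is at most \<open>A\<close> for all signs. The small part has square
  sum at most \<open>8 * A\<^sup>2 / q\<close>, and Khintchine with \<open>p \<le> 4 * q\<close>
  gives \<open>2 * sqrt 32 * A \<le> 12 * A\<close>. Adding the two parts costs a further factor
  4.\<close>

lemma Lp_norm_le_of_small_subgraphs:
  fixes q :: nat
  assumes J: "finite J" and q: "q \<ge> 1" and p: "1 \<le> p" "p \<le> 4 * real q" and A: "A \<ge> 0"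
    and deg: "\<And>j. j \<in> J \<Longrightarrow> card {i \<in> J. (i, j) \<in> E} \<le> q"
    and H: "\<And>F u v. F \<subseteq> E \<inter> (J \<times> J) \<Longrightarrow> card F \<le> q \<Longrightarrow> L2_set u J \<le> 1 \<Longrightarrow> L2_set v J \<le> 1 \<Longrightarrow>
      (\<Sum>e\<in>F. u (fst e) * v (snd e)) \<le> A"
    and st: "L2_set s J \<le> 1" "L2_set t J \<le> 1"
  shows "Lp_norm p (\<lambda>\<omega>. bform J (\<lambda>i j. indicator E (i, j) * eps i j \<omega>) s t) \<le> 48 * A"
proof -
  define E' where "E' = E \<inter> (J \<times> J)"
  have finE': "finite E'" using J by (simp add: E'_def)
  define c where "c e = s (fst e) * t (snd e)" for e
  define F0 where "F0 = {e \<in> E'. A / q < \<bar>c e\<bar>}"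
  define E1 where "E1 = {e \<in> E'. \<bar>c e\<bar> \<le> A / q}"
  have fin: "finite F0" "finite E1" using finE' by (auto simp: F0_def E1_def)
  have abs_st: "L2_set (\<lambda>i. \<bar>s i\<bar>) J \<le> 1" "L2_set (\<lambda>i. \<bar>t i\<bar>) J \<le> 1" using st by (simp_all add: L2_set_abs)
  have HA: "(\<Sum>e\<in>F. \<bar>c e\<bar>) \<le> A" if "F \<subseteq> E'" "card F \<le> q" for F
    using H[OF that[unfolded E'_def] abs_st] by (simp add: c_def abs_mult)
  have cardF0: "card F0 \<le> q"
  proof (rule ccontr)
    assume "\<not> card F0 \<le> q"
    then obtain F where F: "F \<subseteq> F0" "card F = q" "finite F"
      by (metis obtain_subset_with_card_n nat_le_linear)
    have "A = (\<Sum>e\<in>F. A / q)" using F q by simp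
    also have "\<dots> < (\<Sum>e\<in>F. \<bar>c e\<bar>)"
      using F q by (intro sum_strict_mono) (auto simp: F0_def)
    also have "\<dots> \<le> A" using F by (intro HA) (auto simp: F0_def)
    finally show False by simp
  qed
  have S1: "(\<Sum>e\<in>F0. \<bar>c e\<bar>) \<le> A" by (rule HA[OF _ cardF0]) (auto simp: F0_def)
  have "real q * (\<Sum>e\<in>{e \<in> E'. \<bar>s (fst e)\<bar> * \<bar>t (snd e)\<bar> \<le> A / q}. \<bar>s (fst e)\<bar>\<^sup>2 * \<bar>t (snd e)\<bar>\<^sup>2) \<le> 8 * A\<^sup>2"
  proof (rule small_products_le[OF J _ q A])
    fix j assume "j \<in> J"
    have "card {i \<in> J. (i, j) \<in> E'} \<le> card {i \<in> J. (i, j) \<in> E}"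
      using J by (intro card_mono) (auto simp: E'_def)
    then show "card {i \<in> J. (i, j) \<in> E'} \<le> q" using deg[OF \<open>j \<in> J\<close>] by simp
  qed (use abs_st H in \<open>auto simp: E'_def\<close>)
  also have "{e \<in> E'. \<bar>s (fst e)\<bar> * \<bar>t (snd e)\<bar> \<le> A / q} = E1" by (simp add: E1_def c_def abs_mult)
  finally have "real q * (\<Sum>e\<in>E1. (c e)\<^sup>2) \<le> 8 * A\<^sup>2" by (simp add: c_def power_mult_distrib)
  then have c2: "(\<Sum>e\<in>E1. (c e)\<^sup>2) \<le> (sqrt (8 / q) * A)\<^sup>2"
    using q by (simp add: power_mult_distrib field_simps)
  let ?S2 = "\<lambda>\<omega>. \<Sum>e\<in>E1. c e * sgb (\<omega> e)"
  have kh: "(\<integral>\<omega>. \<bar>?S2 \<omega>\<bar> powr p \<partial>rademacher_space) \<le> (12 * A) powr p"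
  proof -
    have "(\<integral>\<omega>. \<bar>?S2 \<omega>\<bar> powr p \<partial>rademacher_space) \<le> (2 * sqrt p * (sqrt (8 / q) * A)) powr p"
      by (rule khintchine[OF fin(2) p(1) _ c2]) (use A in auto)
    also have "\<dots> \<le> (12 * A) powr p"
    proof (intro powr_mono2)
      have "sqrt p * sqrt (8 / q) = sqrt (p * (8 / q))" by (rule real_sqrt_mult[symmetric])
      also have "\<dots> \<le> sqrt 36" using p q by (intro real_sqrt_le_mono) (simp add: field_simps)
      also have "sqrt 36 = (6::real)" by (rule real_sqrt_unique) auto
      finally have "2 * (sqrt p * sqrt (8 / q)) * A \<le> 2 * 6 * A" using A by (intro mult_right_mono) auto
      then show "2 * sqrt p * (sqrt (8 / q) * A) \<le> 12 * A" by (simp add: mult.assoc)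
    qed (use p A in auto)
    finally show ?thesis .
  qed
  have split: "bform J (\<lambda>i j. indicator E (i, j) * eps i j \<omega>) s t = (\<Sum>e\<in>F0. c e * sgb (\<omega> e)) + ?S2 \<omega>" for \<omega>
  proof -
    have "bform J (\<lambda>i j. indicator E (i, j) * eps i j \<omega>) s t = (\<Sum>e\<in>E'. c e * sgb (\<omega> e))"
      unfolding bform_eps_eq_sum
      by (rule sum.mono_neutral_cong_right) (use J in \<open>auto simp: E'_def c_def indicator_def\<close>)
    also have "E' = F0 \<union> E1" by (auto simp: F0_def E1_def)
    also have "(\<Sum>e\<in>F0 \<union> E1. c e * sgb (\<omega> e)) = (\<Sum>e\<in>F0. c e * sgb (\<omega> e)) + ?S2 \<omega>"
      by (rule sum.union_disjoint[OF fin]) (auto simp: F0_def E1_def)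
    finally show ?thesis .
  qed
  have S1': "\<bar>\<Sum>e\<in>F0. c e * sgb (\<omega> e)\<bar> \<le> A" for \<omega>
  proof -
    have "\<bar>\<Sum>e\<in>F0. c e * sgb (\<omega> e)\<bar> \<le> (\<Sum>e\<in>F0. \<bar>c e * sgb (\<omega> e)\<bar>)" by (rule sum_abs)
    also have "\<dots> = (\<Sum>e\<in>F0. \<bar>c e\<bar>)" by (intro sum.cong refl) (simp add: abs_mult)
    finally show ?thesis using S1 by simp
  qed
  have int2: "integrable rademacher_space (\<lambda>\<omega>. \<bar>?S2 \<omega>\<bar> powr p)"
    by (rule integrable_finitely_many_signs[OF fin(2)]) simp
  interpret prob_space rademacher_space by (rule prob_space_rademacher_space)
  show ?thesis
  proof (rule Lp_norm_le)
    have "(\<integral>\<omega>. \<bar>bform J (\<lambda>i j. indicator E (i, j) * eps i j \<omega>) s t\<bar> powr p \<partial>rademacher_space) \<le>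
        (\<integral>\<omega>. 2 powr p * (A powr p + \<bar>?S2 \<omega>\<bar> powr p) \<partial>rademacher_space)"
    proof (rule integral_mono)
      show "integrable rademacher_space (\<lambda>\<omega>. \<bar>bform J (\<lambda>i j. indicator E (i, j) * eps i j \<omega>) s t\<bar> powr p)"
        by (rule integrable_bform[OF J])
      show "integrable rademacher_space (\<lambda>\<omega>. 2 powr p * (A powr p + \<bar>?S2 \<omega>\<bar> powr p))"
        using int2 by simp
      fix \<omega>
      have "\<bar>bform J (\<lambda>i j. indicator E (i, j) * eps i j \<omega>) s t\<bar> powr p \<le> (A + \<bar>?S2 \<omega>\<bar>) powr p"
        unfolding split using S1'[of \<omega>] p by (intro powr_mono2) auto
      also have "\<dots> \<le> 2 powr p * (A powr p + \<bar>?S2 \<omega>\<bar> powr p)" by (rule powr_add_le) (use A p in auto)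
      finally show "\<bar>bform J (\<lambda>i j. indicator E (i, j) * eps i j \<omega>) s t\<bar> powr p \<le> \<dots>" .
    qed
    also have "\<dots> = 2 powr p * (A powr p + (\<integral>\<omega>. \<bar>?S2 \<omega>\<bar> powr p \<partial>rademacher_space))"
      using int2 by (simp add: prob_space[unfolded space_rademacher_space])
    also have "\<dots> \<le> 2 powr p * ((12 * A) powr p + (12 * A) powr p)"
      using A p kh by (intro mult_left_mono add_mono powr_mono2) auto
    also have "\<dots> = (2 powr p * 2) * (12 * A) powr p" by simp
    also have "\<dots> \<le> (2 powr p * 2 powr p) * (12 * A) powr p"
      using powr_mono[of 1 p 2] p by (intro mult_right_mono mult_left_mono) auto
    also have "\<dots> = (2 * 2 * (12 * A)) powr p" by (simp only: powr_mult)
    finally show "(\<integral>\<omega>. \<bar>bform J (\<lambda>i j. indicator E (i, j) * eps i j \<omega>) s t\<bar> powr p \<partial>rademacher_space)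
        \<le> (48 * A) powr p" by simp
  qed (use p A in auto)
qed

section \<open>Monotonicity in the edge set, and vertex-disjoint blocks\<close>

lemma expectation_flip:
  fixes f :: "(nat \<times> nat \<Rightarrow> bool) \<Rightarrow> real"
  assumes K: "finite K" and f: "\<And>\<omega> \<omega>'. (\<And>e. e \<in> K \<Longrightarrow> \<omega> e = \<omega>' e) \<Longrightarrow> f \<omega> = f \<omega>'"
  shows "(\<integral>\<omega>. f (\<lambda>e. \<omega> e \<noteq> (e \<in> D)) \<partial>rademacher_space) = integral\<^sup>L rademacher_space f"
proof -
  \<comment> \<open>On subsets of \<open>K\<close> this is the symmetric difference with
    \<open>D \<inter> K\<close>, an involution.\<close>
  let ?\<phi> = "\<lambda>S. (S - D) \<union> (D \<inter> K - S)"
  have "(\<Sum>S\<in>Pow K. f (\<lambda>e. (e \<in> S) \<noteq> (e \<in> D))) = (\<Sum>S\<in>Pow K. f (\<lambda>e. e \<in> S))"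
  proof (rule sum.reindex_bij_witness[of _ ?\<phi> ?\<phi>])
    fix S assume S: "S \<in> Pow K"
    show "f (\<lambda>e. e \<in> ?\<phi> S) = f (\<lambda>e. (e \<in> S) \<noteq> (e \<in> D))" by (rule f) (use S in auto)
  qed auto
  moreover have "(\<integral>\<omega>. f (\<lambda>e. \<omega> e \<noteq> (e \<in> D)) \<partial>rademacher_space) =
      (\<Sum>S\<in>Pow K. f (\<lambda>e. (e \<in> S) \<noteq> (e \<in> D))) / 2 ^ card K"
    by (rule expectation_signs[OF K]) (rule f, simp)
  ultimately show ?thesis using expectation_signs[OF K f] by simp
qed

text \<open>Flipping all signs off \<open>E'\<close> and averaging with the original cancels the
  entries outside \<open>E'\<close>. The smaller matrix is thus a mean of two copies of the larger
  one with the same law.\<close>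

lemma expected_op_norm_mono:
  assumes J: "finite J" and E: "E' \<subseteq> E"
  shows "expected_op_norm J (\<lambda>i j. indicator E' (i, j)) \<le> expected_op_norm J (\<lambda>i j. indicator E (i, j))"
proof -
  let ?f = "\<lambda>\<omega>. op_norm J (\<lambda>i j. indicator E (i, j) * eps i j \<omega>)"
  let ?\<phi> = "\<lambda>\<omega> e. \<omega> e \<noteq> (e \<in> - E')"
  have dep: "?f \<omega> = ?f \<omega>'" if "\<And>e. e \<in> J \<times> J \<Longrightarrow> \<omega> e = \<omega>' e" for \<omega> \<omega>'
    by (rule op_norm_cong) (simp add: eps_def that)
  have le: "op_norm J (\<lambda>i j. indicator E' (i, j) * eps i j \<omega>) \<le> (?f \<omega> + ?f (?\<phi> \<omega>)) / 2" for \<omega>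
  proof (rule op_norm_le)
    fix s t assume st: "L2_set s J \<le> 1" "L2_set t J \<le> 1"
    have "bform J (\<lambda>i j. indicator E' (i, j) * eps i j \<omega>) s t =
        (bform J (\<lambda>i j. indicator E (i, j) * eps i j \<omega>) s t +
         bform J (\<lambda>i j. indicator E (i, j) * eps i j (?\<phi> \<omega>)) s t) / 2"
      unfolding bform_def sum.distrib[symmetric] sum_divide_distrib
    proof (intro sum.cong refl)
      fix i j
      show "indicator E' (i, j) * eps i j \<omega> * s i * t j =
        (indicator E (i, j) * eps i j \<omega> * s i * t j + indicator E (i, j) * eps i j (?\<phi> \<omega>) * s i * t j) / 2"
        using E by (auto simp: indicator_def eps_def)
    qed
    also have "\<dots> \<le> (?f \<omega> + ?f (?\<phi> \<omega>)) / 2"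
      by (intro divide_right_mono add_mono bform_le_op_norm J st) simp
    finally show "bform J (\<lambda>i j. indicator E' (i, j) * eps i j \<omega>) s t \<le> (?f \<omega> + ?f (?\<phi> \<omega>)) / 2" .
  qed
  have int1: "integrable rademacher_space ?f" by (rule integrable_op_norm[OF J, of "\<lambda>x. x"])
  have int2: "integrable rademacher_space (\<lambda>\<omega>. ?f (?\<phi> \<omega>))"
    by (rule integrable_finitely_many_signs[of "J \<times> J"]) (use J in \<open>auto intro!: dep\<close>)
  have "expected_op_norm J (\<lambda>i j. indicator E' (i, j)) \<le> (\<integral>\<omega>. (?f \<omega> + ?f (?\<phi> \<omega>)) / 2 \<partial>rademacher_space)"
    unfolding expected_op_norm_def
    by (rule integral_mono[OF _ _ le]) (use int1 int2 integrable_op_norm[OF J, of "\<lambda>x. x"] in auto)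
  also have "\<dots> = (integral\<^sup>L rademacher_space ?f + (\<integral>\<omega>. ?f (?\<phi> \<omega>) \<partial>rademacher_space)) / 2"
    using int1 int2 by simp
  also have "(\<integral>\<omega>. ?f (?\<phi> \<omega>) \<partial>rademacher_space) = integral\<^sup>L rademacher_space ?f"
    by (rule expectation_flip[of "J \<times> J" ?f "- E'"]) (simp add: J, rule dep, blast)
  finally show ?thesis by (simp add: expected_op_norm_def)
qed

lemma expectation_all_positive:
  assumes "finite F"
  shows "(\<integral>\<omega>. (if \<forall>e\<in>F. \<omega> e then 1 else 0) \<partial>rademacher_space) = (1/2 :: real) ^ card F"
proof -
  have "(if \<forall>e\<in>F. \<omega> e then 1 else 0) = (\<Prod>e\<in>F. of_bool (\<omega> e) :: real)" for \<omega>
  proof (cases "\<forall>e\<in>F. \<omega> e")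
    case False
    then have "\<exists>e\<in>F. of_bool (\<omega> e) = (0 :: real)" by auto
    then have "(\<Prod>e\<in>F. of_bool (\<omega> e) :: real) = 0" using assms by (simp add: prod_zero_iff)
    then show ?thesis using False by simp
  qed simp
  then have "(\<integral>\<omega>. (if \<forall>e\<in>F. \<omega> e then 1 else 0) \<partial>rademacher_space) =
      (\<integral>\<omega>. (\<Prod>e\<in>F. of_bool (\<omega> e) :: real) \<partial>rademacher_space)" by simp
  also have "\<dots> = (\<Prod>e\<in>F. (of_bool True + of_bool False) / 2)"
    by (rule expectation_prod_signs[OF assms, where h = "\<lambda>e b. of_bool b"])
  finally show ?thesis by simp
qed

text \<open>Row and column indices are pooled because a removable set deletes an index on both
  sides.\<close>

definition vertices :: "(nat \<times> nat) set \<Rightarrow> nat set" where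
  "vertices F = fst ` F \<union> snd ` F"

text \<open>Restricting the test vectors to the rows and columns of \<open>F\<close> isolates its
  block, since no other member touches these vertices; with all signs positive the block is the
  indicator matrix of \<open>F\<close>.\<close>

lemma op_norm_ge_positive_block:
  assumes J: "finite J" and Fam: "F \<in> Fam" "\<And>G. G \<in> Fam \<Longrightarrow> G \<noteq> F \<Longrightarrow> vertices F \<inter> vertices G = {}"
    and pos: "\<And>e. e \<in> F \<Longrightarrow> \<omega> e"
  shows "op_norm J (\<lambda>i j. indicator F (i, j)) \<le> op_norm J (\<lambda>i j. indicator (\<Union>Fam) (i, j) * eps i j \<omega>)"
proof (rule op_norm_le)
  fix s t assume st: "L2_set s J \<le> 1" "L2_set t J \<le> 1"
  let ?s = "\<lambda>i. if i \<in> fst ` F then s i else 0" and ?t = "\<lambda>j. if j \<in> snd ` F then t j else 0"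
  have "bform J (\<lambda>i j. indicator F (i, j)) s t = bform J (\<lambda>i j. indicator (\<Union>Fam) (i, j) * eps i j \<omega>) ?s ?t"
    unfolding bform_def
  proof (intro sum.cong refl)
    fix i j
    show "indicator F (i, j) * s i * t j = indicator (\<Union>Fam) (i, j) * eps i j \<omega> * ?s i * ?t j"
    proof (cases "(i, j) \<in> F")
      case True
      then have "i \<in> fst ` F" "j \<in> snd ` F" "(i, j) \<in> \<Union>Fam" "\<omega> (i, j)"
        using Fam(1) pos by (force, force, auto)
      then show ?thesis using True by (simp add: eps_def)
    next
      case False
      have "(i, j) \<notin> \<Union>Fam \<or> i \<notin> fst ` F"
      proof (rule ccontr)
        assume "\<not> ?thesis"
        then obtain G where G: "G \<in> Fam" "(i, j) \<in> G" "i \<in> fst ` F" by auto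
        then have "i \<in> vertices F \<inter> vertices G" by (force simp: vertices_def)
        then show False using Fam(2)[OF G(1)] G(2) False by auto
      qed
      then show ?thesis using False by auto
    qed
  qed
  also have "\<dots> \<le> op_norm J (\<lambda>i j. indicator (\<Union>Fam) (i, j) * eps i j \<omega>)"
  proof (rule bform_le_op_norm[OF J])
    have "L2_set ?s J \<le> L2_set s J" "L2_set ?t J \<le> L2_set t J"
      unfolding L2_set_def by (intro real_sqrt_le_mono sum_mono; simp)+
    then show "L2_set ?s J \<le> 1" "L2_set ?t J \<le> 1" using st by linarith+
  qed
  finally show "bform J (\<lambda>i j. indicator F (i, j)) s t \<le> \<dots>" .
qed

text \<open>With \<open>2 ^ q\<close> vertex-disjoint blocks of at most \<open>q\<close> edges, the number \<open>Z\<close> of blocks all of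
  whose signs are positive satisfies \<open>E Z \<ge> 1\<close>. The inequality \<open>2 l Z - l\<^sup>2 Z\<^sup>2 \<le> 1\<close>, with equality
  to \<open>0\<close> on \<open>Z = 0\<close>, makes the second moment method linear in the expectation.\<close>

lemma expected_op_norm_ge_disjoint_blocks:
  assumes J: "finite J" and Fam: "finite Fam" "card Fam = 2 ^ q"
    and F: "\<And>F. F \<in> Fam \<Longrightarrow> finite F" "\<And>F. F \<in> Fam \<Longrightarrow> card F \<le> q" "\<And>F. F \<in> Fam \<Longrightarrow> F \<noteq> {}"
    and disj: "\<And>F G. F \<in> Fam \<Longrightarrow> G \<in> Fam \<Longrightarrow> F \<noteq> G \<Longrightarrow> vertices F \<inter> vertices G = {}"
    and \<alpha>: "\<alpha> \<ge> 0" "\<And>F. F \<in> Fam \<Longrightarrow> \<alpha> \<le> op_norm J (\<lambda>i j. indicator F (i, j))"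
  shows "\<alpha> / 2 \<le> expected_op_norm J (\<lambda>i j. indicator (\<Union>Fam) (i, j))"
proof -
  interpret prob_space rademacher_space by (rule prob_space_rademacher_space)
  define y :: "(nat \<times> nat) set \<Rightarrow> (nat \<times> nat \<Rightarrow> bool) \<Rightarrow> real" where "y F \<omega> = (if \<forall>e\<in>F. \<omega> e then 1 else 0)" for F \<omega>
  have y_int: "integrable rademacher_space (y F)" if "finite F" for F
    by (rule integrable_finitely_many_signs[OF that]) (simp add: y_def)
  have Ey: "integral\<^sup>L rademacher_space (y F) = (1/2) ^ card F" if "finite F" for F
    unfolding y_def[abs_def] by (rule expectation_all_positive[OF that])
  have y_mult: "y F \<omega> * y G \<omega> = y (F \<union> G) \<omega>" for F G \<omega> by (auto simp: y_def)
  define Z where "Z \<omega> = (\<Sum>F\<in>Fam. y F \<omega>)" for \<omega>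
  define \<mu> where "\<mu> = (\<Sum>F\<in>Fam. (1/2 :: real) ^ card F)"
  have \<mu>1: "\<mu> \<ge> 1"
  proof -
    have "1 = (\<Sum>F\<in>Fam. (1/2 :: real) ^ q)" using Fam(2) by (simp add: power_one_over)
    also have "\<dots> \<le> \<mu>" unfolding \<mu>_def by (intro sum_mono power_decreasing F(2)) auto
    finally show ?thesis .
  qed
  have intZ: "integrable rademacher_space Z" unfolding Z_def by (intro Bochner_Integration.integrable_sum y_int F(1))
  have EZ: "integral\<^sup>L rademacher_space Z = \<mu>"
    unfolding Z_def \<mu>_def using y_int F(1) by (subst Bochner_Integration.integral_sum) (auto simp: Ey)
  have Z2: "(Z \<omega>)\<^sup>2 = (\<Sum>F\<in>Fam. \<Sum>G\<in>Fam. y (F \<union> G) \<omega>)" for \<omega>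
    unfolding Z_def power2_eq_square sum_product y_mult ..
  have intZ2: "integrable rademacher_space (\<lambda>\<omega>. (Z \<omega>)\<^sup>2)"
    unfolding Z2 by (intro Bochner_Integration.integrable_sum y_int) (use F(1) in auto)
  \<comment> \<open>Vertex-disjoint blocks have disjoint edge sets, so the joint probabilities
    factor off the diagonal; the diagonal adds at most the mean.\<close>
  have EZ2: "(\<integral>\<omega>. (Z \<omega>)\<^sup>2 \<partial>rademacher_space) \<le> \<mu> + \<mu>\<^sup>2"
  proof -
    have "(\<integral>\<omega>. (Z \<omega>)\<^sup>2 \<partial>rademacher_space) = (\<Sum>F\<in>Fam. \<integral>\<omega>. (\<Sum>G\<in>Fam. y (F \<union> G) \<omega>) \<partial>rademacher_space)"
      unfolding Z2 by (intro Bochner_Integration.integral_sum Bochner_Integration.integrable_sum y_int) (use F(1) in auto)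
    also have "\<dots> = (\<Sum>F\<in>Fam. \<Sum>G\<in>Fam. (1/2) ^ card (F \<union> G))"
    proof (rule sum.cong[OF refl])
      fix F assume "F \<in> Fam"
      then have "(\<integral>\<omega>. (\<Sum>G\<in>Fam. y (F \<union> G) \<omega>) \<partial>rademacher_space) = (\<Sum>G\<in>Fam. integral\<^sup>L rademacher_space (y (F \<union> G)))"
        using F(1) by (intro Bochner_Integration.integral_sum y_int) auto
      also have "\<dots> = (\<Sum>G\<in>Fam. (1/2) ^ card (F \<union> G))"
        using F(1) \<open>F \<in> Fam\<close> by (intro sum.cong refl Ey) auto
      finally show "(\<integral>\<omega>. (\<Sum>G\<in>Fam. y (F \<union> G) \<omega>) \<partial>rademacher_space) = (\<Sum>G\<in>Fam. (1/2) ^ card (F \<union> G))" .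
    qed
    also have "\<dots> \<le> (\<Sum>F\<in>Fam. \<Sum>G\<in>Fam. (if G = F then (1/2) ^ card F else 0) + (1/2) ^ card F * (1/2) ^ card G)"
    proof (intro sum_mono)
      fix A B assume AB: "A \<in> Fam" "B \<in> Fam"
      show "(1/2 :: real) ^ card (A \<union> B) \<le> (if B = A then (1/2) ^ card A else 0) + (1/2) ^ card A * (1/2) ^ card B"
      proof (cases "B = A")
        case False
        have "A \<inter> B = {}"
        proof (rule ccontr)
          assume "A \<inter> B \<noteq> {}"
          then obtain e where "e \<in> A" "e \<in> B" by auto
          then have "fst e \<in> vertices A \<inter> vertices B" by (simp add: vertices_def)
          then show False using disj[OF AB] False by auto
        qed
        then show ?thesis using False F(1)[OF AB(1)] F(1)[OF AB(2)] by (simp add: card_Un_disjoint power_add)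
      qed simp
    qed
    also have "\<dots> = \<mu> + \<mu>\<^sup>2"
      using Fam(1) by (simp add: \<mu>_def sum.distrib power2_eq_square sum_product)
    finally show ?thesis .
  qed
  \<comment> \<open>This value maximises
    \<open>2 * l * \<mu> - l\<^sup>2 * (\<mu> + \<mu>\<^sup>2)\<close>; the maximum is
    \<open>\<mu> / (1 + \<mu>)\<close>, at least one half because
    \<open>\<mu> \<ge> 1\<close>.\<close>
  define l where "l = 1 / (1 + \<mu>)"
  have l: "l > 0" "l * (1 + \<mu>) = 1" using \<mu>1 by (auto simp: l_def)
  let ?f = "\<lambda>\<omega>. op_norm J (\<lambda>i j. indicator (\<Union>Fam) (i, j) * eps i j \<omega>)"
  have le: "\<alpha> * (2 * l * Z \<omega> - l\<^sup>2 * (Z \<omega>)\<^sup>2) \<le> ?f \<omega>" for \<omega>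
  proof (cases "\<exists>F\<in>Fam. \<forall>e\<in>F. \<omega> e")
    case True
    then obtain A where A: "A \<in> Fam" "\<forall>e\<in>A. \<omega> e" by auto
    have "0 \<le> (1 - l * Z \<omega>)\<^sup>2" by simp
    then have "2 * l * Z \<omega> - l\<^sup>2 * (Z \<omega>)\<^sup>2 \<le> 1" by (simp add: power2_eq_square algebra_simps)
    then have "\<alpha> * (2 * l * Z \<omega> - l\<^sup>2 * (Z \<omega>)\<^sup>2) \<le> \<alpha> * 1" using \<alpha>(1) by (intro mult_left_mono)
    also have "\<dots> \<le> op_norm J (\<lambda>i j. indicator A (i, j))" using \<alpha>(2)[OF A(1)] by simp
    also have "\<dots> \<le> ?f \<omega>"
      using A disj by (intro op_norm_ge_positive_block[OF J A(1)]) auto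
    finally show ?thesis .
  next
    case False
    then have "Z \<omega> = 0" unfolding Z_def y_def by (intro sum.neutral) auto
    then show ?thesis using op_norm_nonneg[OF J] by simp
  qed
  have "\<alpha> / 2 \<le> \<alpha> * (l * \<mu>)"
  proof -
    have "1 / 2 \<le> l * \<mu>" using \<mu>1 by (simp add: l_def field_simps)
    then show ?thesis using \<alpha>(1) mult_left_mono[of "1/2" "l * \<mu>" \<alpha>] by simp
  qed
  also have "\<alpha> * (l * \<mu>) = \<alpha> * (2 * l * \<mu> - l\<^sup>2 * (\<mu> + \<mu>\<^sup>2))"
  proof -
    have "l\<^sup>2 * (\<mu> + \<mu>\<^sup>2) = l * (l * (1 + \<mu>)) * \<mu>" by (simp add: power2_eq_square algebra_simps)
    then show ?thesis using l(2) by simp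
  qed
  also have "\<dots> \<le> \<alpha> * (2 * l * \<mu> - l\<^sup>2 * (\<integral>\<omega>. (Z \<omega>)\<^sup>2 \<partial>rademacher_space))"
    using EZ2 \<alpha>(1) by (intro mult_left_mono diff_left_mono) auto
  also have "\<dots> = (\<integral>\<omega>. \<alpha> * (2 * l * Z \<omega> - l\<^sup>2 * (Z \<omega>)\<^sup>2) \<partial>rademacher_space)"
    using intZ intZ2 EZ by simp
  also have "\<dots> \<le> expected_op_norm J (\<lambda>i j. indicator (\<Union>Fam) (i, j))"
    unfolding expected_op_norm_def
    by (rule integral_mono[OF _ _ le]) (use intZ intZ2 integrable_op_norm[OF J, of "\<lambda>x. x"] in auto)
  finally show ?thesis .
qed

section \<open>The lower bound\<close>

lemma L2_set_delta: "finite J \<Longrightarrow> i \<in> J \<Longrightarrow> L2_set (\<lambda>k. if k = i then 1 else 0) J = 1"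
proof -
  assume "finite J" "i \<in> J"
  moreover have "(\<Sum>k\<in>J. (if k = i then 1 else 0 :: real)\<^sup>2) = (\<Sum>k\<in>J. if k = i then 1 else 0)"
    by (intro sum.cong) auto
  ultimately show ?thesis by (simp add: L2_set_def)
qed

lemma le_of_mult_self_le: "x * x \<le> K * x \<Longrightarrow> 0 \<le> x \<Longrightarrow> 0 \<le> K \<Longrightarrow> x \<le> (K :: real)"
  by (cases "x = 0") auto

lemma L2_row_le_op_norm:
  assumes J: "finite J" and i: "i \<in> J"
  shows "L2_set (\<lambda>j. M i j) J \<le> op_norm J M"
proof (rule le_of_mult_self_le)
  let ?L = "L2_set (\<lambda>j. M i j) J"
  have "?L * ?L = (\<Sum>j\<in>J. M i j * M i j)"
    using L2_set_power2[of "\<lambda>j. M i j" J] by (simp add: power2_eq_square)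
  also have "\<dots> = (\<Sum>k\<in>J. if k = i then (\<Sum>j\<in>J. M i j * M i j) else 0)" using J i by simp
  also have "\<dots> = bform J M (\<lambda>k. if k = i then 1 else 0) (\<lambda>j. M i j)"
    unfolding bform_def by (intro sum.cong refl) auto
  also have "\<dots> \<le> op_norm J M * L2_set (\<lambda>k. if k = i then 1 else 0) J * ?L"
    by (rule bform_le_op_norm_mult[OF J])
  also have "\<dots> = op_norm J M * ?L" using L2_set_delta[OF J i] by simp
  finally show "?L * ?L \<le> op_norm J M * ?L" .
qed (auto simp: op_norm_nonneg J)

lemma L2_col_le_op_norm:
  assumes J: "finite J" and j: "j \<in> J"
  shows "L2_set (\<lambda>i. M i j) J \<le> op_norm J M"
proof (rule le_of_mult_self_le)
  let ?L = "L2_set (\<lambda>i. M i j) J"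
  have "?L * ?L = (\<Sum>i\<in>J. M i j * M i j)"
    using L2_set_power2[of "\<lambda>i. M i j" J] by (simp add: power2_eq_square)
  also have "\<dots> = bform J M (\<lambda>i. M i j) (\<lambda>k. if k = j then 1 else 0)"
    unfolding bform_def
  proof (rule sum.cong[OF refl])
    fix i
    have "(\<Sum>k\<in>J. M i k * M i j * (if k = j then 1 else 0)) = (\<Sum>k\<in>J. if k = j then M i j * M i j else 0)"
      by (intro sum.cong refl) auto
    then show "M i j * M i j = (\<Sum>k\<in>J. M i k * M i j * (if k = j then 1 else 0))" using J j by simp
  qed
  also have "\<dots> \<le> op_norm J M * ?L * L2_set (\<lambda>k. if k = j then 1 else 0) J"
    by (rule bform_le_op_norm_mult[OF J])
  also have "\<dots> = op_norm J M * ?L" using L2_set_delta[OF J j] by simp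
  finally show "?L * ?L \<le> op_norm J M * ?L" .
qed (auto simp: op_norm_nonneg J)

lemma const_le_expected_op_norm:
  assumes J: "finite J" and c: "\<And>\<omega>. c \<le> op_norm J (\<lambda>i j. a i j * eps i j \<omega>)"
  shows "c \<le> expected_op_norm J a"
proof -
  interpret prob_space rademacher_space by (rule prob_space_rademacher_space)
  have "(\<integral>\<omega>. c \<partial>rademacher_space) \<le> expected_op_norm J a"
    unfolding expected_op_norm_def
    by (rule integral_mono[OF _ _ c]) (use integrable_op_norm[OF J, of "\<lambda>x. x"] in auto)
  then show ?thesis by (simp add: prob_space[unfolded space_rademacher_space])
qed

text \<open>Row norms are unchanged by signs, so the operator norm dominates them for every sign
  pattern, not only on average.\<close>

lemma max_row_le_expected_op_norm:
  assumes J: "finite J" "J \<noteq> {}"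
  shows "max_row J a \<le> expected_op_norm J a"
proof (rule const_le_expected_op_norm[OF J(1)])
  fix \<omega>
  have "L2_set (\<lambda>j. a i j) J \<le> op_norm J (\<lambda>i j. a i j * eps i j \<omega>)" if "i \<in> J" for i
  proof -
    have "L2_set (\<lambda>j. a i j) J = L2_set (\<lambda>j. a i j * eps i j \<omega>) J"
      unfolding L2_set_def by (intro arg_cong[where f = sqrt] sum.cong refl) (simp add: eps_def)
    then show ?thesis using L2_row_le_op_norm[OF J(1) that, of "\<lambda>i j. a i j * eps i j \<omega>"] by simp
  qed
  then show "max_row J a \<le> op_norm J (\<lambda>i j. a i j * eps i j \<omega>)"
    unfolding max_row_def using J by (intro Max.boundedI) auto
qed

lemma max_col_le_expected_op_norm:
  assumes J: "finite J" "J \<noteq> {}"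
  shows "max_col J a \<le> expected_op_norm J a"
proof (rule const_le_expected_op_norm[OF J(1)])
  fix \<omega>
  have "L2_set (\<lambda>i. a i j) J \<le> op_norm J (\<lambda>i j. a i j * eps i j \<omega>)" if "j \<in> J" for j
  proof -
    have "L2_set (\<lambda>i. a i j) J = L2_set (\<lambda>i. a i j * eps i j \<omega>) J"
      unfolding L2_set_def by (intro arg_cong[where f = sqrt] sum.cong refl) (simp add: eps_def)
    then show ?thesis using L2_col_le_op_norm[OF J(1) that, of "\<lambda>i j. a i j * eps i j \<omega>"] by simp
  qed
  then show "max_col J a \<le> op_norm J (\<lambda>i j. a i j * eps i j \<omega>)"
    unfolding max_col_def using J by (intro Max.boundedI) auto
qed

lemma card_vertices_le: "finite F \<Longrightarrow> card (vertices F) \<le> 2 * card F"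
proof -
  assume F: "finite F"
  have "card (vertices F) \<le> card (fst ` F) + card (snd ` F)" unfolding vertices_def by (rule card_Un_le)
  also have "\<dots> \<le> card F + card F" by (intro add_mono card_image_le F)
  finally show ?thesis by simp
qed

text \<open>Greedy removal: a maximal family of vertex-disjoint small subgraphs of large norm has fewer
  than \<open>2 ^ q\<close> members, and no such subgraph survives the removal of its vertices.\<close>

lemma exists_removable_set:
  fixes q :: nat
  assumes J: "finite J" and E: "E \<subseteq> J \<times> J" and q: "q \<ge> 1"
  obtains I where "I \<subseteq> J" "card I \<le> 4 ^ q"
    "\<And>F. F \<subseteq> E \<inter> ((J - I) \<times> (J - I)) \<Longrightarrow> card F \<le> q \<Longrightarrow>
      op_norm J (\<lambda>i j. indicator F (i, j)) \<le> 2 * expected_op_norm J (\<lambda>i j. indicator E (i, j))"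
proof -
  define M0 where "M0 = expected_op_norm J (\<lambda>i j. indicator E (i, j))"
  have M0: "M0 \<ge> 0" unfolding M0_def by (rule const_le_expected_op_norm[OF J]) (rule op_norm_nonneg[OF J])
  have finE: "finite E" using finite_subset[OF E] J by simp
  define big where "big F \<longleftrightarrow> F \<subseteq> E \<and> card F \<le> q \<and> 2 * M0 < op_norm J (\<lambda>i j. indicator F (i, j))" for F
  define fam where "fam Fam \<longleftrightarrow> (\<forall>F\<in>Fam. big F) \<and>
    (\<forall>F\<in>Fam. \<forall>G\<in>Fam. F \<noteq> G \<longrightarrow> vertices F \<inter> vertices G = {})" for Fam
  have fin: "finite F" if "big F" for F using that finE finite_subset by (auto simp: big_def)
  have op_empty: "op_norm J (\<lambda>i j. indicator {} (i, j)) \<le> 0"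
    by (rule op_norm_le) (simp add: bform_def)
  have nonempty: "F \<noteq> {}" if "big F" for F
    using that op_empty M0 by (auto simp: big_def)
  have famsub: "Fam \<in> Pow (Pow E)" if "fam Fam" for Fam using that by (auto simp: fam_def big_def)
  have finfam: "finite {Fam. fam Fam}"
    by (rule finite_subset[of _ "Pow (Pow E)"]) (use famsub finE in auto)
  have "fam {}" by (simp add: fam_def)
  then have "Max (card ` {Fam. fam Fam}) \<in> card ` {Fam. fam Fam}" using finfam by (intro Max_in) auto
  then obtain Fam where Fam: "fam Fam" "card Fam = Max (card ` {Fam. fam Fam})" by auto
  have max: "card Fam' \<le> card Fam" if "fam Fam'" for Fam'
    unfolding Fam(2) using that finfam by (intro Max_ge) auto
  have finFam: "finite Fam" using famsub[OF Fam(1)] finE by (meson PowD finite_Pow_iff finite_subset)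
  have card_lt: "card Fam < 2 ^ q"
  proof (rule ccontr)
    assume "\<not> card Fam < 2 ^ q"
    then obtain G where G: "G \<subseteq> Fam" "card G = 2 ^ q" "finite G"
      by (metis obtain_subset_with_card_n not_less)
    have Gne: "G \<noteq> {}" using G(2) by auto
    define \<alpha> where "\<alpha> = Min ((\<lambda>F. op_norm J (\<lambda>i j. indicator F (i, j))) ` G)"
    have big: "big F" if "F \<in> G" for F using that G(1) Fam(1) by (auto simp: fam_def)
    have "\<alpha> > 2 * M0"
      unfolding \<alpha>_def using G(3) Gne big by (subst Min_gr_iff) (auto simp: big_def)
    have "\<alpha> / 2 \<le> expected_op_norm J (\<lambda>i j. indicator (\<Union>G) (i, j))"
    proof (rule expected_op_norm_ge_disjoint_blocks[OF J G(3,2)])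
      show "\<alpha> \<ge> 0" using \<open>\<alpha> > 2 * M0\<close> M0 by simp
      show "\<alpha> \<le> op_norm J (\<lambda>i j. indicator F (i, j))" if "F \<in> G" for F
        unfolding \<alpha>_def using that G(3) by (intro Min_le) auto
      show "vertices F \<inter> vertices F' = {}" if "F \<in> G" "F' \<in> G" "F \<noteq> F'" for F F'
        using that G(1) Fam(1) unfolding fam_def by blast
    qed (use big fin nonempty in \<open>auto simp: big_def\<close>)
    also have "\<dots> \<le> M0"
      unfolding M0_def by (rule expected_op_norm_mono[OF J]) (use big in \<open>auto simp: big_def\<close>)
    finally show False using \<open>\<alpha> > 2 * M0\<close> by simp
  qed
  define I where "I = (\<Union>F\<in>Fam. vertices F)"
  have bigFam: "big F" if "F \<in> Fam" for F using that Fam(1) by (auto simp: fam_def)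
  show ?thesis
  proof (rule that[of I])
    show "I \<subseteq> J"
      unfolding I_def using bigFam E by (fastforce simp: big_def vertices_def)
    have "card I \<le> (\<Sum>F\<in>Fam. card (vertices F))" unfolding I_def by (rule card_UN_le[OF finFam])
    also have "\<dots> \<le> (\<Sum>F\<in>Fam. 2 * q)"
    proof (rule sum_mono)
      fix F assume "F \<in> Fam"
      then have "big F" by (rule bigFam)
      then show "card (vertices F) \<le> 2 * q"
        using card_vertices_le[OF fin[OF \<open>big F\<close>]] by (simp add: big_def)
    qed
    also have "\<dots> = card Fam * (2 * q)" by simp
    \<comment> \<open>Fewer than \<open>2 ^ q\<close> members with at most \<open>2 * q\<close>
      vertices each, and \<open>2 * q \<le> 2 ^ q\<close>. This is why scales are matched as
      \<open>4 ^ q \<le> k\<close> later.\<close>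
    also have "\<dots> \<le> 2 ^ q * 2 ^ q"
    proof (rule mult_mono)
      show "2 * q \<le> 2 ^ q"
      proof -
        obtain k where "q = Suc k" using q by (metis Suc_le_D One_nat_def)
        moreover have "Suc k \<le> 2 ^ k" by (simp add: Suc_le_eq)
        ultimately show ?thesis by simp
      qed
    qed (use card_lt in auto)
    also have "\<dots> = 4 ^ q" by (simp flip: power_mult_distrib)
    finally show "card I \<le> 4 ^ q" .
  next
    fix F assume F: "F \<subseteq> E \<inter> ((J - I) \<times> (J - I))" "card F \<le> q"
    show "op_norm J (\<lambda>i j. indicator F (i, j)) \<le> 2 * expected_op_norm J (\<lambda>i j. indicator E (i, j))"
    proof (rule ccontr)
      assume "\<not> ?thesis"
      then have bigF: "big F" using F by (auto simp: big_def M0_def)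
      have VF: "vertices F \<inter> I = {}" using F(1) by (auto simp: vertices_def)
      \<comment> \<open>A member of the family has all its vertices in \<open>I\<close>. Having a
        vertex, \<open>F\<close> is therefore not a member, and inserting it contradicts
        maximality.\<close>
      have "vertices F \<noteq> {}" using nonempty[OF bigF] by (simp add: vertices_def)
      then have "F \<notin> Fam" using VF by (auto simp: I_def)
      moreover have "fam (insert F Fam)"
        using Fam(1) bigF VF unfolding fam_def I_def by blast
      ultimately show False using max[of "insert F Fam"] finFam by simp
    qed
  qed
qed

text \<open>For \<open>4 ^ q \<le> k < 4 ^ Suc q\<close> the removable set fits into
  \<open>k\<close>, and \<open>Log k \<le> 2 * q + 2 \<le> 4 * q\<close> is the range of the
  small-subgraph bound. That bound wants column degrees at most \<open>q\<close>, guaranteed by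
  \<open>\<delta>\<^sup>2 \<le> q\<close>; otherwise
  \<open>Log k \<le> (2 * \<delta>)\<^sup>2\<close> and Khintchine suffices with nothing removed.
  The constant is \<open>2 + 48 * 2\<close>.\<close>

theorem Q_le_expected_op_norm:
  assumes n: "n \<ge> 1" and E: "E \<subseteq> {1..n} \<times> {1..n}"
  shows "Q_quantity n E \<le> 98 * expected_op_norm {1..n} (\<lambda>i j. indicator E (i, j))"
proof -
  let ?J = "{1..n}"
  let ?a = "\<lambda>i j. indicator E (i, j) :: real"
  define M0 where "M0 = expected_op_norm ?J ?a"
  define \<delta> where "\<delta> = max_row ?J ?a + max_col ?J ?a"
  have J: "finite ?J" "?J \<noteq> {}" using n by auto
  have a01: "?a i j \<in> {0, 1}" for i j by (simp add: indicator_def)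
  have M0: "M0 \<ge> 0" unfolding M0_def by (rule const_le_expected_op_norm[OF J(1)]) (rule op_norm_nonneg[OF J(1)])
  have \<delta>: "\<delta> \<le> 2 * M0"
    using max_row_le_expected_op_norm[OF J, of ?a] max_col_le_expected_op_norm[OF J, of ?a]
    by (simp add: \<delta>_def M0_def)
  have "tail_max n E \<le> 96 * M0"
  proof (rule tail_max_le[OF n])
    fix k assume k: "k \<in> {1..n}"
    show "\<exists>I. I \<subseteq> ?J \<and> card I \<le> k \<and> tail_norm n E k I \<le> 96 * M0"
    proof (cases "E = {}")
      case True
      have "tail_norm n E k {} \<le> 96 * M0"
        by (rule tail_norm_le) (use M0 True in \<open>simp add: bform_def Lp_norm_def\<close>)
      then show ?thesis by (intro exI[of _ "{}"]) auto
    next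
      case False
      then obtain i0 j0 where "(i0, j0) \<in> E" by auto
      then have \<delta>1: "\<delta> \<ge> 1" using max_row_col_ge_1[OF J(1), of i0 j0 ?a] E by (auto simp: \<delta>_def)
      obtain q where q: "4 ^ q \<le> k" "k < 4 ^ Suc q"
        using ex_power_ivl1[of 4 k] k by auto
      have Log_k: "Log (real k) \<le> 2 * real q + 2"
      proof -
        have "real k \<le> 4 ^ Suc q" using q(2) by (metis of_nat_le_iff of_nat_numeral of_nat_power less_imp_le)
        moreover have "exp 1 \<le> (4::real) ^ Suc q"
        proof -
          have "exp 1 \<le> (4::real) * 1" using exp_le by simp
          also have "\<dots> \<le> 4 * 4 ^ q" by (intro mult_left_mono) auto
          finally show ?thesis by simp
        qed
        ultimately have "Log (real k) \<le> ln (4 ^ Suc q)"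
          unfolding Log_def by (subst ln_le_cancel_iff) (auto simp: less_max_iff_disj)
        also have "\<dots> = real (Suc q) * ln (2 ^ 2)" by (subst ln_realpow) auto
        also have "\<dots> = real (Suc q) * (2 * ln 2)" by (subst ln_realpow) auto
        also have "\<dots> \<le> real (Suc q) * 2" using ln2_le_25_over_36 by (intro mult_left_mono) auto
        finally show ?thesis by simp
      qed
      show ?thesis
      proof (cases "\<delta>\<^sup>2 \<le> real q")
        case False
        have "tail_norm n E k {} \<le> 2 * sqrt (Log (real k))"
          by (rule tail_norm_le) (use Lp_norm_bform_le[OF J(1) Log_ge_1 abs_indicator_le_1] in simp)
        also have "\<dots> \<le> 2 * (2 * \<delta>)"
        proof -
          have "Log (real k) \<le> (2 * \<delta>)\<^sup>2"
            using Log_k False one_le_power[OF \<delta>1, of 2] by (simp add: power_mult_distrib)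
          then show ?thesis using \<delta>1 by (intro mult_left_mono real_le_lsqrt) auto
        qed
        also have "\<dots> \<le> 96 * M0" using \<delta> M0 by simp
        finally show ?thesis by (intro exI[of _ "{}"]) auto
      next
        case True
        then have q1: "q \<ge> 1" using one_le_power[OF \<delta>1, of 2] by linarith
        obtain I where I: "I \<subseteq> ?J" "card I \<le> 4 ^ q"
          "\<And>F. F \<subseteq> E \<inter> ((?J - I) \<times> (?J - I)) \<Longrightarrow> card F \<le> q \<Longrightarrow>
            op_norm ?J (\<lambda>i j. indicator F (i, j)) \<le> 2 * M0"
          using exists_removable_set[OF J(1) E q1] unfolding M0_def by metis
        have fin: "finite (?J - I)" by simp
        have "tail_norm n E k I \<le> 48 * (2 * M0)"
        proof (rule tail_norm_le)
          fix s t assume st: "L2_set s ?J \<le> 1" "L2_set t ?J \<le> 1"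
          have st': "L2_set s (?J - I) \<le> 1" "L2_set t (?J - I) \<le> 1"
            using st L2_set_subset[of ?J "?J - I"] by (auto intro: order.trans)
          have "Log (real k) \<le> 4 * real q" using Log_k q1 by simp
          then show "Lp_norm (Log (real k)) (\<lambda>\<omega>. bform (?J - I) (\<lambda>i j. ?a i j * eps i j \<omega>) s t) \<le> 48 * (2 * M0)"
          proof (rule Lp_norm_le_of_small_subgraphs[OF fin q1 Log_ge_1 _ _ _ _ st'])
            fix j assume j: "j \<in> ?J - I"
            have "card {i \<in> ?J - I. (i, j) \<in> E} \<le> card {i \<in> ?J. ?a i j = 1}"
              by (intro card_mono) auto
            also have "real \<dots> \<le> \<delta>\<^sup>2"
              using degrees_le_max_row_col(2)[OF J a01, of j] j by (simp add: \<delta>_def)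
            finally show "card {i \<in> ?J - I. (i, j) \<in> E} \<le> q" using True by simp
          next
            fix F u v
            assume F: "F \<subseteq> E \<inter> ((?J - I) \<times> (?J - I))" "card F \<le> q"
              and uv: "L2_set u (?J - I) \<le> 1" "L2_set v (?J - I) \<le> 1"
            let ?u = "\<lambda>i. if i \<in> ?J - I then u i else 0" and ?v = "\<lambda>j. if j \<in> ?J - I then v j else 0"
            have "(\<Sum>e\<in>F. u (fst e) * v (snd e)) = (\<Sum>e\<in>?J \<times> ?J. indicator F e * ?u (fst e) * ?v (snd e))"
              by (rule sum.mono_neutral_cong_left) (use F in auto)
            also have "\<dots> = bform ?J (\<lambda>i j. indicator F (i, j)) ?u ?v"
              unfolding bform_def sum.cartesian_product by (simp add: case_prod_beta')
            also have "\<dots> \<le> op_norm ?J (\<lambda>i j. indicator F (i, j))"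
              by (rule bform_le_op_norm) (use uv in \<open>simp_all only: L2_set_restrict[OF J(1) Diff_subset] finite_atLeastAtMost\<close>)
            also have "\<dots> \<le> 2 * M0" by (rule I(3)[OF F])
            finally show "(\<Sum>e\<in>F. u (fst e) * v (snd e)) \<le> 2 * M0" .
          qed (use M0 in auto)
        qed
        then show ?thesis using I q(1) by (intro exI[of _ I]) auto
      qed
    qed
  qed
  then show ?thesis using \<delta> by (simp add: Q_quantity_eq \<delta>_def M0_def)
qed

theorem theorem1p1:
  shows "\<exists>C::real. C \<ge> 1 \<and>
    (\<forall>(m::nat) (b :: nat \<Rightarrow> nat \<Rightarrow> real).
       m \<ge> 1 \<and> (\<forall>i\<in>{1..m}. \<forall>j\<in>{1..m}. b i j \<in> {0, 1}) \<longrightarrow>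
       expected_op_norm {1..m} b \<le> C * (max_row {1..m} b + max_col {1..m} b + R_norm {1..m} b (Log (real m)))) \<and>
    (\<forall>(n::nat) (E :: (nat \<times> nat) set).
       n \<ge> 1 \<and> E \<subseteq> {1..n} \<times> {1..n} \<longrightarrow>
       inverse C * Q_quantity n E \<le> expected_op_norm {1..n} (\<lambda>i j. indicator E (i, j)) \<and>
       expected_op_norm {1..n} (\<lambda>i j. indicator E (i, j)) \<le> C * Q_quantity n E)"
\<comment> \<open>One constant for three bounds: \<open>4 * op_const\<close> in the first statement,
  98 and \<open>80 * op_const\<close> for the two sides of the second.\<close>
proof (intro exI[of _ "98 * op_const"] conjI allI impI)
  show "98 * op_const \<ge> 1" using op_const_ge_1 by simp
next
  fix m :: nat and b :: "nat \<Rightarrow> nat \<Rightarrow> real"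
  assume mb: "m \<ge> 1 \<and> (\<forall>i\<in>{1..m}. \<forall>j\<in>{1..m}. b i j \<in> {0, 1})"
  let ?R = "max_row {1..m} b + max_col {1..m} b + R_norm {1..m} b (Log (real m))"
  have "?R \<ge> 0"
  proof (intro add_nonneg_nonneg max_row_nonneg max_col_nonneg R_norm_nonneg Log_ge_1)
    fix i j assume "i \<in> {1..m}" "j \<in> {1..m}"
    then have "b i j = 0 \<or> b i j = 1" using mb by auto
    then show "\<bar>b i j\<bar> \<le> 1" by auto
  qed (use mb in auto)
  then have "4 * op_const * ?R \<le> 98 * op_const * ?R"
    using op_const_ge_1 by (intro mult_right_mono) auto
  moreover have "expected_op_norm {1..m} b \<le> 4 * op_const * ?R"
    by (rule expected_op_norm_le_R_norm) (use mb in auto)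
  ultimately show "expected_op_norm {1..m} b \<le> 98 * op_const * ?R" by linarith
next
  fix n :: nat and E :: "(nat \<times> nat) set"
  assume nE: "n \<ge> 1 \<and> E \<subseteq> {1..n} \<times> {1..n}"
  let ?M = "expected_op_norm {1..n} (\<lambda>i j. indicator E (i, j))"
  have M: "?M \<ge> 0" by (rule const_le_expected_op_norm) (auto intro: op_norm_nonneg)
  have "Q_quantity n E \<le> 98 * ?M" using nE by (intro Q_le_expected_op_norm) auto
  also have "\<dots> \<le> 98 * op_const * ?M" using op_const_ge_1 M by (intro mult_right_mono) auto
  finally show "inverse (98 * op_const) * Q_quantity n E \<le> ?M"
    using op_const_ge_1 by (simp add: field_simps)
  have "?M \<le> 80 * op_const * Q_quantity n E" using nE by (intro expected_op_norm_le_Q) auto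
  moreover have "Q_quantity n E \<ge> 0"
    using nE max_row_nonneg[of "{1..n}"] max_col_nonneg[of "{1..n}"] tail_max_nonneg[of n E]
    by (auto simp: Q_quantity_eq intro!: add_nonneg_nonneg)
  then have "80 * op_const * Q_quantity n E \<le> 98 * op_const * Q_quantity n E"
    using op_const_ge_1 by (intro mult_right_mono) auto
  ultimately show "?M \<le> 98 * op_const * Q_quantity n E" by linarith
qed

end
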